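(* Let $L,M,N,R\in\mathbb{N}$, let $p,q\in\mathbb{N}$ be coprime with $N/M=p/q$, let $\mathbb{S}\subset\mathbb{Z}$ be an $N\mathbb{Z}$-periodic set, let $g=\{g_l\}_{l\in\mathbb{N}_L}\subset\ell^2(\mathbb{S},\mathbb{C}^R)$, and let $0<A\le B$ be real numbers. The following statements are equivalent. (1) $\mathcal{G}(g,L,M,N,R)$ is a frame for $\ell^2(\mathbb{S},\mathbb{C}^R)$ with frame bounds $A\le B$. (2) For all $j\in\mathbb{N}_{M/q}$ and a.e. $\theta\in[0,1)$, $$\frac{A}{M}\, I_R\otimes\mathcal{K}(j)\ \le\ \sum_{l\in\mathbb{N}_L}Z_{g_l}^*(j,\theta)Z_{g_l}(j,\theta)\ \le\ \frac{B}{M}\, I_R\otimes\mathcal{K}(j).$$ (3) The inequalities displayed in (2) hold for all $j\in\mathbb{N}_M$ and a.e. $\theta\in[0,1)$.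
   Context: $\mathbb{N}=\{1,2,3,\dots\}$ and $\mathbb{N}_K=\{0,1,\dots,K-1\}$. A nonempty set $\mathbb{S}\subset\mathbb{Z}$ is $N\mathbb{Z}$-periodic if $j+nN\in\mathbb{S}$ for all $j\in\mathbb{S}$, $n\in\mathbb{Z}$. $\ell^2(\mathbb{S})=\{f\in\ell^2(\mathbb{Z}): f(j)=0 \text{ if } j\notin\mathbb{S}\}$, and $\ell^2(\mathbb{S},\mathbb{C}^R)$ is the Hilbert space of $f=(f_1,\dots,f_R)$ with $f_r\in\ell^2(\mathbb{S})$ and inner product $\sum_{r=1}^R\langle f_r,\tilde f_r\rangle$. Operators (componentwise): $E_{m/M}f(j)=e^{2\pi i mj/M}f(j)$, $T_{nN}f(j)=f(j-nN)$. $\mathcal{G}(g,L,M,N,R)=\{E_{m/M}T_{nN}g_l\}_{m\in\mathbb{N}_M,\,n\in\mathbb{Z},\,l\in\mathbb{N}_L}$. A countable family $\{f_i\}$ in a Hilbert space $\mathcal{U}$ is a frame with frame bounds $0<A\le B<\infty$ if $A\|f\|^2\le\sum_i|\langle f,f_i\rangle|^2\le B\|f\|^2$ for all $f\in\mathcal{U}$ (bounds need not be optimal). Zak transform: $z_Kh(j,\theta)=\sum_{k\in\mathbb{Z}}h(j+kK)e^{2\pi i k\theta}$ for $h\in\ell^2(\mathbb{Z})$, $j\in\mathbb{Z}$, a.e. $\theta\in\mathbb{R}$ (convergence in $L^2([0,1))$). For $h\in\ell^2(\mathbb{Z})$, $Z_h(j,\theta)$ is the $q\times p$ matrix with entries $z_{pM}h(j+kM-rN,\theta)$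 ($r\in\mathbb{N}_q$ row, $k\in\mathbb{N}_p$ column). For $f=(f_1,\dots,f_R)$, $Z_f(j,\theta)=(Z_{f_1}(j,\theta),\dots,Z_{f_R}(j,\theta))$, a $q\times pR$ matrix; $Z^*$ is the conjugate transpose. $\mathcal{K}_j=\{k\in\mathbb{N}_p: j+kM\in\mathbb{S}\}$, $\mathcal{K}(j)=\operatorname{diag}(\chi_{\mathcal{K}_j}(0),\dots,\chi_{\mathcal{K}_j}(p-1))$, and $I_R\otimes\mathcal{K}(j)$ is the $pR\times pR$ block diagonal matrix with $R$ diagonal blocks equal to $\mathcal{K}(j)$. Inequalities between Hermitian matrices are in the positive semidefinite order. *)

theory Defs
  imports "HOL-Analysis.Analysis" "Jordan_Normal_Form.Schur_Decomposition"
begin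

no_notation vec_index (infixl \<open>$\<close> 100)
no_notation scalar_prod (infix \<open>\<bullet>\<close> 70)

section \<open>The space \<open>\<ell>\<^sup>2(S, \<complex>\<^sup>R)\<close>\<close>

definition periodic_set :: "nat \<Rightarrow> int set \<Rightarrow> bool" where
  "periodic_set N S \<longleftrightarrow> S \<noteq> {} \<and> (\<forall>j\<in>S. \<forall>n::int. j + n * int N \<in> S)"

definition ell2 :: "int set \<Rightarrow> (int \<Rightarrow> complex) set" where
  "ell2 S = {f. (\<lambda>j. (cmod (f j))\<^sup>2) summable_on UNIV \<and> (\<forall>j. j \<notin> S \<longrightarrow> f j = 0)}"

definition ell2_inner :: "(int \<Rightarrow> complex) \<Rightarrow> (int \<Rightarrow> complex) \<Rightarrow> complex" where
  "ell2_inner f h = (\<Sum>\<^sub>\<infinity>j\<in>UNIV. f j * cnj (h j))"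

text \<open>An \<open>R\<close>-tuple of sequences is a function on \<open>nat\<close> whose components are numbered
  \<open>0, \<dots>, R - 1\<close>.  The components with index \<open>\<ge> R\<close> are required to vanish, so that each tuple
  has exactly one representation.\<close>

definition ell2_vec :: "int set \<Rightarrow> nat \<Rightarrow> (nat \<Rightarrow> int \<Rightarrow> complex) set" where
  "ell2_vec S R = {f. (\<forall>r<R. f r \<in> ell2 S) \<and> (\<forall>r\<ge>R. f r = (\<lambda>_. 0))}"

definition ell2_vec_inner ::
    "nat \<Rightarrow> (nat \<Rightarrow> int \<Rightarrow> complex) \<Rightarrow> (nat \<Rightarrow> int \<Rightarrow> complex) \<Rightarrow> complex" where
  "ell2_vec_inner R f h = (\<Sum>r<R. ell2_inner (f r) (h r))"

section \<open>Frames and Gabor systems\<close>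

text \<open>\<open>U\<close> is the carrier of a Hilbert space with inner product \<open>ip\<close>, so \<open>Re (ip f f)\<close> is
  \<open>\<parallel>f\<parallel>\<^sup>2\<close>.  Summability is stated explicitly, since a divergent \<open>infsum\<close> is \<open>0\<close>.\<close>

definition is_frame ::
    "'h set \<Rightarrow> ('h \<Rightarrow> 'h \<Rightarrow> complex) \<Rightarrow> 'i set \<Rightarrow> ('i \<Rightarrow> 'h) \<Rightarrow> real \<Rightarrow> real \<Rightarrow> bool" where
  "is_frame U ip I \<phi> A B \<longleftrightarrow>
     countable I \<and> (\<forall>i\<in>I. \<phi> i \<in> U) \<and> 0 < A \<and> A \<le> B \<and>
     (\<forall>f\<in>U. (\<lambda>i. (cmod (ip f (\<phi> i)))\<^sup>2) summable_on I \<and>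
        A * Re (ip f f) \<le> (\<Sum>\<^sub>\<infinity>i\<in>I. (cmod (ip f (\<phi> i)))\<^sup>2) \<and>
        (\<Sum>\<^sub>\<infinity>i\<in>I. (cmod (ip f (\<phi> i)))\<^sup>2) \<le> B * Re (ip f f))"

definition modulation :: "real \<Rightarrow> (nat \<Rightarrow> int \<Rightarrow> complex) \<Rightarrow> nat \<Rightarrow> int \<Rightarrow> complex" where
  "modulation a f = (\<lambda>r j. exp (2 * of_real pi * \<i> * of_real a * of_int j) * f r j)"

definition translation :: "int \<Rightarrow> (nat \<Rightarrow> int \<Rightarrow> complex) \<Rightarrow> nat \<Rightarrow> int \<Rightarrow> complex" where
  "translation s f = (\<lambda>r j. f r (j - s))"

definition gabor_index :: "nat \<Rightarrow> nat \<Rightarrow> (nat \<times> int \<times> nat) set" where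
  "gabor_index L M = {..<M} \<times> UNIV \<times> {..<L}"

definition gabor ::
    "nat \<Rightarrow> nat \<Rightarrow> (nat \<Rightarrow> nat \<Rightarrow> int \<Rightarrow> complex) \<Rightarrow> nat \<times> int \<times> nat \<Rightarrow> nat \<Rightarrow> int \<Rightarrow> complex" where
  "gabor M N g = (\<lambda>(m, n, l). modulation (real m / real M) (translation (n * int N) (g l)))"

section \<open>Zak transform\<close>

text \<open>\<open>F\<close> represents \<open>z\<^sub>Kh(j, \<cdot>)\<close>: it is the \<open>1\<close>-periodic \<open>L\<^sup>2\<close>-limit of the (unconditionally
  convergent) series.  For square summable \<open>h\<close> and \<open>K \<ge> 1\<close> such an \<open>F\<close> exists (Riesz-Fischer)
  and is unique up to null sets; \<open>zak\<close> chooses one representative.\<close>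

definition is_zak :: "nat \<Rightarrow> (int \<Rightarrow> complex) \<Rightarrow> int \<Rightarrow> (real \<Rightarrow> complex) \<Rightarrow> bool" where
  "is_zak K h j F \<longleftrightarrow>
     F \<in> borel_measurable borel \<and> (\<forall>\<theta>. F (\<theta> + 1) = F \<theta>) \<and>
     ((\<lambda>T. \<integral>\<^sup>+\<theta>\<in>{0..<1}. ennreal ((cmod
          (F \<theta> - (\<Sum>k\<in>T. h (j + k * int K) * exp (2 * of_real pi * \<i> * of_int k * of_real \<theta>))))\<^sup>2)
          \<partial>lborel)
        \<longlongrightarrow> 0) (finite_subsets_at_top (UNIV :: int set))"

definition zak :: "nat \<Rightarrow> (int \<Rightarrow> complex) \<Rightarrow> int \<Rightarrow> real \<Rightarrow> complex" where
  "zak K h j = (SOME F. is_zak K h j F)"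

definition zak_mat ::
    "nat \<Rightarrow> nat \<Rightarrow> nat \<Rightarrow> nat \<Rightarrow> (int \<Rightarrow> complex) \<Rightarrow> int \<Rightarrow> real \<Rightarrow> complex Matrix.mat" where
  "zak_mat p q M N h j \<theta> =
     Matrix.mat q p (\<lambda>(r, k). zak (p * M) h (j + int k * int M - int r * int N) \<theta>)"

text \<open>The blocks \<open>Z f\<^sub>1, \<dots>, Z f\<^sub>R\<close> side by side: column \<open>c\<close> is column \<open>c mod p\<close> of the block with
  (zero-based) number \<open>c div p\<close>.\<close>

definition zak_mat_vec ::
    "nat \<Rightarrow> nat \<Rightarrow> nat \<Rightarrow> nat \<Rightarrow> nat \<Rightarrow> (nat \<Rightarrow> int \<Rightarrow> complex) \<Rightarrow> int \<Rightarrow> real \<Rightarrow> complex Matrix.mat" where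
  "zak_mat_vec p q M N R f j \<theta> =
     Matrix.mat q (p * R) (\<lambda>(r, c). zak_mat p q M N (f (c div p)) j \<theta> $$ (r, c mod p))"

section \<open>The matrices in the characterization\<close>

definition K_set :: "nat \<Rightarrow> nat \<Rightarrow> int set \<Rightarrow> int \<Rightarrow> nat set" where
  "K_set p M S j = {k. k < p \<and> j + int k * int M \<in> S}"

definition K_mat :: "nat \<Rightarrow> nat \<Rightarrow> int set \<Rightarrow> int \<Rightarrow> complex Matrix.mat" where
  "K_mat p M S j = mat_diag p (indicator (K_set p M S j))"

definition I_tensor :: "nat \<Rightarrow> complex Matrix.mat \<Rightarrow> complex Matrix.mat" where
  "I_tensor R D = diag_block_mat (replicate R D)"

text \<open>Matrices whose dimension is not a type do not form a monoid, hence the explicit fold.\<close>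

definition zak_gram ::
    "nat \<Rightarrow> nat \<Rightarrow> nat \<Rightarrow> nat \<Rightarrow> nat \<Rightarrow> nat \<Rightarrow> (nat \<Rightarrow> nat \<Rightarrow> int \<Rightarrow> complex) \<Rightarrow> int \<Rightarrow> real
      \<Rightarrow> complex Matrix.mat" where
  "zak_gram p q L M N R g j \<theta> =
     foldr (+) (map (\<lambda>l. mat_adjoint (zak_mat_vec p q M N R (g l) j \<theta>)
                         * zak_mat_vec p q M N R (g l) j \<theta>) [0..<L])
       (0\<^sub>m (p * R) (p * R))"

definition hermitian_mat :: "nat \<Rightarrow> complex Matrix.mat \<Rightarrow> bool" where
  "hermitian_mat n D \<longleftrightarrow> D \<in> carrier_mat n n \<and> mat_adjoint D = D"

definition psd_mat :: "nat \<Rightarrow> complex Matrix.mat \<Rightarrow> bool" where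
  "psd_mat n D \<longleftrightarrow> hermitian_mat n D \<and> (\<forall>v\<in>carrier_vec n. 0 \<le> Re ((D *\<^sub>v v) \<bullet>c v))"

definition loewner_le :: "nat \<Rightarrow> complex Matrix.mat \<Rightarrow> complex Matrix.mat \<Rightarrow> bool" where
  "loewner_le n C D \<longleftrightarrow> hermitian_mat n C \<and> hermitian_mat n D \<and> psd_mat n (D - C)"

end

theory Submission
  imports Defs
begin

text \<open>The Zak transform diagonalises the problem.  Writing \<open>n = s + q t\<close>, the inner products of \<open>f\<close>
  with the Gabor system are, up to a discrete Fourier transform in \<open>m\<close> over the residues
  \<open>j mod M\<close>, the \<open>t\<close>-th Fourier coefficients of \<open>\<Sum>\<^sub>r\<^sub>,\<^sub>k z f\<^sub>r(j + k M) cnj (z g\<^sub>l\<^sub>r(j + k M - s N))\<close>.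
  Two applications of Parseval, one finite and one on \<open>[0,1)\<close>, thus turn the frame sum into
  \<open>M \<Sum>\<^sub>j \<integral> \<Sum>\<^sub>l \<parallel>Z\<^bsub>g_l\<^esub>(j,\<theta>) v(\<theta>)\<parallel>\<^sup>2 d\<theta>\<close>, where \<open>v\<close> collects the conjugated Zak transforms of \<open>f\<close>,
  while \<open>\<parallel>f\<parallel>\<^sup>2 = \<Sum>\<^sub>j \<integral> \<parallel>v(\<theta>)\<parallel>\<^sup>2 d\<theta>\<close>.  Integrating the matrix inequalities gives the frame inequalities;
  conversely, testing with \<open>v = \<chi>\<^sub>E v\<^sub>0\<close> for Borel sets \<open>E\<close> and rational vectors \<open>v\<^sub>0\<close> localises them.
  Quasi-periodicity of the Zak transform transports the inequalities from \<open>j\<close> to \<open>j + M\<close> and \<open>j - N\<close>,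
  and \<open>gcd(M,N) = M/q\<close>.\<close>

section \<open>Fourier coefficients on the unit interval\<close>

text \<open>The Zak transform is available only as a chosen representative of an L2 limit, so
  identities about it hold almost everywhere and rest on two facts about Fourier series: existence
  of the limit, and uniqueness of an integrable function with given coefficients. The function whose
  coefficients enter the frame sum is a finite sum of products of two square integrable functions,
  hence known only to be integrable, and the frame sum may be infinite before a bound is known; this
  is why Parseval is needed with values in [0, \<infinity>]. The residue \<open>s\<close> appears
  because \<open>q * N = p * M\<close>: \<open>q\<close> translations by \<open>N\<close> make one
  period of the Zak transform, so \<open>s\<close> numbers the rows and \<open>t\<close> becomes a
  frequency. The factor \<open>M\<close> is that of the unnormalised discrete Fourier transform,
  whence the bounds \<open>A / M\<close> and \<open>B / M\<close>. The test vectors are rational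
  because each vector comes with its own null set and only countably many can be united; continuity
  of both quadratic forms supplies the rest. The projection \<open>K_mat\<close> reflects that Zak
  transforms of sequences on \<open>S\<close> vanish in the columns outside
  \<open>K_set\<close>.\<close>

abbreviation unit_lebesgue :: "real measure" (\<open>\<mu>\<close>) where
  "\<mu> \<equiv> restrict_space lborel {0..<1::real}"

lemma space_unit_lebesgue: "space \<mu> = {0..<1}"
  by (simp add: space_restrict_space)

lemma borel_measurable_unit_lebesgue:
  "f \<in> borel_measurable borel \<Longrightarrow> f \<in> borel_measurable \<mu>"
  by (rule measurable_restrict_space1) simp

lemma emeasure_unit_lebesgue: "emeasure \<mu> (space \<mu>) = 1"
  by (simp add: space_unit_lebesgue emeasure_restrict_space)

interpretation unit_lebesgue: finite_measure \<mu>
  by (rule finite_measureI) (simp only: emeasure_unit_lebesgue, simp)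

lemma integrable_unit_lebesgue_bounded:
  fixes f :: "real \<Rightarrow> 'b::{banach, second_countable_topology}"
  assumes "f \<in> borel_measurable \<mu>" "\<And>x. norm (f x) \<le> B"
  shows "integrable \<mu> f"
  using assms by (intro unit_lebesgue.integrable_const_bound[of _ B]) auto

section \<open>Characters of the circle and their integrals\<close>

definition fexp :: "int \<Rightarrow> real \<Rightarrow> complex" where
  "fexp k \<theta> = exp (2 * of_real pi * \<i> * of_int k * of_real \<theta>)"

lemma fexp_0 [simp]: "fexp 0 = (\<lambda>_. 1)"
  by (simp add: fexp_def fun_eq_iff)

lemma fexp_add: "fexp (k + l) \<theta> = fexp k \<theta> * fexp l \<theta>"
  by (simp add: fexp_def algebra_simps flip: exp_add)

lemma cnj_fexp [simp]: "cnj (fexp k \<theta>) = fexp (- k) \<theta>"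
  by (simp add: fexp_def exp_cnj)

lemma norm_fexp [simp]: "cmod (fexp k \<theta>) = 1"
  by (simp add: fexp_def norm_exp_eq_Re)

lemma fexp_plus_1 [simp]: "fexp k (\<theta> + 1) = fexp k \<theta>"
proof -
  have "fexp k (\<theta> + 1) = fexp k \<theta> * exp (2 * of_real (of_int k) * of_real pi * \<i>)"
    by (simp only: fexp_def flip: exp_add) (simp add: algebra_simps)
  also have "exp (2 * of_real (of_int k) * of_real pi * \<i>) = (1 :: complex)"
    using exp_integer_2pi[of "of_int k"] by simp
  finally show ?thesis by simp
qed

lemma measurable_fexp [measurable]: "fexp k \<in> borel_measurable borel"
  unfolding fexp_def by (intro borel_measurable_continuous_onI continuous_intros)

lemma measurable_fexp_unit_lebesgue [measurable]: "fexp k \<in> borel_measurable \<mu>"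
  by (simp add: borel_measurable_unit_lebesgue)

lemma integrable_fexp [simp]: "integrable \<mu> (fexp k)"
  by (rule integrable_unit_lebesgue_bounded[of _ 1]) (auto intro: borel_measurable_unit_lebesgue)

lemma integrable_fexp_mult [intro]:
  assumes "integrable \<mu> H" shows "integrable \<mu> (\<lambda>\<theta>. H \<theta> * fexp k \<theta>)"
proof -
  have [measurable]: "H \<in> borel_measurable \<mu>" using assms by simp
  show ?thesis
    by (rule Bochner_Integration.integrable_bound[OF assms]) (measurable, simp add: norm_mult)
qed

lemma integral_fexp: "(\<integral>\<theta>. fexp k \<theta> \<partial>\<mu>) = (if k = 0 then 1 else 0)"
proof (cases "k = 0")
  case True
  then show ?thesis
    by (simp add: measure_def space_unit_lebesgue emeasure_restrict_space)
next
  case False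
  let ?c = "2 * of_real pi * \<i> * of_int k :: complex"
  define G where "G \<theta> = fexp k \<theta> / ?c" for \<theta>
  have c: "?c \<noteq> 0" using False by simp
  have D: "(G has_vector_derivative fexp k \<theta>) (at \<theta> within A)" for \<theta> A
  proof -
    have "((\<lambda>z. exp (?c * z) / ?c) has_field_derivative exp (?c * of_real \<theta>)) (at (of_real \<theta>))"
      using c by (auto intro!: derivative_eq_intros)
    from has_vector_derivative_real_field[OF this] show ?thesis
      unfolding G_def fexp_def by (simp add: o_def has_vector_derivative_at_within mult_ac)
  qed
  have "(\<integral>\<theta>. fexp k \<theta> \<partial>\<mu>) = (\<integral>\<theta>. indicator {0..<1} \<theta> *\<^sub>R fexp k \<theta> \<partial>lborel)"
    by (rule integral_restrict_space) simp
  \<comment> \<open>The fundamental theorem of calculus is applied on the closed interval; the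
    endpoint 1 is a null set.\<close>
  also have "\<dots> = (\<integral>\<theta>. indicator {0..1} \<theta> *\<^sub>R fexp k \<theta> \<partial>lborel)"
  proof (rule integral_cong_AE)
    show "AE \<theta> in lborel. indicator {0..<1} \<theta> *\<^sub>R fexp k \<theta> = indicator {0..1} \<theta> *\<^sub>R fexp k \<theta>"
      using AE_lborel_singleton[of "1::real"] by eventually_elim (auto simp: indicator_def)
  qed measurable
  also have "\<dots> = G 1 - G 0"
    by (rule integral_FTC_atLeastAtMost)
       (auto simp: fexp_def intro!: D[unfolded fexp_def] continuous_intros)
  also have "\<dots> = 0"
    using fexp_plus_1[of k 0] by (simp add: G_def)
  finally show ?thesis using False by simp
qed

section \<open>Fourier coefficients and trigonometric polynomials\<close>

definition fcoeff :: "(real \<Rightarrow> complex) \<Rightarrow> int \<Rightarrow> complex" where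
  "fcoeff H t = (\<integral>\<theta>. H \<theta> * fexp (- t) \<theta> \<partial>\<mu>)"

definition trig_sum :: "(int \<Rightarrow> complex) \<Rightarrow> int set \<Rightarrow> real \<Rightarrow> complex" where
  "trig_sum a T \<theta> = (\<Sum>k\<in>T. a k * fexp k \<theta>)"

lemma measurable_trig_sum [measurable]: "trig_sum a T \<in> borel_measurable borel"
  unfolding trig_sum_def by measurable

lemma trig_sum_bound: "cmod (trig_sum a T \<theta>) \<le> (\<Sum>k\<in>T. cmod (a k))"
  unfolding trig_sum_def by (rule order.trans[OF norm_sum]) (simp add: norm_mult)

lemma integrable_trig_sum [simp]: "integrable \<mu> (trig_sum a T)"
  by (rule integrable_unit_lebesgue_bounded[OF _ trig_sum_bound])
     (auto intro: borel_measurable_unit_lebesgue)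

lemma fcoeff_trig_sum:
  assumes "finite T" shows "fcoeff (trig_sum a T) t = (if t \<in> T then a t else 0)"
proof -
  have "fcoeff (trig_sum a T) t = (\<integral>\<theta>. (\<Sum>k\<in>T. a k * fexp (k - t) \<theta>) \<partial>\<mu>)"
    by (simp add: fcoeff_def trig_sum_def sum_distrib_right mult.assoc diff_conv_add_uminus fexp_add
        del: add_uminus_conv_diff)
  also have "\<dots> = (\<Sum>k\<in>T. a k * (if k = t then 1 else 0))"
    by (subst Bochner_Integration.integral_sum) (auto simp: integral_fexp)
  finally show ?thesis using assms by (simp add: if_distrib cong: if_cong)
qed

lemma fcoeff_diff:
  "integrable \<mu> F \<Longrightarrow> integrable \<mu> G \<Longrightarrow> fcoeff (\<lambda>\<theta>. F \<theta> - G \<theta>) t = fcoeff F t - fcoeff G t"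
  unfolding fcoeff_def left_diff_distrib
  by (intro Bochner_Integration.integral_diff integrable_fexp_mult)

lemma fcoeff_add:
  "integrable \<mu> F \<Longrightarrow> integrable \<mu> G \<Longrightarrow> fcoeff (\<lambda>\<theta>. F \<theta> + G \<theta>) t = fcoeff F t + fcoeff G t"
  unfolding fcoeff_def distrib_right
  by (intro Bochner_Integration.integral_add integrable_fexp_mult)

lemma fcoeff_cmult: "fcoeff (\<lambda>\<theta>. c * F \<theta>) t = c * fcoeff F t"
  by (simp add: fcoeff_def mult.assoc)

lemma fcoeff_fexp_mult: "fcoeff (\<lambda>\<theta>. fexp k \<theta> * F \<theta>) t = fcoeff F (t - k)"
  by (simp add: fcoeff_def mult_ac flip: fexp_add)

section \<open>Square integrable functions on the unit interval\<close>

definition square_integrable :: "(real \<Rightarrow> complex) \<Rightarrow> bool" where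
  "square_integrable F \<longleftrightarrow> F \<in> borel_measurable \<mu> \<and> integrable \<mu> (\<lambda>\<theta>. (cmod (F \<theta>))\<^sup>2)"

lemma square_integrable_iff:
  "square_integrable F \<longleftrightarrow> F \<in> borel_measurable \<mu> \<and> (\<integral>\<^sup>+\<theta>. ennreal ((cmod (F \<theta>))\<^sup>2) \<partial>\<mu>) < \<infinity>"
  by (auto simp: square_integrable_def integrable_iff_bounded)

lemma square_integrable_imp_integrable:
  assumes "square_integrable F" shows "integrable \<mu> F"
proof -
  have [measurable]: "F \<in> borel_measurable \<mu>" and i: "integrable \<mu> (\<lambda>\<theta>. (cmod (F \<theta>))\<^sup>2)"
    using assms by (auto simp: square_integrable_def)
  have "integrable \<mu> (\<lambda>\<theta>. (F \<theta>)\<^sup>2)"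
    by (rule Bochner_Integration.integrable_bound[OF i]) (measurable, simp add: norm_power)
  then show ?thesis
    by (rule unit_lebesgue.square_integrable_imp_integrable[rotated]) measurable
qed

lemma cmod_add_le_sq: "(cmod (x + y))\<^sup>2 \<le> 2 * (cmod x)\<^sup>2 + 2 * (cmod y)\<^sup>2"
proof -
  have "(cmod (x + y))\<^sup>2 \<le> (cmod x + cmod y)\<^sup>2"
    by (simp add: norm_triangle_ineq power_mono)
  also have "\<dots> = 2 * (cmod x)\<^sup>2 + 2 * (cmod y)\<^sup>2 - (cmod x - cmod y)\<^sup>2"
    by (simp add: power2_eq_square algebra_simps)
  also have "\<dots> \<le> 2 * (cmod x)\<^sup>2 + 2 * (cmod y)\<^sup>2"
    by simp
  finally show ?thesis .
qed

lemma measurable_cnj [measurable]: "cnj \<in> borel_measurable borel"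
  by (intro borel_measurable_continuous_onI continuous_intros)

lemma square_integrable_measurable: "square_integrable F \<Longrightarrow> F \<in> borel_measurable \<mu>"
  by (simp add: square_integrable_def)

lemma square_integrable_add:
  assumes "square_integrable F" "square_integrable G"
  shows "square_integrable (\<lambda>\<theta>. F \<theta> + G \<theta>)"
proof -
  have [measurable]: "F \<in> borel_measurable \<mu>" "G \<in> borel_measurable \<mu>"
    using assms by (auto simp: square_integrable_def)
  have i: "integrable \<mu> (\<lambda>\<theta>. 2 * (cmod (F \<theta>))\<^sup>2 + 2 * (cmod (G \<theta>))\<^sup>2)"
    using assms by (auto simp: square_integrable_def)
  have "integrable \<mu> (\<lambda>\<theta>. (cmod (F \<theta> + G \<theta>))\<^sup>2)"
    by (rule Bochner_Integration.integrable_bound[OF i]) (measurable, simp add: cmod_add_le_sq)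
  then show ?thesis
    by (simp add: square_integrable_def)
qed

lemma square_integrable_bounded:
  assumes [measurable]: "F \<in> borel_measurable \<mu>" and b: "\<And>\<theta>. cmod (F \<theta>) \<le> C"
  shows "square_integrable F"
proof -
  have "integrable \<mu> (\<lambda>\<theta>. (cmod (F \<theta>))\<^sup>2)"
    by (rule integrable_unit_lebesgue_bounded[of _ "C\<^sup>2"])
       (measurable, simp add: b power_mono)
  then show ?thesis by (simp add: square_integrable_def)
qed

lemma square_integrable_trig_sum [simp]: "square_integrable (trig_sum a T)"
  by (rule square_integrable_bounded[OF _ trig_sum_bound])
     (simp add: borel_measurable_unit_lebesgue)

lemma square_integrable_mult_bounded:
  assumes F: "square_integrable F" and [measurable]: "G \<in> borel_measurable \<mu>"
    and b: "\<And>\<theta>. cmod (G \<theta>) \<le> C"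
  shows "square_integrable (\<lambda>\<theta>. G \<theta> * F \<theta>)"
proof -
  have [measurable]: "F \<in> borel_measurable \<mu>"
    using F by (auto simp: square_integrable_def)
  have i: "integrable \<mu> (\<lambda>\<theta>. C\<^sup>2 * (cmod (F \<theta>))\<^sup>2)"
    using F by (auto simp: square_integrable_def)
  have "integrable \<mu> (\<lambda>\<theta>. (cmod (G \<theta> * F \<theta>))\<^sup>2)"
    by (rule Bochner_Integration.integrable_bound[OF i])
       (measurable, simp add: norm_mult power_mult_distrib b power_mono mult_right_mono)
  then show ?thesis by (simp add: square_integrable_def)
qed

lemma square_integrable_cmult: "square_integrable F \<Longrightarrow> square_integrable (\<lambda>\<theta>. c * F \<theta>)"
  by (rule square_integrable_mult_bounded[of _ "\<lambda>_. c" "cmod c"]) auto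

lemma square_integrable_diff:
  assumes "square_integrable F" "square_integrable G"
  shows "square_integrable (\<lambda>\<theta>. F \<theta> - G \<theta>)"
  using square_integrable_add[OF assms(1) square_integrable_cmult[OF assms(2), of "-1"]] by simp

lemma integrable_mult_cnj:
  assumes "square_integrable F" "square_integrable G"
  shows "integrable \<mu> (\<lambda>\<theta>. F \<theta> * cnj (G \<theta>))"
proof -
  have [measurable]: "F \<in> borel_measurable \<mu>" "G \<in> borel_measurable \<mu>"
    using assms by (auto simp: square_integrable_def)
  have i: "integrable \<mu> (\<lambda>\<theta>. (cmod (F \<theta>))\<^sup>2 + (cmod (G \<theta>))\<^sup>2)"
    using assms by (auto simp: square_integrable_def)
  have "2 * (x * y) \<le> x\<^sup>2 + y\<^sup>2" for x y :: real
    using sum_squares_bound[of x y] by simp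
  then have xy: "x * y \<le> x\<^sup>2 + y\<^sup>2" if "x \<ge> 0" "y \<ge> 0" for x y :: real
    using that by (smt (verit) mult_nonneg_nonneg)
  show ?thesis
    by (rule Bochner_Integration.integrable_bound[OF i])
       (measurable, simp add: norm_mult xy)
qed

text \<open>Adding a frequency \<open>k\<close> outside \<open>T\<close> subtracts
  \<open>c * fexp k\<close> from the residual \<open>G\<close>. By orthogonality \<open>G\<close>
  still has the coefficient \<open>c\<close> of \<open>H\<close> at \<open>k\<close>, so the cross
  term contributes -2|c|^2 and the new square +|c|^2, a net loss of |c|^2.\<close>

lemma fourier_residual:
  assumes H: "square_integrable H" and "finite T"
  shows "(\<integral>\<theta>. (cmod (H \<theta> - trig_sum (fcoeff H) T \<theta>))\<^sup>2 \<partial>\<mu>)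
    = (\<integral>\<theta>. (cmod (H \<theta>))\<^sup>2 \<partial>\<mu>) - (\<Sum>k\<in>T. (cmod (fcoeff H k))\<^sup>2)"
  using \<open>finite T\<close>
proof (induction T)
  case empty
  then show ?case by (simp add: trig_sum_def)
next
  case (insert k T)
  define G where "G \<theta> = H \<theta> - trig_sum (fcoeff H) T \<theta>" for \<theta>
  define c where "c = fcoeff H k"
  have G: "square_integrable G"
    unfolding G_def using H by (intro square_integrable_diff) auto
  have cG: "fcoeff G k = c"
    using insert.hyps H unfolding G_def c_def
    by (subst fcoeff_diff) (auto simp: fcoeff_trig_sum square_integrable_imp_integrable)
  have pt: "(cmod (H \<theta> - trig_sum (fcoeff H) (insert k T) \<theta>))\<^sup>2
    = (cmod (G \<theta>))\<^sup>2 - 2 * Re (cnj c * (G \<theta> * fexp (- k) \<theta>)) + (cmod c)\<^sup>2" for \<theta>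
  proof -
    have e: "(cmod (x - y))\<^sup>2 = (cmod x)\<^sup>2 - 2 * Re (cnj y * x) + (cmod y)\<^sup>2" for x y
      by (simp only: cmod_power2) (simp add: power2_eq_square algebra_simps)
    have "H \<theta> - trig_sum (fcoeff H) (insert k T) \<theta> = G \<theta> - c * fexp k \<theta>"
      using insert.hyps by (simp add: G_def c_def trig_sum_def)
    then show ?thesis
      by (simp add: e norm_mult mult_ac)
  qed
  have i1: "integrable \<mu> (\<lambda>\<theta>. (cmod (G \<theta>))\<^sup>2)"
    using G by (simp add: square_integrable_def)
  have i2: "integrable \<mu> (\<lambda>\<theta>. cnj c * (G \<theta> * fexp (- k) \<theta>))"
    using G by (intro integrable_mult_right integrable_fexp_mult square_integrable_imp_integrable)
  define h where "h \<theta> = Re (cnj c * (G \<theta> * fexp (- k) \<theta>))" for \<theta>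
  have h: "integrable \<mu> h" "(\<integral>\<theta>. h \<theta> \<partial>\<mu>) = Re (\<integral>\<theta>. cnj c * (G \<theta> * fexp (- k) \<theta>) \<partial>\<mu>)"
    unfolding h_def by (rule integrable_Re[OF i2], rule integral_Re[OF i2])
  have "(\<integral>\<theta>. (cmod (H \<theta> - trig_sum (fcoeff H) (insert k T) \<theta>))\<^sup>2 \<partial>\<mu>)
      = (\<integral>\<theta>. (cmod (G \<theta>))\<^sup>2 - 2 * h \<theta> + (cmod c)\<^sup>2 \<partial>\<mu>)"
    by (simp only: pt h_def)
  also have "\<dots> = (\<integral>\<theta>. (cmod (G \<theta>))\<^sup>2 \<partial>\<mu>) - 2 * (\<integral>\<theta>. h \<theta> \<partial>\<mu>) + (cmod c)\<^sup>2"
    using i1 h(1) by (simp add: measure_def emeasure_restrict_space space_unit_lebesgue)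
  also note h(2)
  also have "(\<integral>\<theta>. cnj c * (G \<theta> * fexp (- k) \<theta>) \<partial>\<mu>) = cnj c * c"
    by (simp flip: cG add: fcoeff_def)
  also have "Re (cnj c * c) = (cmod c)\<^sup>2"
    by (simp only: cmod_power2) (simp add: power2_eq_square)
  finally show ?case
    using insert by (simp add: G_def c_def)
qed

lemma bessel_inequality:
  assumes "square_integrable H" "finite T"
  shows "(\<Sum>k\<in>T. (cmod (fcoeff H k))\<^sup>2) \<le> (\<integral>\<theta>. (cmod (H \<theta>))\<^sup>2 \<partial>\<mu>)"
proof -
  have "0 \<le> (\<integral>\<theta>. (cmod (H \<theta> - trig_sum (fcoeff H) T \<theta>))\<^sup>2 \<partial>\<mu>)"
    by (rule Bochner_Integration.integral_nonneg) simp
  then show ?thesis using fourier_residual[OF assms] by simp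
qed

text \<open>A trigonometric sum over \<open>T\<close> is its own Fourier partial sum over
  \<open>T\<close>, so its residual is 0.\<close>

lemma norm_trig_sum:
  assumes "finite T"
  shows "(\<integral>\<theta>. (cmod (trig_sum a T \<theta>))\<^sup>2 \<partial>\<mu>) = (\<Sum>k\<in>T. (cmod (a k))\<^sup>2)"
proof -
  have "trig_sum (fcoeff (trig_sum a T)) T = trig_sum a T"
    using assms by (simp add: fun_eq_iff trig_sum_def[of _ T] fcoeff_trig_sum cong: sum.cong)
  with fourier_residual[of "trig_sum a T" T] assms show ?thesis
    by (simp add: fcoeff_trig_sum cong: sum.cong)
qed

text \<open>The coefficients cancel on the intersection of \<open>T\<close> and \<open>T'\<close>,
  so the distance between two partial sums is controlled by a tail of the series. This is the Cauchy
  estimate behind the Riesz-Fischer theorem.\<close>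

lemma norm_trig_sum_diff:
  assumes "finite T" "finite T'"
  shows "(\<integral>\<theta>. (cmod (trig_sum a T \<theta> - trig_sum a T' \<theta>))\<^sup>2 \<partial>\<mu>)
    = (\<Sum>k\<in>sym_diff T T'. (cmod (a k))\<^sup>2)"
proof -
  define b where "b k = (if k \<in> T then a k else 0) - (if k \<in> T' then a k else 0)" for k
  have "trig_sum a T \<theta> - trig_sum a T' \<theta> = trig_sum b (T \<union> T') \<theta>" for \<theta>
  proof -
    have "trig_sum a T \<theta> = (\<Sum>k\<in>T\<union>T'. (if k \<in> T then a k else 0) * fexp k \<theta>)"
      unfolding trig_sum_def using assms by (intro sum.mono_neutral_cong_left) auto
    moreover have "trig_sum a T' \<theta> = (\<Sum>k\<in>T\<union>T'. (if k \<in> T' then a k else 0) * fexp k \<theta>)"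
      unfolding trig_sum_def using assms by (intro sum.mono_neutral_cong_left) auto
    ultimately show ?thesis
      by (simp add: trig_sum_def b_def left_diff_distrib sum_subtractf)
  qed
  then have "(\<integral>\<theta>. (cmod (trig_sum a T \<theta> - trig_sum a T' \<theta>))\<^sup>2 \<partial>\<mu>)
      = (\<Sum>k\<in>T \<union> T'. (cmod (b k))\<^sup>2)"
    using assms by (simp add: norm_trig_sum)
  also have "\<dots> = (\<Sum>k\<in>sym_diff T T'. (cmod (a k))\<^sup>2)"
    using assms by (intro sum.mono_neutral_cong_right) (auto simp: b_def)
  finally show ?thesis .
qed

text \<open>The condition \<open>is_zak\<close> for an arbitrary coefficient sequence, freed from
  the progression \<open>j + k * int K\<close>. Borel measurability and the period 1 are kept so
  that \<open>is_zak\<close> becomes an instance.\<close>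

definition is_fourier :: "(int \<Rightarrow> complex) \<Rightarrow> (real \<Rightarrow> complex) \<Rightarrow> bool" where
  "is_fourier a F \<longleftrightarrow> F \<in> borel_measurable borel \<and> (\<forall>\<theta>. F (\<theta> + 1) = F \<theta>) \<and>
     ((\<lambda>T. \<integral>\<^sup>+\<theta>. ennreal ((cmod (F \<theta> - trig_sum a T \<theta>))\<^sup>2) \<partial>\<mu>) \<longlongrightarrow> 0)
       (finite_subsets_at_top UNIV)"

lemma eventually_finite_superset:
  "finite T0 \<Longrightarrow> eventually (\<lambda>T. finite T \<and> T0 \<subseteq> T) (finite_subsets_at_top UNIV)"
  by (auto simp: eventually_finite_subsets_at_top)

text \<open>Some partial sum lies at L2 distance less than 1, and \<open>F\<close> is that partial
  sum plus a square integrable remainder.\<close>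

lemma is_fourier_square_integrable:
  assumes "is_fourier a F" shows "square_integrable F"
proof -
  have [measurable]: "F \<in> borel_measurable \<mu>"
    using assms by (simp add: is_fourier_def borel_measurable_unit_lebesgue)
  have "eventually (\<lambda>T. (\<integral>\<^sup>+\<theta>. ennreal ((cmod (F \<theta> - trig_sum a T \<theta>))\<^sup>2) \<partial>\<mu>) < 1)
      (finite_subsets_at_top UNIV)"
    using assms by (intro order_tendstoD[of _ 0]) (auto simp: is_fourier_def)
  then obtain T where T: "(\<integral>\<^sup>+\<theta>. ennreal ((cmod (F \<theta> - trig_sum a T \<theta>))\<^sup>2) \<partial>\<mu>) < 1"
    using eventually_happens[of _ "finite_subsets_at_top (UNIV :: int set)"] by auto
  have [measurable]: "trig_sum a T \<in> borel_measurable \<mu>"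
    by (simp add: borel_measurable_unit_lebesgue)
  from T have "square_integrable (\<lambda>\<theta>. F \<theta> - trig_sum a T \<theta>)"
    unfolding square_integrable_iff by (auto intro: order.strict_trans)
  from square_integrable_add[OF this square_integrable_trig_sum[of a T]]
  show ?thesis by simp
qed

text \<open>Once \<open>T\<close> contains \<open>k\<close>, the difference of the coefficients at
  \<open>k\<close> is a coefficient of the residual. Bessel's inequality for \<open>{k}\<close>
  bounds it by the L2 norm of the residual, which tends to 0.\<close>

lemma is_fourier_fcoeff:
  assumes F: "is_fourier a F" shows "fcoeff F = a"
proof
  fix k :: int
  note sF = is_fourier_square_integrable[OF F]
  let ?X = "\<lambda>T. \<integral>\<^sup>+\<theta>. ennreal ((cmod (F \<theta> - trig_sum a T \<theta>))\<^sup>2) \<partial>\<mu>"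
  have "eventually (\<lambda>T. finite T \<and> {k} \<subseteq> T) (finite_subsets_at_top UNIV)"
    by (rule eventually_finite_superset) simp
  then have "eventually (\<lambda>T. ennreal ((cmod (fcoeff F k - a k))\<^sup>2) \<le> ?X T) (finite_subsets_at_top UNIV)"
  proof eventually_elim
    case (elim T)
    let ?G = "\<lambda>\<theta>. F \<theta> - trig_sum a T \<theta>"
    have G: "square_integrable ?G"
      using sF by (intro square_integrable_diff) auto
    have "fcoeff ?G k = fcoeff F k - a k"
      using elim sF by (simp add: fcoeff_diff square_integrable_imp_integrable fcoeff_trig_sum)
    with bessel_inequality[OF G, of "{k}"]
    have "(cmod (fcoeff F k - a k))\<^sup>2 \<le> (\<integral>\<theta>. (cmod (?G \<theta>))\<^sup>2 \<partial>\<mu>)" by simp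
    moreover have "?X T = ennreal (\<integral>\<theta>. (cmod (?G \<theta>))\<^sup>2 \<partial>\<mu>)"
      using G by (intro nn_integral_eq_integral) (auto simp: square_integrable_def)
    ultimately show ?case by (simp add: ennreal_leI)
  qed
  moreover have "(?X \<longlongrightarrow> 0) (finite_subsets_at_top UNIV)"
    using F by (simp add: is_fourier_def)
  ultimately have "ennreal ((cmod (fcoeff F k - a k))\<^sup>2) \<le> 0"
    by (intro tendsto_lowerbound) auto
  then show "fcoeff F k = a k" by simp
qed

text \<open>By \<open>fourier_residual\<close> the squared distance from \<open>F\<close> to its
  partial sum is the squared norm of \<open>F\<close> minus the partial sum of squares, so L2
  convergence amounts to Parseval's identity.\<close>

lemma is_fourier_has_sum:
  assumes F: "is_fourier a F"
  shows "((\<lambda>k. (cmod (a k))\<^sup>2) has_sum (\<integral>\<theta>. (cmod (F \<theta>))\<^sup>2 \<partial>\<mu>)) UNIV"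
proof -
  note sF = is_fourier_square_integrable[OF F] and cF = is_fourier_fcoeff[OF F]
  let ?I = "\<integral>\<theta>. (cmod (F \<theta>))\<^sup>2 \<partial>\<mu>"
  let ?X = "\<lambda>T. \<integral>\<^sup>+\<theta>. ennreal ((cmod (F \<theta> - trig_sum a T \<theta>))\<^sup>2) \<partial>\<mu>"
  have X: "?X T = ennreal (?I - (\<Sum>k\<in>T. (cmod (a k))\<^sup>2))" and le: "(\<Sum>k\<in>T. (cmod (a k))\<^sup>2) \<le> ?I"
    if "finite T" for T
  proof -
    have "square_integrable (\<lambda>\<theta>. F \<theta> - trig_sum a T \<theta>)"
      using sF by (intro square_integrable_diff) auto
    then have "?X T = ennreal (\<integral>\<theta>. (cmod (F \<theta> - trig_sum a T \<theta>))\<^sup>2 \<partial>\<mu>)"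
      by (intro nn_integral_eq_integral) (auto simp: square_integrable_def)
    then show "?X T = ennreal (?I - (\<Sum>k\<in>T. (cmod (a k))\<^sup>2))"
      using fourier_residual[OF sF that] by (simp add: cF)
    show "(\<Sum>k\<in>T. (cmod (a k))\<^sup>2) \<le> ?I"
      using bessel_inequality[OF sF that] by (simp add: cF)
  qed
  have ev: "eventually (\<lambda>T::int set. finite T) (finite_subsets_at_top UNIV)"
    using eventually_finite_superset[of "{} :: int set"] by simp
  have "(?X \<longlongrightarrow> ennreal 0) (finite_subsets_at_top UNIV)"
    using F by (simp add: is_fourier_def)
  then have "((\<lambda>T. ennreal (?I - (\<Sum>k\<in>T. (cmod (a k))\<^sup>2))) \<longlongrightarrow> ennreal 0) (finite_subsets_at_top UNIV)"
    by (rule Lim_transform_eventually) (use ev in eventually_elim, rule X)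
  then have "((\<lambda>T. ?I - (\<Sum>k\<in>T. (cmod (a k))\<^sup>2)) \<longlongrightarrow> 0) (finite_subsets_at_top UNIV)"
    by (rule tendsto_ennrealD) (use ev in \<open>auto elim!: eventually_mono simp: le\<close>)
  from tendsto_diff[OF tendsto_const[of ?I] this] show ?thesis
    by (simp add: has_sum_def)
qed

section \<open>The Riesz--Fischer theorem\<close>

text \<open>A finite \<open>T0\<close> whose sum is within \<open>e\<close> of the total leaves at
  most \<open>e\<close> for any finite set disjoint from it.\<close>

lemma summable_on_tail_bound:
  fixes f :: "'a \<Rightarrow> real"
  assumes f: "f summable_on UNIV" and nn: "\<And>k. f k \<ge> 0" and "e > 0"
  obtains T0 where "finite T0" "\<And>T. finite T \<Longrightarrow> T \<inter> T0 = {} \<Longrightarrow> sum f T \<le> e"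
proof -
  from f have "(sum f \<longlongrightarrow> infsum f UNIV) (finite_subsets_at_top UNIV)"
    using has_sum_infsum[OF f] by (simp add: has_sum_def)
  then have "eventually (\<lambda>T. sum f T > infsum f UNIV - e) (finite_subsets_at_top UNIV)"
    using \<open>e > 0\<close> by (intro order_tendstoD) auto
  then obtain T0 where T0: "finite T0" "sum f T0 > infsum f UNIV - e"
    by (auto simp: eventually_finite_subsets_at_top)
  show thesis
  proof (rule that[OF T0(1)])
    fix T :: "'a set" assume T: "finite T" "T \<inter> T0 = {}"
    have "sum f T + sum f T0 = sum f (T \<union> T0)"
      using T T0(1) by (simp add: sum.union_disjoint)
    also have "\<dots> \<le> infsum f UNIV"
      using T T0(1) nn by (intro finite_sum_le_infsum f) auto
    finally show "sum f T \<le> e" using T0(2) by simp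
  qed
qed

text \<open>A sequence of partial sums with tails 4^(-n) converges almost everywhere, which yields a
  concrete Borel representative. Fatou's lemma then upgrades this to L2 convergence along the whole
  net of finite index sets, as \<open>is_fourier\<close> demands.\<close>

theorem riesz_fischer:
  assumes a: "(\<lambda>k. (cmod (a k))\<^sup>2) summable_on UNIV"
  obtains F where "is_fourier a F"
proof -
  have "\<exists>T0. finite T0 \<and> (\<forall>T. finite T \<longrightarrow> T \<inter> T0 = {} \<longrightarrow> (\<Sum>k\<in>T. (cmod (a k))\<^sup>2) \<le> (1/4) ^ n)" for n :: nat
    by (rule summable_on_tail_bound[OF a, of "(1/4) ^ n"]) auto
  then obtain T' where T': "\<And>n. finite (T' n)"
    "\<And>n T. finite T \<Longrightarrow> T \<inter> T' n = {} \<Longrightarrow> (\<Sum>k\<in>T. (cmod (a k))\<^sup>2) \<le> (1/4) ^ n"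
    by metis
  \<comment> \<open>The union makes the sets increasing while keeping the tail bound of
    \<open>T' n\<close>.\<close>
  define T where "T n = (\<Union>i\<le>n. T' i)" for n
  have fT: "finite (T n)" for n
    using T'(1) by (simp add: T_def)
  have close: "(\<integral>\<theta>. (cmod (trig_sum a U \<theta> - trig_sum a V \<theta>))\<^sup>2 \<partial>\<mu>) \<le> (1/4) ^ n"
    if "finite U" "finite V" "T n \<subseteq> U" "T n \<subseteq> V" for U V n
    unfolding norm_trig_sum_diff[OF that(1,2)]
    by (rule T'(2)) (use that in \<open>auto simp: T_def\<close>)
  have mono: "T n \<subseteq> T m" if "n \<le> m" for n m
    using that unfolding T_def by (intro UN_mono) auto
  define P where "P n = trig_sum a (T n)" for n
  have mP [measurable]: "P n \<in> borel_measurable borel" "P n \<in> borel_measurable \<mu>" for n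
    by (auto simp: P_def borel_measurable_unit_lebesgue)
  \<comment> \<open>\<open>lim\<close> has some value even where the sequence diverges, and this
    value depends only on the sequence; so \<open>F\<close> has period 1 everywhere and not merely
    almost everywhere.\<close>
  define F where "F \<theta> = lim (\<lambda>n. P n \<theta>)" for \<theta>
  have mF: "F \<in> borel_measurable borel"
    unfolding F_def by measurable
  have mF' [measurable]: "F \<in> borel_measurable \<mu>"
    using mF by (rule borel_measurable_unit_lebesgue)
  have L1: "(\<integral>\<^sup>+\<theta>. ennreal (cmod (P (Suc n) \<theta> - P n \<theta>)) \<partial>\<mu>) \<le> ennreal (2 * (1/2) ^ n)" for n
  proof -
    let ?D = "\<lambda>\<theta>. P (Suc n) \<theta> - P n \<theta>"
    have D: "square_integrable ?D"
      unfolding P_def by (intro square_integrable_diff) auto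
    then have i: "integrable \<mu> (\<lambda>\<theta>. (cmod (?D \<theta>))\<^sup>2)"
      by (simp add: square_integrable_def)
    \<comment> \<open>A substitute for the Cauchy-Schwarz inequality: with the L2 bound 4^(-n), each
      of the two terms on the right integrates to at most 2^(-n).\<close>
    have pt: "x \<le> 2 ^ n * x\<^sup>2 + (1/2) ^ n" if "x \<ge> 0" for x :: real
    proof (cases "x \<le> (1/2) ^ n")
      case False
      then have "1 \<le> 2 ^ n * x"
        by (simp add: power_one_over field_simps)
      then have "1 * x \<le> (2 ^ n * x) * x"
        using that by (rule mult_right_mono)
      then show ?thesis
        by (simp add: power2_eq_square mult.assoc add_increasing2)
    qed (use that in \<open>simp add: add_increasing\<close>)
    have "(\<integral>\<^sup>+\<theta>. ennreal (cmod (?D \<theta>)) \<partial>\<mu>) \<le> (\<integral>\<^sup>+\<theta>. ennreal (2 ^ n * (cmod (?D \<theta>))\<^sup>2 + (1/2) ^ n) \<partial>\<mu>)"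
      by (intro nn_integral_mono ennreal_leI pt) simp
    also have "\<dots> = ennreal (\<integral>\<theta>. 2 ^ n * (cmod (?D \<theta>))\<^sup>2 + (1/2) ^ n \<partial>\<mu>)"
      using i by (intro nn_integral_eq_integral) auto
    also have "(\<integral>\<theta>. 2 ^ n * (cmod (?D \<theta>))\<^sup>2 + (1/2) ^ n \<partial>\<mu>) = 2 ^ n * (\<integral>\<theta>. (cmod (?D \<theta>))\<^sup>2 \<partial>\<mu>) + (1/2) ^ n"
      using i by (simp add: measure_def emeasure_restrict_space space_unit_lebesgue)
    also have "\<dots> \<le> 2 ^ n * (1/4) ^ n + (1/2) ^ n"
      unfolding P_def using mono[of n "Suc n"]
      by (intro add_right_mono mult_left_mono close) (auto simp: fT)
    also have "2 ^ n * (1/4) ^ n + (1/2) ^ n = (2 * (1/2) ^ n :: real)"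
      by (simp flip: power_mult_distrib)
    finally show ?thesis by (simp add: ennreal_leI)
  qed
  have "(\<integral>\<^sup>+\<theta>. (\<Sum>n. ennreal (cmod (P (Suc n) \<theta> - P n \<theta>))) \<partial>\<mu>)
      = (\<Sum>n. \<integral>\<^sup>+\<theta>. ennreal (cmod (P (Suc n) \<theta> - P n \<theta>)) \<partial>\<mu>)"
    by (rule nn_integral_suminf) measurable
  also have "\<dots> \<le> (\<Sum>n. ennreal (2 * (1/2) ^ n))"
    by (intro suminf_le L1) auto
  also have "\<dots> < \<infinity>"
    by (subst suminf_ennreal2) (auto intro!: summable_mult summable_geometric)
  finally have "AE \<theta> in \<mu>. (\<Sum>n. ennreal (cmod (P (Suc n) \<theta> - P n \<theta>))) \<noteq> \<infinity>"
    by (intro nn_integral_PInf_AE) auto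
  then have conv: "AE \<theta> in \<mu>. (\<lambda>n. P n \<theta>) \<longlonglongrightarrow> F \<theta>"
  proof eventually_elim
    case (elim \<theta>)
    then have "summable (\<lambda>n. cmod (P (Suc n) \<theta> - P n \<theta>))"
      by (intro summable_suminf_not_top) auto
    then have "summable (\<lambda>n. P (Suc n) \<theta> - P n \<theta>)"
      by (rule summable_norm_cancel)
    then have "convergent (\<lambda>n. \<Sum>i<n. P (Suc i) \<theta> - P i \<theta>)"
      by (simp add: summable_iff_convergent)
    then have "convergent (\<lambda>n. P n \<theta> - P 0 \<theta>)"
      by (simp only: sum_lessThan_telescope[of "\<lambda>i. P i \<theta>"])
    then have "convergent (\<lambda>n. P n \<theta> - P 0 \<theta> + P 0 \<theta>)"
      by (intro convergent_add convergent_const)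
    then show ?case
      by (simp add: F_def convergent_LIMSEQ_iff)
  qed
  let ?X = "\<lambda>U. \<integral>\<^sup>+\<theta>. ennreal ((cmod (F \<theta> - trig_sum a U \<theta>))\<^sup>2) \<partial>\<mu>"
  have bound: "?X U \<le> ennreal ((1/4) ^ n)" if U: "finite U" "T n \<subseteq> U" for U n
  proof -
    have [measurable]: "trig_sum a U \<in> borel_measurable \<mu>"
      by (simp add: borel_measurable_unit_lebesgue)
    \<comment> \<open>Since \<open>P m\<close> tends to \<open>F\<close> almost everywhere, Fatou's
      lemma reduces the claim to partial sums; for \<open>m \<ge> n\<close> both \<open>T m\<close>
      and \<open>U\<close> contain \<open>T n\<close>, so \<open>close\<close> applies.\<close>
    have "?X U = (\<integral>\<^sup>+\<theta>. liminf (\<lambda>m. ennreal ((cmod (P m \<theta> - trig_sum a U \<theta>))\<^sup>2)) \<partial>\<mu>)"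
    proof (rule nn_integral_cong_AE)
      show "AE \<theta> in \<mu>. ennreal ((cmod (F \<theta> - trig_sum a U \<theta>))\<^sup>2)
          = liminf (\<lambda>m. ennreal ((cmod (P m \<theta> - trig_sum a U \<theta>))\<^sup>2))"
        using conv
      proof eventually_elim
        case (elim \<theta>)
        then have "(\<lambda>m. ennreal ((cmod (P m \<theta> - trig_sum a U \<theta>))\<^sup>2))
            \<longlonglongrightarrow> ennreal ((cmod (F \<theta> - trig_sum a U \<theta>))\<^sup>2)"
          by (intro tendsto_ennrealI tendsto_intros)
        then show ?case
          by (intro lim_imp_Liminf[symmetric]) auto
      qed
    qed
    also have "\<dots> \<le> liminf (\<lambda>m. \<integral>\<^sup>+\<theta>. ennreal ((cmod (P m \<theta> - trig_sum a U \<theta>))\<^sup>2) \<partial>\<mu>)"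
      by (rule nn_integral_liminf) measurable
    also have "\<dots> \<le> ennreal ((1/4) ^ n)"
    proof (rule Liminf_le)
      show "\<forall>\<^sub>F m in sequentially. (\<integral>\<^sup>+\<theta>. ennreal ((cmod (P m \<theta> - trig_sum a U \<theta>))\<^sup>2) \<partial>\<mu>) \<le> ennreal ((1/4) ^ n)"
        using eventually_ge_at_top[of n]
      proof eventually_elim
        case (elim m)
        have "square_integrable (\<lambda>\<theta>. P m \<theta> - trig_sum a U \<theta>)"
          unfolding P_def by (intro square_integrable_diff) auto
        then have "(\<integral>\<^sup>+\<theta>. ennreal ((cmod (P m \<theta> - trig_sum a U \<theta>))\<^sup>2) \<partial>\<mu>)
            = ennreal (\<integral>\<theta>. (cmod (P m \<theta> - trig_sum a U \<theta>))\<^sup>2 \<partial>\<mu>)"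
          by (intro nn_integral_eq_integral) (auto simp: square_integrable_def)
        also have "\<dots> \<le> ennreal ((1/4) ^ n)"
          unfolding P_def using U mono[OF elim] by (intro ennreal_leI close) (auto simp: fT)
        finally show ?case .
      qed
    qed simp
    finally show ?thesis .
  qed
  have "is_fourier a F"
    unfolding is_fourier_def
  proof (intro conjI allI mF)
    show "F (\<theta> + 1) = F \<theta>" for \<theta>
      by (simp add: F_def P_def trig_sum_def)
    show "(?X \<longlongrightarrow> 0) (finite_subsets_at_top UNIV)"
    proof (rule order_tendstoI)
      fix e :: ennreal assume "0 < e"
      have "(\<lambda>n. ennreal ((1/4) ^ n)) \<longlonglongrightarrow> ennreal 0"
        by (intro tendsto_ennrealI LIMSEQ_power_zero) simp
      then have "eventually (\<lambda>n. ennreal ((1/4) ^ n) < e) sequentially"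
        using \<open>0 < e\<close> by (intro order_tendstoD) auto
      then obtain n where n: "ennreal ((1/4) ^ n) < e"
        by (auto simp: eventually_sequentially)
      show "eventually (\<lambda>U. ?X U < e) (finite_subsets_at_top UNIV)"
        using eventually_finite_superset[OF fT[of n]]
        by eventually_elim (use bound n in \<open>blast intro: order.strict_trans1\<close>)
    qed simp
  qed
  then show thesis by (rule that)
qed

section \<open>Uniqueness of Fourier coefficients\<close>

text \<open>This class is closed under multiplication by characters. Uniqueness follows by testing
  its members against larger and larger classes: polynomials on the circle, continuous functions,
  indicators of closed sets, of rays, and of Borel sets.\<close>

definition zero_fourier :: "(real \<Rightarrow> complex) \<Rightarrow> bool" where
  "zero_fourier H \<longleftrightarrow> integrable \<mu> H \<and> (\<forall>t. fcoeff H t = 0)"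

lemma zero_fourier_integral: "zero_fourier H \<Longrightarrow> (\<integral>\<theta>. H \<theta> \<partial>\<mu>) = 0"
  by (auto simp: zero_fourier_def fcoeff_def dest: spec[of _ 0])

lemma zero_fourier_add: "zero_fourier F \<Longrightarrow> zero_fourier G \<Longrightarrow> zero_fourier (\<lambda>\<theta>. F \<theta> + G \<theta>)"
  by (simp add: zero_fourier_def fcoeff_add)

lemma zero_fourier_cmult: "zero_fourier F \<Longrightarrow> zero_fourier (\<lambda>\<theta>. c * F \<theta>)"
  by (simp add: zero_fourier_def fcoeff_cmult)

lemma zero_fourier_fexp_mult:
  assumes "zero_fourier F" shows "zero_fourier (\<lambda>\<theta>. fexp k \<theta> * F \<theta>)"
  using assms integrable_fexp_mult[of F k] fcoeff_fexp_mult[of k F]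
  by (simp add: zero_fourier_def mult.commute)

text \<open>On the circle a real linear functional is a combination of \<open>fexp 1\<close> and
  \<open>fexp (- 1)\<close>, so every constructor of real polynomial functions stays within
  \<open>zero_fourier\<close>. The product case needs the induction for arbitrary
  \<open>H\<close>.\<close>

lemma zero_fourier_polynomial:
  assumes "real_polynomial_function f" "zero_fourier H"
  shows "zero_fourier (\<lambda>\<theta>. of_real (f (fexp 1 \<theta>)) * H \<theta>)"
  using assms
proof (induction arbitrary: H)
  case (linear f)
  then interpret bounded_linear f by simp
  \<comment> \<open>The coefficients come from inserting Re z = (z + cnj z) / 2 and Im z = (z - cnj
    z) / (2 \<i>) into f z = Re z * f 1 + Im z * f \<i>.\<close>
  define \<alpha> where "\<alpha> = (of_real (f 1) - \<i> * of_real (f \<i>)) / 2"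
  define \<beta> where "\<beta> = (of_real (f 1) + \<i> * of_real (f \<i>)) / 2"
  have "of_real (f (fexp 1 \<theta>)) = \<alpha> * fexp 1 \<theta> + \<beta> * fexp (- 1) \<theta>" for \<theta>
  proof -
    let ?z = "fexp 1 \<theta>"
    have "f ?z = f (Re ?z *\<^sub>R 1 + Im ?z *\<^sub>R \<i>)"
      by (rule arg_cong[of _ _ f]) (simp add: complex_eq_iff)
    also have "\<dots> = Re ?z * f 1 + Im ?z * f \<i>"
      by (simp only: add scaleR) simp
    finally have "of_real (f ?z) = \<alpha> * ?z + \<beta> * cnj ?z"
      by (simp add: \<alpha>_def \<beta>_def complex_eq_iff field_simps del: cnj_fexp)
    then show ?thesis by simp
  qed
  then have "(\<lambda>\<theta>. of_real (f (fexp 1 \<theta>)) * H \<theta>)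
      = (\<lambda>\<theta>. \<alpha> * (fexp 1 \<theta> * H \<theta>) + \<beta> * (fexp (- 1) \<theta> * H \<theta>))"
    by (simp add: fun_eq_iff ring_distribs mult.assoc)
  then show ?case
    using linear.prems by (simp add: zero_fourier_add zero_fourier_cmult zero_fourier_fexp_mult)
next
  case (const c)
  then show ?case by (rule zero_fourier_cmult)
next
  case (add f g)
  then show ?case
    by (simp add: zero_fourier_add ring_distribs)
next
  case (mult f g)
  have "zero_fourier (\<lambda>\<theta>. of_real (f (fexp 1 \<theta>)) * (of_real (g (fexp 1 \<theta>)) * H \<theta>))"
    by (intro mult.IH mult.prems)
  then show ?case by (simp add: mult.assoc)
qed

lemma fexp_in_sphere: "fexp k \<theta> \<in> sphere 0 1"
  by simp

lemma measurable_circle_function: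
  assumes "continuous_on (sphere 0 1) (g :: complex \<Rightarrow> real)"
  shows "(\<lambda>\<theta>. g (fexp 1 \<theta>)) \<in> borel_measurable borel"
proof (rule borel_measurable_continuous_onI)
  have "continuous_on UNIV (fexp 1)"
    unfolding fexp_def by (intro continuous_intros)
  then show "continuous_on UNIV (\<lambda>\<theta>. g (fexp 1 \<theta>))"
    by (rule continuous_on_compose2[OF assms]) auto
qed

lemma bounded_circle_function:
  assumes "continuous_on (sphere 0 1) (g :: complex \<Rightarrow> real)"
  obtains B where "\<And>\<theta>. \<bar>g (fexp 1 \<theta>)\<bar> \<le> B"
proof -
  have "bounded (g ` sphere 0 1)"
    using assms by (intro compact_imp_bounded compact_continuous_image) auto
  then obtain B where "\<forall>z\<in>sphere 0 1. \<bar>g z\<bar> \<le> B"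
    unfolding bounded_iff by auto
  with fexp_in_sphere show thesis by (intro that) blast
qed

lemma integrable_bounded_mult:
  assumes H: "integrable \<mu> (H :: real \<Rightarrow> complex)" and [measurable]: "h \<in> borel_measurable \<mu>"
    and b: "\<And>\<theta>. \<bar>h \<theta>\<bar> \<le> (B::real)"
  shows "integrable \<mu> (\<lambda>\<theta>. of_real (h \<theta>) * H \<theta>)"
proof -
  have [measurable]: "H \<in> borel_measurable \<mu>" using H by simp
  have i: "integrable \<mu> (\<lambda>\<theta>. of_real B * H \<theta>)" using H by simp
  have "\<bar>h \<theta>\<bar> * cmod (H \<theta>) \<le> \<bar>B\<bar> * cmod (H \<theta>)" for \<theta>
    using b[of \<theta>] by (intro mult_right_mono) auto
  then show ?thesis
    by (intro Bochner_Integration.integrable_bound[OF i]) (measurable, simp add: norm_mult)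
qed

text \<open>By the Stone-Weierstrass theorem \<open>g\<close> is uniformly within \<open>e\<close>
  of a polynomial, whose integral against \<open>H\<close> is 0; what remains is at most
  \<open>e\<close> times the L1 norm of \<open>H\<close>.\<close>

lemma zero_fourier_continuous:
  assumes g: "continuous_on (sphere 0 1) (g :: complex \<Rightarrow> real)" and H: "zero_fourier H"
  shows "(\<integral>\<theta>. of_real (g (fexp 1 \<theta>)) * H \<theta> \<partial>\<mu>) = 0"
proof -
  have iH: "integrable \<mu> H" using H by (simp add: zero_fourier_def)
  have ig: "integrable \<mu> (\<lambda>\<theta>. of_real (h (fexp 1 \<theta>)) * H \<theta>)"
    if h: "continuous_on (sphere 0 1) h" for h :: "complex \<Rightarrow> real"
  proof -
    obtain B where "\<And>\<theta>. \<bar>h (fexp 1 \<theta>)\<bar> \<le> B" using bounded_circle_function[OF h] by blast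
    then show ?thesis
      by (intro integrable_bounded_mult[OF iH] borel_measurable_unit_lebesgue measurable_circle_function h)
  qed
  let ?N = "\<integral>\<theta>. cmod (H \<theta>) \<partial>\<mu>"
  have "cmod (\<integral>\<theta>. of_real (g (fexp 1 \<theta>)) * H \<theta> \<partial>\<mu>) \<le> e * ?N" if "e > 0" for e :: real
  proof -
    obtain f where f: "real_polynomial_function f" "\<And>z. z \<in> sphere 0 1 \<Longrightarrow> \<bar>g z - f z\<bar> < e"
      using Stone_Weierstrass_real_polynomial_function[OF compact_sphere g \<open>e > 0\<close>] by blast
    have cf: "continuous_on (sphere 0 1) f"
      using f(1) continuous_on_polymonial_function real_polynomial_function_eq by blast
    have "(\<integral>\<theta>. of_real (g (fexp 1 \<theta>)) * H \<theta> \<partial>\<mu>)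
        = (\<integral>\<theta>. of_real (g (fexp 1 \<theta>)) * H \<theta> - of_real (f (fexp 1 \<theta>)) * H \<theta> \<partial>\<mu>)"
      using zero_fourier_integral[OF zero_fourier_polynomial[OF f(1) H]]
      by (simp add: Bochner_Integration.integral_diff ig g cf)
    also have "cmod \<dots> \<le> (\<integral>\<theta>. e * cmod (H \<theta>) \<partial>\<mu>)"
    proof (rule Bochner_Integration.integral_norm_bound_integral)
      show "cmod (of_real (g (fexp 1 \<theta>)) * H \<theta> - of_real (f (fexp 1 \<theta>)) * H \<theta>) \<le> e * cmod (H \<theta>)" for \<theta>
      proof -
        have "cmod (of_real (g (fexp 1 \<theta>)) * H \<theta> - of_real (f (fexp 1 \<theta>)) * H \<theta>)
            = \<bar>g (fexp 1 \<theta>) - f (fexp 1 \<theta>)\<bar> * cmod (H \<theta>)"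
          by (simp flip: left_diff_distrib of_real_diff add: norm_mult)
        also have "\<dots> \<le> e * cmod (H \<theta>)"
          using f(2)[of "fexp 1 \<theta>"] by (intro mult_right_mono) auto
        finally show ?thesis .
      qed
    qed (use ig[OF g] ig[OF cf] iH in auto)
    finally show ?thesis by simp
  qed
  \<comment> \<open>Taking \<open>e / (?N + 1)\<close> absorbs the L1 norm \<open>?N\<close> without
    a case distinction on \<open>?N = 0\<close>.\<close>
  then have "cmod (\<integral>\<theta>. of_real (g (fexp 1 \<theta>)) * H \<theta> \<partial>\<mu>) \<le> 0 + e" if "e > 0" for e :: real
  proof -
    have N: "?N \<ge> 0" by simp
    from \<open>\<And>e. e > 0 \<Longrightarrow> cmod _ \<le> e * ?N\<close>[of "e / (?N + 1)"] that N
    have "cmod (\<integral>\<theta>. of_real (g (fexp 1 \<theta>)) * H \<theta> \<partial>\<mu>) \<le> e / (?N + 1) * ?N" by simp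
    also have "e / (n + 1) * n \<le> e" if "n \<ge> 0" for n :: real
      using that \<open>e > 0\<close> by (simp add: field_simps)
    note this[OF N]
    finally show ?thesis by simp
  qed
  then have "cmod (\<integral>\<theta>. of_real (g (fexp 1 \<theta>)) * H \<theta> \<partial>\<mu>) \<le> 0"
    by (rule field_le_epsilon)
  then show ?thesis by simp
qed

text \<open>The indicator of a closed set is the pointwise limit of the continuous functions max 0
  (1 - n dist(z, C)), which are bounded by 1. Nonemptiness matters because \<open>infdist\<close> to
  the empty set is 0.\<close>

lemma zero_fourier_closed:
  assumes C: "closed C" "C \<noteq> {}" and H: "zero_fourier H"
  shows "(\<integral>\<theta>. of_real (indicator C (fexp 1 \<theta>)) * H \<theta> \<partial>\<mu>) = 0"
proof -
  have iH: "integrable \<mu> H" using H by (simp add: zero_fourier_def)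
  then have [measurable]: "H \<in> borel_measurable \<mu>" by simp
  define g where "g n z = max 0 (1 - real n * infdist z C)" for n and z :: complex
  have cg: "continuous_on (sphere 0 1) (g n)" for n
    unfolding g_def by (intro continuous_intros)
  have [measurable]: "(\<lambda>\<theta>. g n (fexp 1 \<theta>)) \<in> borel_measurable \<mu>" for n
    by (intro borel_measurable_unit_lebesgue measurable_circle_function cg)
  have [measurable]: "C \<in> sets borel" using C by auto
  have lim: "(\<lambda>n. g n z) \<longlonglongrightarrow> indicator C z" for z
  proof (cases "z \<in> C")
    case True
    then show ?thesis by (simp add: g_def)
  next
    case False
    then have d: "infdist z C > 0" using infdist_pos_not_in_closed C by blast
    obtain m :: nat where m: "1 / infdist z C < m" using reals_Archimedean2 by blast
    have "eventually (\<lambda>n. g n z = 0) sequentially"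
      using eventually_ge_at_top[of m]
    proof eventually_elim
      case (elim n)
      have "1 / infdist z C < real n" using m elim by linarith
      then have "1 \<le> real n * infdist z C" using d by (simp add: field_simps)
      then show ?case by (simp add: g_def)
    qed
    then show ?thesis using False by (simp add: tendsto_eventually)
  qed
  have "(\<lambda>n. \<integral>\<theta>. of_real (g n (fexp 1 \<theta>)) * H \<theta> \<partial>\<mu>) \<longlonglongrightarrow> (\<integral>\<theta>. of_real (indicator C (fexp 1 \<theta>)) * H \<theta> \<partial>\<mu>)"
  proof (rule integral_dominated_convergence[of _ _ _ "\<lambda>\<theta>. cmod (H \<theta>)"])
    show "AE \<theta> in \<mu>. (\<lambda>n. of_real (g n (fexp 1 \<theta>)) * H \<theta>) \<longlonglongrightarrow> of_real (indicator C (fexp 1 \<theta>)) * H \<theta>"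
      by (intro AE_I2 tendsto_intros lim)
    show "AE \<theta> in \<mu>. cmod (of_real (g n (fexp 1 \<theta>)) * H \<theta>) \<le> cmod (H \<theta>)" for n
      by (intro AE_I2) (auto simp: norm_mult g_def infdist_nonneg intro!: mult_left_le_one_le)
  qed (use iH in \<open>measurable, simp_all\<close>)
  then show ?thesis
    by (simp add: zero_fourier_continuous[OF cg H] LIMSEQ_const_iff)
qed

lemma inj_on_fexp: "inj_on (fexp 1) {0..<1}"
proof
  fix x y :: real assume xy: "x \<in> {0..<1}" "y \<in> {0..<1}" and "fexp 1 x = fexp 1 y"
  then have "exp (2 * of_real pi * \<i> * of_real x) = exp (2 * of_real pi * \<i> * of_real y :: complex)"
    by (simp add: fexp_def)
  then obtain n :: int where "2 * of_real pi * \<i> * of_real x = 2 * of_real pi * \<i> * of_real y + of_real (of_int (2 * n) * pi) * \<i>"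
    unfolding exp_eq by blast
  then have "2 * pi * x = 2 * pi * (y + of_int n)"
    by (simp add: complex_eq_iff algebra_simps)
  then have "x = y + of_int n" by simp
  with xy have "n = 0" by auto
  with \<open>x = y + of_int n\<close> show "x = y" by simp
qed

text \<open>In the main case the ray meets [0,1) in a segment [0,a], which \<open>fexp 1\<close>
  maps onto a closed arc. Injectivity of \<open>fexp 1\<close>, owed to the missing endpoint 1,
  makes the arc pull back to exactly this segment.\<close>

lemma zero_fourier_atMost:
  assumes H: "zero_fourier H"
  shows "(\<integral>\<theta>. of_real (indicator {..a} \<theta>) * H \<theta> \<partial>\<mu>) = 0"
proof -
  consider "a < 0" | "0 \<le> a" "a < 1" | "1 \<le> a" by linarith
  then show ?thesis
  proof cases
    case 1
    then have "(\<integral>\<theta>. of_real (indicator {..a} \<theta>) * H \<theta> \<partial>\<mu>) = (\<integral>\<theta>. 0 \<partial>\<mu>)"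
      by (intro Bochner_Integration.integral_cong) (auto simp: space_unit_lebesgue)
    then show ?thesis by simp
  next
    case 2
    let ?C = "fexp 1 ` {0..a}"
    have "compact ?C"
      by (intro compact_continuous_image) (auto simp: fexp_def intro!: continuous_intros)
    then have C: "closed ?C" "?C \<noteq> {}"
      using 2 by (auto dest: compact_imp_closed)
    have "fexp 1 \<theta> \<in> ?C \<longleftrightarrow> \<theta> \<le> a" if "\<theta> \<in> {0..<1}" for \<theta>
      by (subst inj_on_image_mem_iff[OF inj_on_fexp]) (use 2 that in auto)
    then have "(\<integral>\<theta>. of_real (indicator {..a} \<theta>) * H \<theta> \<partial>\<mu>)
        = (\<integral>\<theta>. of_real (indicator ?C (fexp 1 \<theta>)) * H \<theta> \<partial>\<mu>)"
      by (intro Bochner_Integration.integral_cong)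
         (auto simp: space_unit_lebesgue indicator_def)
    then show ?thesis
      using zero_fourier_closed[OF C H] by simp
  next
    case 3
    then have "(\<integral>\<theta>. of_real (indicator {..a} \<theta>) * H \<theta> \<partial>\<mu>) = (\<integral>\<theta>. H \<theta> \<partial>\<mu>)"
      by (intro Bochner_Integration.integral_cong) (auto simp: space_unit_lebesgue)
    then show ?thesis using zero_fourier_integral[OF H] by simp
  qed
qed

text \<open>Rays form an intersection-stable generator of the Borel sets. Vanishing of the integral
  passes to complements, since the integral of \<open>H\<close> itself is 0, and to countable
  disjoint unions by dominated convergence.\<close>

lemma zero_fourier_indicator:
  assumes H: "zero_fourier H" and A: "A \<in> sets borel"
  shows "(\<integral>\<theta>. of_real (indicator A \<theta>) * H \<theta> \<partial>\<mu>) = 0"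
proof -
  have iH: "integrable \<mu> H" using H by (simp add: zero_fourier_def)
  then have [measurable]: "H \<in> borel_measurable \<mu>" by simp
  have m: "indicator A \<in> borel_measurable \<mu>" if "A \<in> sets borel" for A :: "real set"
    using that by (intro borel_measurable_unit_lebesgue) simp
  have i: "integrable \<mu> (\<lambda>\<theta>. of_real (indicator A \<theta>) * H \<theta>)" if "A \<in> sets borel" for A
    by (rule integrable_bounded_mult[OF iH m[OF that], of 1]) (simp add: indicator_def)
  let ?G = "range (\<lambda>a::real. {..a})"
  have borel: "sigma_sets UNIV ?G = sets borel"
    by (simp add: borel_eq_atMost)
  have "Int_stable ?G"
  proof (rule Int_stableI)
    fix a b assume "a \<in> ?G" "b \<in> ?G"
    then obtain x y where "a = {..x}" "b = {..y}" by auto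
    then have "a \<inter> b = {..min x y}" by auto
    then show "a \<inter> b \<in> ?G" by blast
  qed
  moreover have "?G \<subseteq> Pow UNIV" by simp
  moreover have "A \<in> sigma_sets UNIV ?G" using A borel by simp
  ultimately show ?thesis
  proof (induction rule: sigma_sets_induct_disjoint)
    case (basic A)
    then show ?case using zero_fourier_atMost[OF H] by auto
  next
    case empty
    then show ?case by simp
  next
    case (compl A)
    then have "A \<in> sets borel" using borel by simp
    have "(\<integral>\<theta>. of_real (indicator (UNIV - A) \<theta>) * H \<theta> \<partial>\<mu>)
        = (\<integral>\<theta>. H \<theta> - of_real (indicator A \<theta>) * H \<theta> \<partial>\<mu>)"
      by (intro Bochner_Integration.integral_cong) (auto simp: indicator_def)
    also have "\<dots> = 0"
      using compl zero_fourier_integral[OF H] by (simp add: iH i[OF \<open>A \<in> sets borel\<close>])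
    finally show ?case .
  next
    case (union A)
    then have A: "A n \<in> sets borel" for n using borel by auto
    then have [measurable]: "indicator (A n) \<in> borel_measurable \<mu>" for n by (rule m)
    have "(\<lambda>n. \<integral>\<theta>. of_real (indicator (\<Union>i<n. A i) \<theta>) * H \<theta> \<partial>\<mu>)
        \<longlonglongrightarrow> (\<integral>\<theta>. of_real (indicator (\<Union>i. A i) \<theta>) * H \<theta> \<partial>\<mu>)"
    proof (rule integral_dominated_convergence[of _ _ _ "\<lambda>\<theta>. cmod (H \<theta>)"])
      show "AE \<theta> in \<mu>. (\<lambda>n. of_real (indicator (\<Union>i<n. A i) \<theta>) * H \<theta>) \<longlonglongrightarrow> of_real (indicator (\<Union>i. A i) \<theta>) * H \<theta>"
        by (intro AE_I2 tendsto_intros LIMSEQ_indicator_UN)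
      show "AE \<theta> in \<mu>. cmod (of_real (indicator (\<Union>i<n. A i) \<theta>) * H \<theta>) \<le> cmod (H \<theta>)" for n
        by (intro AE_I2) (auto simp: indicator_def)
      show "(\<lambda>\<theta>. of_real (indicator (\<Union>i. A i) \<theta>) * H \<theta>) \<in> borel_measurable \<mu>"
        by (rule borel_measurable_integrable, rule i) (use A in auto)
      show "(\<lambda>\<theta>. of_real (indicator (\<Union>i<n. A i) \<theta>) * H \<theta>) \<in> borel_measurable \<mu>" for n
        by (rule borel_measurable_integrable, rule i) (use A in auto)
    qed (use iH in simp)
    moreover have "(\<integral>\<theta>. of_real (indicator (\<Union>i<n. A i) \<theta>) * H \<theta> \<partial>\<mu>) = 0" for n
    proof -
      have "indicator (\<Union>i<n. A i) \<theta> = (\<Sum>i<n. indicator (A i) \<theta> :: real)" for \<theta>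
        using union.hyps(1)
        by (intro indicator_UN_disjoint) (auto simp: disjoint_family_on_def)
      then have "(\<integral>\<theta>. of_real (indicator (\<Union>i<n. A i) \<theta>) * H \<theta> \<partial>\<mu>)
          = (\<integral>\<theta>. (\<Sum>i<n. of_real (indicator (A i) \<theta>) * H \<theta>) \<partial>\<mu>)"
        by (simp add: sum_distrib_right)
      also have "\<dots> = 0"
        using union.IH by (simp add: i[OF A])
      finally show ?thesis .
    qed
    ultimately show ?case by (simp add: LIMSEQ_const_iff)
  qed
qed

text \<open>All integrals of \<open>H\<close> over measurable sets vanish, so its real and imaginary
  parts have the same set integrals as the density 0.\<close>

theorem fourier_uniqueness:
  assumes H: "integrable \<mu> H" "\<And>t. fcoeff H t = 0"
  shows "AE \<theta> in \<mu>. H \<theta> = 0"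
proof -
  have zH: "zero_fourier H" using H by (simp add: zero_fourier_def)
  have *: "(\<integral>\<theta>. of_real (indicator A \<theta>) * H \<theta> \<partial>\<mu>) = 0 \<and> integrable \<mu> (\<lambda>\<theta>. of_real (indicator A \<theta>) * H \<theta>)"
    if "A \<in> sets \<mu>" for A
  proof -
    from that have "A \<in> sets borel"
      by (auto simp: sets_restrict_space)
    moreover from this have "indicator A \<in> borel_measurable \<mu>"
      by (intro borel_measurable_unit_lebesgue) simp
    ultimately show ?thesis
      using zero_fourier_indicator[OF zH] integrable_bounded_mult[OF H(1), of "indicator A" 1]
      by (auto simp: indicator_def)
  qed
  have "AE \<theta> in \<mu>. Re (H \<theta>) = 0"
  proof (rule density_unique_real)
    fix A assume "A \<in> sets \<mu>"
    then show "(\<integral>\<theta>\<in>A. Re (H \<theta>) \<partial>\<mu>) = (\<integral>\<theta>\<in>A. 0 \<partial>\<mu>)"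
      using integral_Re[of \<mu> "\<lambda>\<theta>. of_real (indicator A \<theta>) * H \<theta>"] *
      by (simp add: set_lebesgue_integral_def)
  qed (use H in auto)
  moreover have "AE \<theta> in \<mu>. Im (H \<theta>) = 0"
  proof (rule density_unique_real)
    fix A assume "A \<in> sets \<mu>"
    then show "(\<integral>\<theta>\<in>A. Im (H \<theta>) \<partial>\<mu>) = (\<integral>\<theta>\<in>A. 0 \<partial>\<mu>)"
      using integral_Im[of \<mu> "\<lambda>\<theta>. of_real (indicator A \<theta>) * H \<theta>"] *
      by (simp add: set_lebesgue_integral_def)
  qed (use H in auto)
  ultimately show ?thesis
    by eventually_elim (simp add: complex_eq_iff)
qed

text \<open>This is how a chosen representative gets identified: it suffices to compute the Fourier
  coefficients of the intended function, which need only be integrable.\<close>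

lemma is_fourier_AE_eq:
  assumes H: "integrable \<mu> H" and F: "is_fourier (fcoeff H) F"
  shows "AE \<theta> in \<mu>. F \<theta> = H \<theta>"
proof -
  have iF: "integrable \<mu> F"
    using F by (intro square_integrable_imp_integrable is_fourier_square_integrable)
  have "fcoeff (\<lambda>\<theta>. F \<theta> - H \<theta>) t = 0" for t
    using iF H is_fourier_fcoeff[OF F] by (simp add: fcoeff_diff)
  then have "AE \<theta> in \<mu>. F \<theta> - H \<theta> = 0"
    using iF H by (intro fourier_uniqueness) auto
  then show ?thesis by simp
qed

section \<open>Parseval identities and the Zak transform\<close>

lemma nonneg_summable_on_iff_nn_integral:
  fixes w :: "'a \<Rightarrow> real"
  assumes "\<And>x. w x \<ge> 0"
  shows "w summable_on A \<longleftrightarrow> (\<integral>\<^sup>+x. ennreal (w x) \<partial>count_space A) < \<infinity>"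
proof -
  have "w summable_on A \<longleftrightarrow> Infinite_Set_Sum.abs_summable_on w A"
    by (subst summable_on_iff_abs_summable_on_real) (rule abs_summable_equivalent)
  also have "\<dots> \<longleftrightarrow> (\<integral>\<^sup>+x. ennreal (w x) \<partial>count_space A) < \<infinity>"
    using assms by (simp add: abs_summable_on_def integrable_iff_bounded)
  finally show ?thesis .
qed

lemma ennreal_infsum:
  fixes w :: "'a \<Rightarrow> real"
  assumes nn: "\<And>x. w x \<ge> 0" and w: "w summable_on A"
  shows "ennreal (infsum w A) = (\<integral>\<^sup>+x. ennreal (w x) \<partial>count_space A)"
proof -
  have a: "Infinite_Set_Sum.abs_summable_on w A"
    using w by (subst abs_summable_equivalent[symmetric], subst summable_on_iff_abs_summable_on_real[symmetric])
  then have "infsum w A = (\<integral>x. w x \<partial>count_space A)"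
    by (simp flip: infsetsum_infsum add: infsetsum_def)
  with a show ?thesis
    using nn by (simp add: abs_summable_on_def nn_integral_eq_integral)
qed

text \<open>Bessel's inequality makes the coefficients square summable, \<open>riesz_fischer\<close>
  realises them by some \<open>F\<close>, and uniqueness identifies \<open>F\<close> with
  \<open>H\<close>. Here completeness of the characters enters.\<close>

lemma square_integrable_fcoeff_has_sum:
  assumes H: "square_integrable H"
  shows "((\<lambda>k. (cmod (fcoeff H k))\<^sup>2) has_sum (\<integral>\<theta>. (cmod (H \<theta>))\<^sup>2 \<partial>\<mu>)) UNIV"
proof -
  have "(\<lambda>k. (cmod (fcoeff H k))\<^sup>2) summable_on UNIV"
    by (rule nonneg_bdd_above_summable_on)
       (use bessel_inequality[OF H] in \<open>auto intro!: bdd_aboveI\<close>)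
  then obtain F where F: "is_fourier (fcoeff H) F" by (rule riesz_fischer)
  have "AE \<theta> in \<mu>. F \<theta> = H \<theta>"
    by (rule is_fourier_AE_eq[OF square_integrable_imp_integrable[OF H] F])
  then have "(\<integral>\<theta>. (cmod (F \<theta>))\<^sup>2 \<partial>\<mu>) = (\<integral>\<theta>. (cmod (H \<theta>))\<^sup>2 \<partial>\<mu>)"
    using square_integrable_measurable[OF H]
      square_integrable_measurable[OF is_fourier_square_integrable[OF F]]
    by (intro integral_cong_AE) auto
  with is_fourier_has_sum[OF F] show ?thesis by simp
qed

text \<open>Both sides may be infinite: square summable Fourier coefficients force an integrable
  function to be square integrable, by the Riesz--Fischer theorem and uniqueness.\<close>

theorem parseval:
  assumes H: "integrable \<mu> H"
  shows "(\<integral>\<^sup>+k. ennreal ((cmod (fcoeff H k))\<^sup>2) \<partial>count_space UNIV)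
    = (\<integral>\<^sup>+\<theta>. ennreal ((cmod (H \<theta>))\<^sup>2) \<partial>\<mu>)" (is "?L = ?R")
proof -
  have mH: "H \<in> borel_measurable \<mu>" using H by simp
  have eq: "?L = ?R" if sH: "square_integrable H"
  proof -
    note hs = square_integrable_fcoeff_has_sum[OF sH]
    have "?L = ennreal (\<integral>\<theta>. (cmod (H \<theta>))\<^sup>2 \<partial>\<mu>)"
      using ennreal_infsum[of "\<lambda>k. (cmod (fcoeff H k))\<^sup>2" UNIV] hs
      by (simp add: has_sum_imp_summable infsumI)
    also have "\<dots> = ?R"
      using sH by (intro nn_integral_eq_integral[symmetric]) (auto simp: square_integrable_def)
    finally show ?thesis .
  qed
  have "square_integrable H" if "?L < \<infinity>"
  proof -
    from that have "(\<lambda>k. (cmod (fcoeff H k))\<^sup>2) summable_on UNIV"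
      by (subst nonneg_summable_on_iff_nn_integral) auto
    then obtain F where F: "is_fourier (fcoeff H) F" by (rule riesz_fischer)
    have "AE \<theta> in \<mu>. F \<theta> = H \<theta>"
      by (rule is_fourier_AE_eq[OF H F])
    then have "?R = (\<integral>\<^sup>+\<theta>. ennreal ((cmod (F \<theta>))\<^sup>2) \<partial>\<mu>)"
      by (intro nn_integral_cong_AE) auto
    with is_fourier_square_integrable[OF F] mH show ?thesis
      by (simp add: square_integrable_iff)
  qed
  moreover have "square_integrable H" if "?R < \<infinity>"
    using that mH by (simp add: square_integrable_iff)
  ultimately show ?thesis
    using eq by (metis infinity_ennreal_def less_top)
qed

text \<open>The differences are written as sums with the factors -1 and -\<i>, so that all four
  terms are instances of one Parseval identity for \<open>F + c * G\<close>.\<close>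

lemma polarization:
  fixes x y :: complex
  shows "x * cnj y = (of_real ((cmod (x + y))\<^sup>2) - of_real ((cmod (x + (- 1) * y))\<^sup>2)
    + \<i> * of_real ((cmod (x + \<i> * y))\<^sup>2) - \<i> * of_real ((cmod (x + (- \<i>) * y))\<^sup>2)) / 4"
  unfolding cmod_power2 by (simp add: complex_eq_iff power2_eq_square algebra_simps)

lemma square_integrable_inner_has_sum:
  assumes F: "square_integrable F" and G: "square_integrable G"
  shows "((\<lambda>k. fcoeff F k * cnj (fcoeff G k)) has_sum (\<integral>\<theta>. F \<theta> * cnj (G \<theta>) \<partial>\<mu>)) UNIV"
proof -
  have K: "square_integrable (\<lambda>\<theta>. F \<theta> + c * G \<theta>)" for c
    using F G by (intro square_integrable_add square_integrable_cmult)
  have i: "integrable \<mu> (\<lambda>\<theta>. of_real ((cmod (F \<theta> + c * G \<theta>))\<^sup>2) :: complex)" for c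
    using K[of c] unfolding square_integrable_def by (intro integrable_of_real) auto
  have hs: "((\<lambda>k. of_real ((cmod (fcoeff F k + c * fcoeff G k))\<^sup>2)) has_sum
      (\<integral>\<theta>. of_real ((cmod (F \<theta> + c * G \<theta>))\<^sup>2) \<partial>\<mu> :: complex)) UNIV" for c
  proof -
    have "fcoeff (\<lambda>\<theta>. F \<theta> + c * G \<theta>) k = fcoeff F k + c * fcoeff G k" for k
      using F G by (simp add: fcoeff_add fcoeff_cmult square_integrable_imp_integrable)
    with has_sum_of_real[OF square_integrable_fcoeff_has_sum[OF K[of c]], where 'a = complex]
    show ?thesis by (simp del: of_real_power)
  qed
  let ?I = "\<lambda>c. \<integral>\<theta>. of_real ((cmod (F \<theta> + c * G \<theta>))\<^sup>2) \<partial>\<mu> :: complex"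
  have "((\<lambda>k. (of_real ((cmod (fcoeff F k + 1 * fcoeff G k))\<^sup>2) + (- of_real ((cmod (fcoeff F k + (- 1) * fcoeff G k))\<^sup>2))
    + \<i> * of_real ((cmod (fcoeff F k + \<i> * fcoeff G k))\<^sup>2) + (- (\<i> * of_real ((cmod (fcoeff F k + (- \<i>) * fcoeff G k))\<^sup>2)))) * (1 / 4))
    has_sum ((?I 1 + (- ?I (- 1)) + \<i> * ?I \<i> + (- (\<i> * ?I (- \<i>)))) * (1 / 4))) UNIV"
    by (intro has_sum_cmult_left has_sum_add has_sum_cmult_right hs has_sum_uminusI)
  also have "(?I 1 + (- ?I (- 1)) + \<i> * ?I \<i> + (- (\<i> * ?I (- \<i>)))) * (1 / 4) = (\<integral>\<theta>. F \<theta> * cnj (G \<theta>) \<partial>\<mu>)"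
    using i[of 1] i[of "- 1"] i[of "\<i>"] i[of "- \<i>"]
    by (subst polarization) simp
  finally show ?thesis
    by (subst polarization) simp
qed

text \<open>Moving the character into \<open>G\<close> turns the \<open>t\<close>-th coefficient of
  the product into an inner product. Multiplication by \<open>fexp t\<close> shifts the coefficients
  of \<open>G\<close> by \<open>t\<close>, so the inner product is the correlation of
  \<open>a\<close> and \<open>b\<close>.\<close>

lemma is_fourier_product:
  assumes F: "is_fourier a F" and G: "is_fourier b G"
  shows "((\<lambda>k. a k * cnj (b (k - t))) has_sum fcoeff (\<lambda>\<theta>. F \<theta> * cnj (G \<theta>)) t) UNIV"
proof -
  have G': "square_integrable (\<lambda>\<theta>. fexp t \<theta> * G \<theta>)"
    by (rule square_integrable_mult_bounded[of _ _ 1])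
       (simp_all add: is_fourier_square_integrable[OF G])
  have "(\<integral>\<theta>. F \<theta> * cnj (fexp t \<theta> * G \<theta>) \<partial>\<mu>) = fcoeff (\<lambda>\<theta>. F \<theta> * cnj (G \<theta>)) t"
    by (simp add: fcoeff_def mult_ac)
  with square_integrable_inner_has_sum[OF is_fourier_square_integrable[OF F] G']
  show ?thesis
    by (simp add: fcoeff_fexp_mult is_fourier_fcoeff[OF F] is_fourier_fcoeff[OF G])
qed

lemma is_fourier_norm:
  assumes F: "is_fourier a F"
  shows "(\<integral>\<^sup>+k. ennreal ((cmod (a k))\<^sup>2) \<partial>count_space UNIV) = (\<integral>\<^sup>+\<theta>. ennreal ((cmod (F \<theta>))\<^sup>2) \<partial>\<mu>)"
  using parseval[OF square_integrable_imp_integrable[OF is_fourier_square_integrable[OF F]]]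
  by (simp add: is_fourier_fcoeff[OF F])

text \<open>Reindexing coefficients corresponds to multiplication by a character, and uniqueness
  compares the two representatives.\<close>

lemma is_fourier_shift:
  assumes F: "is_fourier a F" and G: "is_fourier (\<lambda>k. a (k + c)) G"
  shows "AE \<theta> in \<mu>. G \<theta> = fexp (- c) \<theta> * F \<theta>"
proof (rule is_fourier_AE_eq)
  show "integrable \<mu> (\<lambda>\<theta>. fexp (- c) \<theta> * F \<theta>)"
    using integrable_fexp_mult[OF square_integrable_imp_integrable[OF is_fourier_square_integrable[OF F]], of "- c"]
    by (simp add: mult.commute)
  have "fcoeff (\<lambda>\<theta>. fexp (- c) \<theta> * F \<theta>) = (\<lambda>k. a (k + c))"
    by (simp add: fun_eq_iff fcoeff_fexp_mult is_fourier_fcoeff[OF F])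
  then show "is_fourier (fcoeff (\<lambda>\<theta>. fexp (- c) \<theta> * F \<theta>)) G"
    using G by simp
qed

lemma is_fourier_zero:
  assumes F: "is_fourier (\<lambda>_. 0) F" shows "AE \<theta> in \<mu>. F \<theta> = 0"
proof (rule is_fourier_AE_eq)
  show "is_fourier (fcoeff (\<lambda>\<theta>. 0)) F"
    using F by (simp add: fcoeff_def[abs_def])
qed simp

section \<open>The Zak transform as a Fourier series\<close>

lemma is_zak_iff_is_fourier: "is_zak K h j F \<longleftrightarrow> is_fourier (\<lambda>k. h (j + k * int K)) F"
  by (simp add: is_zak_def is_fourier_def nn_integral_restrict_space trig_sum_def fexp_def)

text \<open>For \<open>K \<ge> 1\<close> the progression visits each integer at most once, so the
  sampled sequence is square summable and the choice in \<open>zak\<close> has a witness.\<close>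

lemma zak_is_fourier:
  assumes h: "h \<in> ell2 S" and K: "K \<ge> 1"
  shows "is_fourier (\<lambda>k. h (j + k * int K)) (zak K h j)"
proof -
  have "(\<lambda>x. (cmod (h x))\<^sup>2) summable_on range (\<lambda>k. j + k * int K)"
    using h by (auto simp: ell2_def intro: summable_on_subset_banach)
  then have "((\<lambda>x. (cmod (h x))\<^sup>2) \<circ> (\<lambda>k. j + k * int K)) summable_on UNIV"
    using K by (subst summable_on_reindex[symmetric]) (auto simp: inj_on_def)
  then obtain F where "is_fourier (\<lambda>k. h (j + k * int K)) F"
    using riesz_fischer[of "\<lambda>k. h (j + k * int K)"] by (auto simp: o_def)
  then have "\<exists>F. is_zak K h j F"
    by (auto simp: is_zak_iff_is_fourier)
  then have "is_zak K h j (zak K h j)"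
    unfolding zak_def by (rule someI_ex)
  then show ?thesis by (simp add: is_zak_iff_is_fourier)
qed

lemma zak_quasi_periodic:
  assumes h: "h \<in> ell2 S" and K: "K \<ge> 1"
  shows "AE \<theta> in \<mu>. zak K h (j + c * int K) \<theta> = fexp (- c) \<theta> * zak K h j \<theta>"
proof (rule is_fourier_shift)
  show "is_fourier (\<lambda>k. h (j + k * int K)) (zak K h j)"
    by (rule zak_is_fourier[OF h K])
  show "is_fourier (\<lambda>k. h (j + (k + c) * int K)) (zak K h (j + c * int K))"
    using zak_is_fourier[OF h K, of "j + c * int K"] by (simp add: algebra_simps)
qed

lemma zak_AE_eq_0:
  assumes h: "h \<in> ell2 S" and K: "K \<ge> 1" and 0: "\<And>k. h (j + k * int K) = 0"
  shows "AE \<theta> in \<mu>. zak K h j \<theta> = 0"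
  using zak_is_fourier[OF h K, of j] by (intro is_fourier_zero) (simp add: 0)

lemma measurable_zak:
  assumes h: "h \<in> ell2 S" and K: "K \<ge> 1"
  shows "zak K h j \<in> borel_measurable \<mu>"
  using zak_is_fourier[OF h K] is_fourier_square_integrable square_integrable_measurable by blast

section \<open>The frame sum in the Zak domain\<close>

lemma ell2_UNIV: "h \<in> ell2 S \<Longrightarrow> h \<in> ell2 UNIV"
  by (simp add: ell2_def)

lemma summable_on_shift:
  fixes \<phi> :: "int \<Rightarrow> 'a::{comm_monoid_add, topological_space}"
  shows "(\<lambda>x. \<phi> (x - c)) summable_on UNIV \<longleftrightarrow> \<phi> summable_on UNIV"
  by (rule summable_on_reindex_bij_betw)
     (auto intro!: bij_betwI[of _ _ _ "\<lambda>x. x + c"])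

lemma ell2_shift: "h \<in> ell2 UNIV \<Longrightarrow> (\<lambda>x. h (x - c)) \<in> ell2 UNIV"
  using summable_on_shift[of "\<lambda>x. (cmod (h x))\<^sup>2" c] by (simp add: ell2_def)

lemma ell2_product_summable:
  assumes "f \<in> ell2 S" "h \<in> ell2 S'"
  shows "(\<lambda>x. f x * cnj (h x)) summable_on UNIV"
proof -
  have "(\<lambda>x. (cmod (f x))\<^sup>2 + (cmod (h x))\<^sup>2) summable_on UNIV"
    using assms by (intro summable_on_add) (auto simp: ell2_def)
  then have "(\<lambda>x. norm (f x * cnj (h x))) summable_on UNIV"
  proof (rule summable_on_comparison_test)
    fix x
    have "2 * (cmod (f x) * cmod (h x)) \<le> (cmod (f x))\<^sup>2 + (cmod (h x))\<^sup>2"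
      using sum_squares_bound[of "cmod (f x)" "cmod (h x)"] by simp
    moreover have "0 \<le> cmod (f x) * cmod (h x)" by simp
    ultimately have "cmod (f x) * cmod (h x) \<le> (cmod (f x))\<^sup>2 + (cmod (h x))\<^sup>2"
      by linarith
    then show "norm (f x * cnj (h x)) \<le> (cmod (f x))\<^sup>2 + (cmod (h x))\<^sup>2"
      by (simp add: norm_mult)
  qed simp
  then show ?thesis by (rule abs_summable_summable)
qed

lemma nn_integral_count_space_Times:
  assumes F: "finite F"
  shows "(\<integral>\<^sup>+z. w z \<partial>count_space (F \<times> UNIV)) = (\<Sum>x\<in>F. \<integral>\<^sup>+t. w (x, t) \<partial>count_space UNIV)"
proof -
  have "(\<integral>\<^sup>+z. w z \<partial>count_space (F \<times> UNIV)) = (\<integral>\<^sup>+z. w z * indicator (F \<times> UNIV) z \<partial>count_space UNIV)"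
    by (rule nn_integral_count_space_indicator) simp
  also have "\<dots> = (\<integral>\<^sup>+x. \<integral>\<^sup>+t. w (x, t) * indicator (F \<times> UNIV) (x, t) \<partial>count_space UNIV \<partial>count_space UNIV)"
    by (rule nn_integral_fst_count_space[symmetric])
  also have "\<dots> = (\<integral>\<^sup>+x. (\<integral>\<^sup>+t. w (x, t) \<partial>count_space UNIV) * indicator F x \<partial>count_space UNIV)"
    by (intro nn_integral_cong) (auto simp: indicator_def)
  also have "\<dots> = (\<integral>\<^sup>+x. (\<integral>\<^sup>+t. w (x, t) \<partial>count_space UNIV) \<partial>count_space F)"
    by (rule nn_integral_count_space_indicator[symmetric]) simp
  also have "\<dots> = (\<Sum>x\<in>F. \<integral>\<^sup>+t. w (x, t) \<partial>count_space UNIV)"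
    by (rule nn_integral_count_space_finite[OF F])
  finally show ?thesis .
qed

lemma fcoeff_sum:
  assumes "finite A" "\<And>i. i \<in> A \<Longrightarrow> integrable \<mu> (F i)"
  shows "fcoeff (\<lambda>\<theta>. \<Sum>i\<in>A. F i \<theta>) t = (\<Sum>i\<in>A. fcoeff (F i) t)"
  unfolding fcoeff_def sum_distrib_right
  by (rule Bochner_Integration.integral_sum) (auto intro: integrable_fexp_mult assms)

lemma fexp_multiple: "M \<ge> 1 \<Longrightarrow> fexp (c * int M) (real m / real M) = 1"
proof -
  assume "M \<ge> 1"
  then have "fexp (c * int M) (real m / real M) = exp (2 * of_real (of_int (c * int m)) * of_real pi * \<i>)"
    by (simp add: fexp_def field_simps)
  also have "\<dots> = 1" using exp_integer_2pi[of "of_int (c * int m)"] by simp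
  finally show ?thesis .
qed

text \<open>For \<open>d \<noteq> 0\<close> this is a geometric series of \<open>M\<close>-th roots
  of unity. The bound on \<open>d\<close> excludes the nonzero multiples of \<open>M\<close>, where
  the ratio would be 1.\<close>

lemma sum_fexp_orthogonal:
  assumes "M \<ge> 1" "\<bar>d\<bar> < int M"
  shows "(\<Sum>m<M. fexp d (real m / real M)) = (if d = 0 then of_nat M else 0)"
proof (cases "d = 0")
  case False
  let ?z = "fexp d (1 / real M)"
  have pow: "fexp d (real m / real M) = ?z ^ m" for m
    by (simp add: fexp_def exp_of_nat_mult[symmetric] algebra_simps)
  have "?z \<noteq> 1"
  proof
    assume "?z = 1"
    then obtain n :: int where "2 * pi * d * (1 / real M) = of_int (2 * n) * pi"
      by (auto simp: fexp_def exp_eq_1)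
    then have "of_int d = (of_int n * real M :: real)"
      using \<open>M \<ge> 1\<close> by (simp add: field_simps)
    then have "d = n * int M"
      by (metis of_int_eq_iff of_int_mult of_int_of_nat_eq)
    then have "int M dvd d" by simp
    then show False
      using assms False zdvd_imp_le[of "int M" "\<bar>d\<bar>"] by auto
  qed
  moreover have "?z ^ M = 1"
    using pow[of M] assms(1) fexp_plus_1[of d 0] by (simp add: fexp_def)
  ultimately show ?thesis
    using False by (simp add: pow geometric_sum)
qed simp

text \<open>Plancherel for the unnormalised discrete Fourier transform on \<open>M\<close> points;
  this is the origin of the factor \<open>M\<close> in the frame sum.\<close>

lemma finite_parseval:
  assumes M: "M \<ge> 1"
  shows "(\<Sum>m<M. (cmod (\<Sum>j\<in>{0..<int M}. fexp (- j) (real m / real M) * c j))\<^sup>2)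
    = real M * (\<Sum>j\<in>{0..<int M}. (cmod (c j))\<^sup>2)"
proof -
  let ?J = "{0..<int M}"
  have "complex_of_real (\<Sum>m<M. (cmod (\<Sum>j\<in>?J. fexp (- j) (real m / real M) * c j))\<^sup>2)
    = (\<Sum>m<M. \<Sum>i\<in>?J. \<Sum>j\<in>?J. c i * cnj (c j) * fexp (j - i) (real m / real M))"
    unfolding of_real_sum complex_norm_square
    by (simp add: sum_product mult_ac fexp_add[of "- i" j for i j, simplified])
  also have "\<dots> = (\<Sum>i\<in>?J. \<Sum>j\<in>?J. c i * cnj (c j) * (\<Sum>m<M. fexp (j - i) (real m / real M)))"
    by (simp only: sum_distrib_left sum.swap[of _ "{..<M}"])
  also have "\<dots> = (\<Sum>i\<in>?J. \<Sum>j\<in>?J. c i * cnj (c j) * (if j = i then of_nat M else 0))"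
    by (intro sum.cong refl arg_cong2[of _ _ _ _ "(*)"]) (subst sum_fexp_orthogonal[OF M], auto)
  also have "\<dots> = (\<Sum>i\<in>?J. c i * cnj (c i) * of_nat M)"
    by (simp add: if_distrib cong: if_cong)
  also have "\<dots> = complex_of_real (real M * (\<Sum>j\<in>?J. (cmod (c j))\<^sup>2))"
    unfolding of_real_mult of_real_sum complex_norm_square
    by (simp add: sum_distrib_left mult_ac)
  finally show ?thesis
    by (simp only: of_real_eq_iff)
qed

text \<open>\<open>qN_eq_pM\<close> is N/M = p/q without division. It says that \<open>q\<close>
  steps of length \<open>N\<close> make one Zak period \<open>p * M\<close>; in particular an
  \<open>N\<close>-periodic set is \<open>p * M\<close>-periodic.\<close>

locale gabor_lattice =
  fixes M N p q :: nat
  assumes M_pos: "M \<ge> 1" and p_pos: "p \<ge> 1" and q_pos: "q \<ge> 1"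
    and qN_eq_pM: "q * N = p * M"
begin

lemma pM_pos: "p * M \<ge> 1"
  using M_pos p_pos by (simp add: Suc_le_eq)

lemma lattice_div_mod:
  assumes "j \<in> {0..<int M}" "k < p"
  shows "(j + int k * int M + n * int (p * M)) mod int M = j"
    and "(j + int k * int M + n * int (p * M)) div int M mod int p = int k"
    and "(j + int k * int M + n * int (p * M)) div int M div int p = n"
proof -
  have e: "j + int k * int M + n * int (p * M) = j + (int k + n * int p) * int M"
    by (simp add: algebra_simps)
  have d: "(j + int k * int M + n * int (p * M)) div int M = int k + n * int p"
    unfolding e using assms by auto
  show "(j + int k * int M + n * int (p * M)) mod int M = j"
    unfolding e using assms by auto
  show "(j + int k * int M + n * int (p * M)) div int M mod int p = int k"
    "(j + int k * int M + n * int (p * M)) div int M div int p = n"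
    unfolding d using assms by auto
qed

text \<open>Three coordinates of an integer: \<open>j\<close> is its residue modulo
  \<open>M\<close>, \<open>k\<close> the column of the Zak matrix, and \<open>n\<close> the
  summation index of the Zak transform of period \<open>p * M\<close>.\<close>

lemma bij_split:
  "bij_betw (\<lambda>((j, k), n). j + int k * int M + n * int (p * M)) (({0..<int M} \<times> {..<p}) \<times> UNIV) UNIV"
proof (rule bij_betw_byWitness[where f' = "\<lambda>x. ((x mod int M, nat (x div int M mod int p)), x div int M div int p)"])
  show "\<forall>z\<in>({0..<int M} \<times> {..<p}) \<times> UNIV. (\<lambda>x. ((x mod int M, nat (x div int M mod int p)), x div int M div int p))
      ((\<lambda>((j, k), n). j + int k * int M + n * int (p * M)) z) = z"
    by (auto simp: lattice_div_mod simp del: of_nat_mult)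
  show "\<forall>x\<in>UNIV. (\<lambda>((j, k), n). j + int k * int M + n * int (p * M))
      ((x mod int M, nat (x div int M mod int p)), x div int M div int p) = x"
  proof
    fix x :: int
    have a: "x div int M mod int p + int p * (x div int M div int p) = x div int M"
      by simp
    have "y + u * int M + w * int (p * M) = y + int M * (u + int p * w)" for y u w
      by (simp add: ring_distribs mult_ac)
    then have "x mod int M + (x div int M mod int p) * int M + (x div int M div int p) * int (p * M)
      = x mod int M + int M * (x div int M)"
      by (simp only: a)
    also have "\<dots> = x" by simp
    finally show "(\<lambda>((j, k), n). j + int k * int M + n * int (p * M))
      ((x mod int M, nat (x div int M mod int p)), x div int M div int p) = x"
      using p_pos by simp
  qed
  show "(\<lambda>x. ((x mod int M, nat (x div int M mod int p)), x div int M div int p)) ` UNIV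
    \<subseteq> ({0..<int M} \<times> {..<p}) \<times> UNIV"
    using M_pos p_pos by (auto simp: nat_less_iff)
qed simp

lemma infsum_split:
  fixes \<phi> :: "int \<Rightarrow> 'a::banach"
  assumes "\<phi> summable_on UNIV"
  shows "infsum \<phi> UNIV
    = (\<Sum>j\<in>{0..<int M}. \<Sum>k<p. \<Sum>\<^sub>\<infinity>n\<in>UNIV. \<phi> (j + int k * int M + n * int (p * M)))"
proof -
  let ?b = "\<lambda>((j, k), n). j + int k * int M + n * int (p * M)"
  let ?A = "{0..<int M} \<times> {..<p}"
  have "(\<lambda>z. \<phi> (?b z)) summable_on ?A \<times> UNIV"
    using assms by (simp only: summable_on_reindex_bij_betw[OF bij_split])
  then have s: "(\<lambda>(x, n). \<phi> (?b (x, n))) summable_on Sigma ?A (\<lambda>_. UNIV)"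
    by (simp add: case_prod_beta')
  have "infsum \<phi> UNIV = infsum (\<lambda>z. \<phi> (?b z)) (?A \<times> UNIV)"
    by (rule infsum_reindex_bij_betw[OF bij_split, symmetric])
  also have "\<dots> = infsum (\<lambda>(x, n). \<phi> (?b (x, n))) (Sigma ?A (\<lambda>_. UNIV))"
    by (simp add: case_prod_beta')
  also have "\<dots> = (\<Sum>\<^sub>\<infinity>x\<in>?A. \<Sum>\<^sub>\<infinity>n\<in>UNIV. \<phi> (?b (x, n)))"
    by (rule infsum_Sigma'_banach[OF s, symmetric])
  also have "\<dots> = (\<Sum>x\<in>?A. \<Sum>\<^sub>\<infinity>n\<in>UNIV. \<phi> (?b (x, n)))"
    by (rule infsum_finite) simp
  also have "\<dots> = (\<Sum>j\<in>{0..<int M}. \<Sum>k<p. \<Sum>\<^sub>\<infinity>n\<in>UNIV. \<phi> (?b ((j, k), n)))"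
    by (subst sum.cartesian_product) (simp add: case_prod_beta')
  finally show ?thesis by simp
qed

abbreviation zk :: "(int \<Rightarrow> complex) \<Rightarrow> int \<Rightarrow> real \<Rightarrow> complex" where
  "zk \<equiv> zak (p * M)"

lemma square_integrable_zak: "h \<in> ell2 S \<Longrightarrow> square_integrable (zk h j)"
  using zak_is_fourier[OF _ pM_pos] is_fourier_square_integrable by blast

lemma fexp_lattice: "fexp (- (j + int k * int M + n * int (p * M))) (real m / real M) = fexp (- j) (real m / real M)"
proof -
  have "- (j + int k * int M + n * int (p * M)) = - j + (- int k - n * int p) * int M"
    by (simp add: algebra_simps)
  then show ?thesis
    by (simp only: fexp_add fexp_multiple[OF M_pos]) simp
qed

text \<open>In the coordinates of \<open>bij_split\<close> the modulation depends on
  \<open>j\<close> only, and translation by \<open>int q * t * int N\<close> moves the Zak index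
  \<open>n\<close> by \<open>t\<close>. The sum over \<open>n\<close> is therefore a correlation,
  that is, a Fourier coefficient.\<close>

lemma gabor_inner_component:
  assumes f: "f \<in> ell2 S" and h: "h \<in> ell2 S'"
  shows "(\<Sum>\<^sub>\<infinity>x\<in>UNIV. f x * cnj (fexp x (real m / real M) * h (x - (int s + int q * t) * int N)))
    = (\<Sum>j\<in>{0..<int M}. fexp (- j) (real m / real M) *
        (\<Sum>k<p. fcoeff (\<lambda>\<theta>. zk f (j + int k * int M) \<theta> * cnj (zk h (j + int k * int M - int s * int N) \<theta>)) t))"
proof -
  let ?n = "int s + int q * t"
  let ?\<phi> = "\<lambda>x. f x * cnj (fexp x (real m / real M) * h (x - ?n * int N))"
  have sh: "(\<lambda>x. h (x - ?n * int N)) \<in> ell2 UNIV"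
    by (rule ell2_shift[OF ell2_UNIV[OF h]])
  then have "(\<lambda>x. fexp x (real m / real M) * h (x - ?n * int N)) \<in> ell2 UNIV"
    by (simp add: ell2_def norm_mult)
  with f have "?\<phi> summable_on UNIV"
    by (rule ell2_product_summable)
  then have "infsum ?\<phi> UNIV = (\<Sum>j\<in>{0..<int M}. \<Sum>k<p. \<Sum>\<^sub>\<infinity>n\<in>UNIV. ?\<phi> (j + int k * int M + n * int (p * M)))"
    by (rule infsum_split)
  also have "\<dots> = (\<Sum>j\<in>{0..<int M}. \<Sum>k<p. fexp (- j) (real m / real M) *
      fcoeff (\<lambda>\<theta>. zk f (j + int k * int M) \<theta> * cnj (zk h (j + int k * int M - int s * int N) \<theta>)) t)"
  proof (intro sum.cong refl)
    fix j and k
    let ?x = "\<lambda>n. j + int k * int M + n * int (p * M)"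
    have e: "?x n - ?n * int N = (j + int k * int M - int s * int N) + (n - t) * int (p * M)" for n
    proof -
      have "int q * int N = int (p * M)"
        by (metis qN_eq_pM of_nat_mult)
      then have "int q * t * int N = t * int (p * M)"
        by (metis mult.assoc mult.commute)
      then show ?thesis
        by (simp only: ring_distribs)
    qed
    have "(\<Sum>\<^sub>\<infinity>n\<in>UNIV. ?\<phi> (?x n)) = (\<Sum>\<^sub>\<infinity>n\<in>UNIV. fexp (- j) (real m / real M) *
        (f (?x n) * cnj (h ((j + int k * int M - int s * int N) + (n - t) * int (p * M)))))"
      unfolding e by (simp only: complex_cnj_mult cnj_fexp fexp_lattice) (simp only: mult_ac)
    also have "\<dots> = fexp (- j) (real m / real M) *
        (\<Sum>\<^sub>\<infinity>n\<in>UNIV. f (?x n) * cnj (h ((j + int k * int M - int s * int N) + (n - t) * int (p * M))))"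
      by (rule infsum_cmult_right')
    also have "(\<Sum>\<^sub>\<infinity>n\<in>UNIV. f (?x n) * cnj (h ((j + int k * int M - int s * int N) + (n - t) * int (p * M))))
        = fcoeff (\<lambda>\<theta>. zk f (j + int k * int M) \<theta> * cnj (zk h (j + int k * int M - int s * int N) \<theta>)) t"
      by (rule infsumI, rule is_fourier_product[OF zak_is_fourier[OF f pM_pos] zak_is_fourier[OF h pM_pos]])
    finally show "(\<Sum>\<^sub>\<infinity>n\<in>UNIV. ?\<phi> (?x n)) = fexp (- j) (real m / real M) *
        fcoeff (\<lambda>\<theta>. zk f (j + int k * int M) \<theta> * cnj (zk h (j + int k * int M - int s * int N) \<theta>)) t" .
  qed
  finally show ?thesis by (simp add: sum_distrib_left)
qed

text \<open>The quadratic form of the Gram matrix of Zak matrices, on vectors with entries \<open>v r k\<close>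
  in column \<open>k\<close> of block \<open>r\<close>.\<close>

definition gram_form :: "nat \<Rightarrow> nat \<Rightarrow> (nat \<Rightarrow> nat \<Rightarrow> int \<Rightarrow> complex) \<Rightarrow> int \<Rightarrow> real \<Rightarrow> (nat \<Rightarrow> nat \<Rightarrow> complex) \<Rightarrow> real" where
  "gram_form L R g j \<theta> v = (\<Sum>l<L. \<Sum>s<q.
     (cmod (\<Sum>r<R. \<Sum>k<p. zk (g l r) (j + int k * int M - int s * int N) \<theta> * v r k))\<^sup>2)"

text \<open>The quadratic form of \<open>I_tensor R (K_mat p M S j)\<close>, in the same double
  indexing as \<open>gram_form\<close>.\<close>

definition support_form :: "nat \<Rightarrow> int set \<Rightarrow> int \<Rightarrow> (nat \<Rightarrow> nat \<Rightarrow> complex) \<Rightarrow> real" where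
  "support_form R S j v = (\<Sum>r<R. \<Sum>k\<in>K_set p M S j. (cmod (v r k))\<^sup>2)"

text \<open>For a row \<open>s\<close>, the \<open>t\<close>-th Fourier coefficients of these
  functions at the various \<open>j\<close> are the data whose finite Fourier transform in
  \<open>j\<close> gives the inner products with the Gabor system.\<close>

definition gabor_product ::
    "nat \<Rightarrow> (nat \<Rightarrow> int \<Rightarrow> complex) \<Rightarrow> (nat \<Rightarrow> int \<Rightarrow> complex) \<Rightarrow> int \<Rightarrow> nat \<Rightarrow> real \<Rightarrow> complex" where
  "gabor_product R f h j s \<theta> =
     (\<Sum>r<R. \<Sum>k<p. zk (f r) (j + int k * int M) \<theta> * cnj (zk (h r) (j + int k * int M - int s * int N) \<theta>))"

lemma ell2_vecD: "f \<in> ell2_vec S R \<Longrightarrow> r < R \<Longrightarrow> f r \<in> ell2 S"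
  by (simp add: ell2_vec_def)

lemma integrable_zak_product:
  assumes "f \<in> ell2 S" "h \<in> ell2 S'"
  shows "integrable \<mu> (\<lambda>\<theta>. zk f i \<theta> * cnj (zk h j \<theta>))"
  by (intro integrable_mult_cnj square_integrable_zak[OF assms(1)] square_integrable_zak[OF assms(2)])

lemma integrable_gabor_product:
  assumes "f \<in> ell2_vec S R" "h \<in> ell2_vec S' R"
  shows "integrable \<mu> (gabor_product R f h j s)"
  unfolding gabor_product_def[abs_def]
  by (intro Bochner_Integration.integrable_sum integrable_zak_product)
     (auto intro: ell2_vecD[OF assms(1)] ell2_vecD[OF assms(2)])

lemma gabor_inner:
  assumes f: "f \<in> ell2_vec S R" and h: "h \<in> ell2_vec S' R"
  shows "ell2_vec_inner R f (modulation (real m / real M) (translation ((int s + int q * t) * int N) h))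
    = (\<Sum>j\<in>{0..<int M}. fexp (- j) (real m / real M) * fcoeff (gabor_product R f h j s) t)"
proof -
  have e: "exp (2 * of_real pi * \<i> * of_real (real m / real M) * of_int x) = fexp x (real m / real M)" for x
    by (simp add: fexp_def mult_ac)
  have "ell2_vec_inner R f (modulation (real m / real M) (translation ((int s + int q * t) * int N) h))
    = (\<Sum>r<R. \<Sum>j\<in>{0..<int M}. fexp (- j) (real m / real M) *
        (\<Sum>k<p. fcoeff (\<lambda>\<theta>. zk (f r) (j + int k * int M) \<theta> * cnj (zk (h r) (j + int k * int M - int s * int N) \<theta>)) t))"
    unfolding ell2_vec_inner_def ell2_inner_def modulation_def translation_def e
    by (intro sum.cong refl gabor_inner_component) (auto intro: ell2_vecD[OF f] ell2_vecD[OF h])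
  also have "\<dots> = (\<Sum>j\<in>{0..<int M}. fexp (- j) (real m / real M) *
      (\<Sum>r<R. \<Sum>k<p. fcoeff (\<lambda>\<theta>. zk (f r) (j + int k * int M) \<theta> * cnj (zk (h r) (j + int k * int M - int s * int N) \<theta>)) t))"
    by (subst sum.swap) (simp add: sum_distrib_left)
  also have "\<dots> = (\<Sum>j\<in>{0..<int M}. fexp (- j) (real m / real M) * fcoeff (gabor_product R f h j s) t)"
    unfolding gabor_product_def[abs_def]
    by (subst fcoeff_sum, (auto)[1],
        (intro Bochner_Integration.integrable_sum integrable_zak_product;
          auto intro: ell2_vecD[OF f] ell2_vecD[OF h])[1],
        intro sum.cong refl arg_cong2[of _ _ _ _ "(*)"], subst fcoeff_sum)
       (auto intro!: integrable_zak_product intro: ell2_vecD[OF f] ell2_vecD[OF h])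
  finally show ?thesis .
qed

lemma bij_index:
  "bij_betw (\<lambda>((m, l, s), t). (m, int s + int q * t, l)) (({..<M} \<times> {..<L} \<times> {..<q}) \<times> UNIV) (gabor_index L M)"
proof (rule bij_betw_byWitness[where f' = "\<lambda>(m, n, l). ((m, l, nat (n mod int q)), n div int q)"])
  show "(\<lambda>(m, n, l). ((m, l, nat (n mod int q)), n div int q)) ` gabor_index L M
      \<subseteq> ({..<M} \<times> {..<L} \<times> {..<q}) \<times> UNIV"
    using q_pos by (auto simp: gabor_index_def nat_less_iff)
qed (use q_pos in \<open>auto simp: gabor_index_def\<close>)

text \<open>Both sides are read in [0, \<infinity>], since nothing bounds the frame sum at this
  point. Nonnegativity permits all interchanges: the sum over \<open>m\<close> moves inside and is
  evaluated by \<open>finite_parseval\<close>, then the sum over \<open>t\<close> by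
  \<open>parseval\<close>.\<close>

theorem gabor_frame_sum:
  assumes f: "f \<in> ell2_vec S R" and g: "\<And>l. l < L \<Longrightarrow> g l \<in> ell2_vec S R"
  shows "(\<integral>\<^sup>+i. ennreal ((cmod (ell2_vec_inner R f (gabor M N g i)))\<^sup>2) \<partial>count_space (gabor_index L M))
    = ennreal (real M) * (\<Sum>j\<in>{0..<int M}. \<integral>\<^sup>+\<theta>. ennreal
        (gram_form L R g j \<theta> (\<lambda>r k. cnj (zk (f r) (j + int k * int M) \<theta>))) \<partial>\<mu>)"
proof -
  let ?J = "{0..<int M}"
  let ?c = "\<lambda>l s t j. fcoeff (gabor_product R f (g l) j s) t"
  let ?w = "\<lambda>i. ennreal ((cmod (ell2_vec_inner R f (gabor M N g i)))\<^sup>2)"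
  have "(\<integral>\<^sup>+i. ?w i \<partial>count_space (gabor_index L M))
    = (\<integral>\<^sup>+z. ?w ((\<lambda>((m, l, s), t). (m, int s + int q * t, l)) z) \<partial>count_space (({..<M} \<times> {..<L} \<times> {..<q}) \<times> UNIV))"
    by (rule nn_integral_bij_count_space[OF bij_index, symmetric])
  also have "\<dots> = (\<Sum>x\<in>{..<M} \<times> {..<L} \<times> {..<q}. \<integral>\<^sup>+t. ?w ((\<lambda>((m, l, s), t). (m, int s + int q * t, l)) (x, t)) \<partial>count_space UNIV)"
    by (rule nn_integral_count_space_Times) auto
  also have "\<dots> = (\<Sum>m<M. \<Sum>l<L. \<Sum>s<q. \<integral>\<^sup>+t. ?w (m, int s + int q * t, l) \<partial>count_space UNIV)"
    by (simp add: sum.cartesian_product case_prod_beta')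
  also have "\<dots> = (\<Sum>m<M. \<Sum>l<L. \<Sum>s<q. \<integral>\<^sup>+t. ennreal ((cmod (\<Sum>j\<in>?J. fexp (- j) (real m / real M) * ?c l s t j))\<^sup>2) \<partial>count_space UNIV)"
    by (intro sum.cong refl nn_integral_cong) (simp add: gabor_def gabor_inner[OF f g])
  also have "\<dots> = (\<Sum>l<L. \<Sum>s<q. \<Sum>m<M. \<integral>\<^sup>+t. ennreal ((cmod (\<Sum>j\<in>?J. fexp (- j) (real m / real M) * ?c l s t j))\<^sup>2) \<partial>count_space UNIV)"
    by (simp only: sum.swap[of _ "{..<M}"])
  also have "\<dots> = (\<Sum>l<L. \<Sum>s<q. \<integral>\<^sup>+t. (\<Sum>m<M. ennreal ((cmod (\<Sum>j\<in>?J. fexp (- j) (real m / real M) * ?c l s t j))\<^sup>2)) \<partial>count_space UNIV)"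
    by (intro sum.cong refl nn_integral_sum[symmetric]) simp
  also have "\<dots> = (\<Sum>l<L. \<Sum>s<q. \<integral>\<^sup>+t. ennreal (real M) * (\<Sum>j\<in>?J. ennreal ((cmod (?c l s t j))\<^sup>2)) \<partial>count_space UNIV)"
    by (intro sum.cong refl nn_integral_cong)
       (simp add: sum_ennreal finite_parseval[OF M_pos] ennreal_mult sum_nonneg)
  also have "\<dots> = (\<Sum>l<L. \<Sum>s<q. ennreal (real M) * (\<Sum>j\<in>?J. \<integral>\<^sup>+t. ennreal ((cmod (?c l s t j))\<^sup>2) \<partial>count_space UNIV))"
    by (simp add: nn_integral_cmult nn_integral_sum del: sum_ennreal)
  also have "\<dots> = (\<Sum>l<L. \<Sum>s<q. ennreal (real M) * (\<Sum>j\<in>?J. \<integral>\<^sup>+\<theta>. ennreal ((cmod (gabor_product R f (g l) j s \<theta>))\<^sup>2) \<partial>\<mu>))"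
    by (intro sum.cong refl arg_cong2[of _ _ _ _ "(*)"] parseval integrable_gabor_product[OF f g]) simp
  also have "\<dots> = ennreal (real M) * (\<Sum>j\<in>?J. \<Sum>l<L. \<Sum>s<q. \<integral>\<^sup>+\<theta>. ennreal ((cmod (gabor_product R f (g l) j s \<theta>))\<^sup>2) \<partial>\<mu>)"
    by (simp only: sum_distrib_left[symmetric] sum.swap[of _ "?J"])
  also have "(\<Sum>j\<in>?J. \<Sum>l<L. \<Sum>s<q. \<integral>\<^sup>+\<theta>. ennreal ((cmod (gabor_product R f (g l) j s \<theta>))\<^sup>2) \<partial>\<mu>)
    = (\<Sum>j\<in>?J. \<integral>\<^sup>+\<theta>. ennreal (gram_form L R g j \<theta> (\<lambda>r k. cnj (zk (f r) (j + int k * int M) \<theta>))) \<partial>\<mu>)"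
  proof (intro sum.cong refl)
    fix j
    have m: "(\<lambda>\<theta>. ennreal ((cmod (gabor_product R f (g l) j s \<theta>))\<^sup>2)) \<in> borel_measurable \<mu>" if "l < L" for l s
    proof -
      have [measurable]: "gabor_product R f (g l) j s \<in> borel_measurable \<mu>"
        using integrable_gabor_product[OF f g[OF that]] by simp
      show ?thesis by measurable
    qed
    \<comment> \<open>Conjugating inside the modulus moves the conjugate to the Zak transform of
      \<open>f\<close>; hence the Gram form is evaluated at conjugated Zak transforms.\<close>
    have c: "cmod (\<Sum>r<R. \<Sum>k<p. zk (g l r) (j + int k * int M - int s * int N) \<theta> * cnj (zk (f r) (j + int k * int M) \<theta>))
      = cmod (gabor_product R f (g l) j s \<theta>)" for l s \<theta>
      unfolding gabor_product_def by (subst complex_mod_cnj[symmetric]) (simp add: mult.commute)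
    have "(\<Sum>l<L. \<Sum>s<q. \<integral>\<^sup>+\<theta>. ennreal ((cmod (gabor_product R f (g l) j s \<theta>))\<^sup>2) \<partial>\<mu>)
      = (\<Sum>l<L. \<integral>\<^sup>+\<theta>. (\<Sum>s<q. ennreal ((cmod (gabor_product R f (g l) j s \<theta>))\<^sup>2)) \<partial>\<mu>)"
      by (intro sum.cong refl nn_integral_sum[symmetric] m) simp
    also have "\<dots> = (\<integral>\<^sup>+\<theta>. (\<Sum>l<L. \<Sum>s<q. ennreal ((cmod (gabor_product R f (g l) j s \<theta>))\<^sup>2)) \<partial>\<mu>)"
      by (intro nn_integral_sum[symmetric] borel_measurable_sum m) simp
    also have "\<dots> = (\<integral>\<^sup>+\<theta>. ennreal (gram_form L R g j \<theta> (\<lambda>r k. cnj (zk (f r) (j + int k * int M) \<theta>))) \<partial>\<mu>)"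
      by (simp add: gram_form_def c sum_ennreal sum_nonneg)
    finally show "(\<Sum>l<L. \<Sum>s<q. \<integral>\<^sup>+\<theta>. ennreal ((cmod (gabor_product R f (g l) j s \<theta>))\<^sup>2) \<partial>\<mu>)
      = (\<integral>\<^sup>+\<theta>. ennreal (gram_form L R g j \<theta> (\<lambda>r k. cnj (zk (f r) (j + int k * int M) \<theta>))) \<partial>\<mu>)" .
  qed
  finally show ?thesis .
qed

text \<open>Parseval applies on each progression \<open>j + int k * int M + n * int (p * M)\<close>
  separately, and these progressions partition the integers.\<close>

theorem ell2_vec_norm:
  assumes f: "f \<in> ell2_vec S R"
  shows "ennreal (Re (ell2_vec_inner R f f))
    = (\<Sum>j\<in>{0..<int M}. \<integral>\<^sup>+\<theta>. ennreal (\<Sum>r<R. \<Sum>k<p. (cmod (zk (f r) (j + int k * int M) \<theta>))\<^sup>2) \<partial>\<mu>)"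
proof -
  let ?J = "{0..<int M}"
  have s: "(\<lambda>x. (cmod (f r x))\<^sup>2) summable_on UNIV" if "r < R" for r
    using ell2_vecD[OF f that] by (simp add: ell2_def)
  have ip: "ell2_inner (f r) (f r) = of_real (\<Sum>\<^sub>\<infinity>x\<in>UNIV. (cmod (f r x))\<^sup>2)" if "r < R" for r
    unfolding ell2_inner_def complex_norm_square[symmetric]
    by (rule infsumI, rule has_sum_of_real, rule has_sum_infsum, rule s[OF that])
  have sp: "ennreal (\<Sum>\<^sub>\<infinity>x\<in>UNIV. (cmod (f r x))\<^sup>2)
    = (\<Sum>j\<in>?J. \<Sum>k<p. \<integral>\<^sup>+\<theta>. ennreal ((cmod (zk (f r) (j + int k * int M) \<theta>))\<^sup>2) \<partial>\<mu>)" if r: "r < R" for r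
  proof -
    have fr: "f r \<in> ell2 S" by (rule ell2_vecD[OF f r])
    have t: "ennreal (\<Sum>\<^sub>\<infinity>n\<in>UNIV. (cmod (f r (i + n * int (p * M))))\<^sup>2) = (\<integral>\<^sup>+\<theta>. ennreal ((cmod (zk (f r) i \<theta>))\<^sup>2) \<partial>\<mu>)" for i
    proof -
      note F = zak_is_fourier[OF fr pM_pos, of i]
      have "(\<lambda>n. (cmod (f r (i + n * int (p * M))))\<^sup>2) summable_on UNIV"
        using is_fourier_has_sum[OF F] by (rule has_sum_imp_summable)
      then show ?thesis
        using is_fourier_norm[OF F] ennreal_infsum[of "\<lambda>n. (cmod (f r (i + n * int (p * M))))\<^sup>2" UNIV] by simp
    qed
    show ?thesis
      unfolding infsum_split[OF s[OF r]] t[symmetric]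
      by (simp add: sum_ennreal sum_nonneg infsum_nonneg)
  qed
  have "Re (ell2_vec_inner R f f) = (\<Sum>r<R. \<Sum>\<^sub>\<infinity>x\<in>UNIV. (cmod (f r x))\<^sup>2)"
    by (simp add: ell2_vec_inner_def ip)
  then have "ennreal (Re (ell2_vec_inner R f f)) = (\<Sum>r<R. ennreal (\<Sum>\<^sub>\<infinity>x\<in>UNIV. (cmod (f r x))\<^sup>2))"
    by (simp add: sum_ennreal infsum_nonneg)
  also have "\<dots> = (\<Sum>r<R. \<Sum>j\<in>?J. \<Sum>k<p. \<integral>\<^sup>+\<theta>. ennreal ((cmod (zk (f r) (j + int k * int M) \<theta>))\<^sup>2) \<partial>\<mu>)"
    by (intro sum.cong refl sp) simp
  also have "\<dots> = (\<Sum>j\<in>?J. \<Sum>r<R. \<Sum>k<p. \<integral>\<^sup>+\<theta>. ennreal ((cmod (zk (f r) (j + int k * int M) \<theta>))\<^sup>2) \<partial>\<mu>)"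
    by (rule sum.swap)
  also have "\<dots> = (\<Sum>j\<in>?J. \<integral>\<^sup>+\<theta>. ennreal (\<Sum>r<R. \<Sum>k<p. (cmod (zk (f r) (j + int k * int M) \<theta>))\<^sup>2) \<partial>\<mu>)"
  proof (intro sum.cong refl)
    fix j
    have m: "(\<lambda>\<theta>. ennreal ((cmod (zk (f r) i \<theta>))\<^sup>2)) \<in> borel_measurable \<mu>" if "r < R" for r i
    proof -
      have [measurable]: "zk (f r) i \<in> borel_measurable \<mu>"
        by (rule measurable_zak[OF ell2_vecD[OF f that] pM_pos])
      show ?thesis by measurable
    qed
    have "(\<Sum>r<R. \<Sum>k<p. \<integral>\<^sup>+\<theta>. ennreal ((cmod (zk (f r) (j + int k * int M) \<theta>))\<^sup>2) \<partial>\<mu>)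
      = (\<Sum>r<R. \<integral>\<^sup>+\<theta>. (\<Sum>k<p. ennreal ((cmod (zk (f r) (j + int k * int M) \<theta>))\<^sup>2)) \<partial>\<mu>)"
      by (intro sum.cong refl nn_integral_sum[symmetric] m) simp
    also have "\<dots> = (\<integral>\<^sup>+\<theta>. (\<Sum>r<R. \<Sum>k<p. ennreal ((cmod (zk (f r) (j + int k * int M) \<theta>))\<^sup>2)) \<partial>\<mu>)"
      by (intro nn_integral_sum[symmetric] borel_measurable_sum m) simp
    also have "\<dots> = (\<integral>\<^sup>+\<theta>. ennreal (\<Sum>r<R. \<Sum>k<p. (cmod (zk (f r) (j + int k * int M) \<theta>))\<^sup>2) \<partial>\<mu>)"
      by (simp add: sum_ennreal sum_nonneg)
    finally show "(\<Sum>r<R. \<Sum>k<p. \<integral>\<^sup>+\<theta>. ennreal ((cmod (zk (f r) (j + int k * int M) \<theta>))\<^sup>2) \<partial>\<mu>)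
      = (\<integral>\<^sup>+\<theta>. ennreal (\<Sum>r<R. \<Sum>k<p. (cmod (zk (f r) (j + int k * int M) \<theta>))\<^sup>2) \<partial>\<mu>)" .
  qed
  finally show ?thesis .
qed

end

section \<open>Quadratic forms of the Zak matrices\<close>

lemma mat_adjoint_dim [simp]: "dim_row (mat_adjoint A) = dim_col A" "dim_col (mat_adjoint A) = dim_row A"
  by (simp_all add: mat_adjoint_def)

lemma mat_adjoint_index:
  fixes A :: "complex Matrix.mat"
  assumes "i < dim_col A" "j < dim_row A"
  shows "mat_adjoint A $$ (i, j) = cnj (A $$ (j, i))"
  using assms by (simp add: mat_adjoint_def mat_of_rows_index)

lemma hermitian_mat_iff:
  "hermitian_mat n D \<longleftrightarrow> D \<in> carrier_mat n n \<and> (\<forall>i<n. \<forall>j<n. D $$ (i, j) = cnj (D $$ (j, i)))"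
proof
  assume "hermitian_mat n D"
  then have D: "D \<in> carrier_mat n n" and "mat_adjoint D = D"
    by (auto simp: hermitian_mat_def)
  show "D \<in> carrier_mat n n \<and> (\<forall>i<n. \<forall>j<n. D $$ (i, j) = cnj (D $$ (j, i)))"
  proof (intro conjI allI impI D)
    fix i j assume "i < n" "j < n"
    then have "mat_adjoint D $$ (i, j) = cnj (D $$ (j, i))"
      using D by (intro mat_adjoint_index) auto
    then show "D $$ (i, j) = cnj (D $$ (j, i))"
      by (simp only: \<open>mat_adjoint D = D\<close>)
  qed
next
  assume D: "D \<in> carrier_mat n n \<and> (\<forall>i<n. \<forall>j<n. D $$ (i, j) = cnj (D $$ (j, i)))"
  have "mat_adjoint D = D"
  proof (rule eq_matI)
    fix i j assume "i < dim_row D" "j < dim_col D"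
    with D have "i < n" "j < n" by auto
    with D have "mat_adjoint D $$ (i, j) = cnj (D $$ (j, i))"
      by (intro mat_adjoint_index) auto
    also have "\<dots> = D $$ (i, j)"
      using D \<open>i < n\<close> \<open>j < n\<close> by metis
    finally show "mat_adjoint D $$ (i, j) = D $$ (i, j)" .
  qed (use D in auto)
  with D show "hermitian_mat n D"
    by (simp add: hermitian_mat_def)
qed

text \<open>Vectors are plain functions on \<open>nat\<close>, of which only the values below
  \<open>n\<close> count; this spares carrier conditions once \<open>loewner_le_iff\<close> is
  available.\<close>

definition quad_form :: "nat \<Rightarrow> complex Matrix.mat \<Rightarrow> (nat \<Rightarrow> complex) \<Rightarrow> complex" where
  "quad_form n D v = (\<Sum>a<n. \<Sum>b<n. D $$ (a, b) * v b * cnj (v a))"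

lemma cscalar_prod_mult_mat_vec:
  assumes D: "D \<in> carrier_mat n n" and v: "v \<in> carrier_vec n"
  shows "(D *\<^sub>v v) \<bullet>c v = quad_form n D (vec_index v)"
  using assms
  by (simp add: quad_form_def Matrix.scalar_prod_def sum_distrib_right lessThan_atLeast0)

text \<open>The difference of Hermitian matrices is Hermitian, and its quadratic form is the
  difference of the forms; so positivity is the only condition left.\<close>

lemma loewner_le_iff:
  assumes C: "hermitian_mat n C" and D: "hermitian_mat n D"
  shows "loewner_le n C D \<longleftrightarrow> (\<forall>v. Re (quad_form n C v) \<le> Re (quad_form n D v))"
proof -
  have c: "C \<in> carrier_mat n n" "D \<in> carrier_mat n n"
    using assms by (auto simp: hermitian_mat_def)
  have "D - C \<in> carrier_mat n n" by (rule minus_carrier_mat[OF c(1)])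
  moreover have "hermitian_mat n (D - C)"
    unfolding hermitian_mat_iff
  proof (intro conjI allI impI)
    fix i j assume "i < n" "j < n"
    with C D have "D $$ (i, j) = cnj (D $$ (j, i))" "C $$ (i, j) = cnj (C $$ (j, i))"
      unfolding hermitian_mat_iff by blast+
    then show "(D - C) $$ (i, j) = cnj ((D - C) $$ (j, i))"
      using c \<open>i < n\<close> \<open>j < n\<close> by (metis carrier_matD complex_cnj_diff index_minus_mat(1))
  qed fact
  ultimately have "loewner_le n C D \<longleftrightarrow> (\<forall>v\<in>carrier_vec n. 0 \<le> Re (quad_form n (D - C) (vec_index v)))"
    using assms by (simp add: loewner_le_def psd_mat_def cscalar_prod_mult_mat_vec)
  also have "\<dots> \<longleftrightarrow> (\<forall>v\<in>carrier_vec n. Re (quad_form n C (vec_index v)) \<le> Re (quad_form n D (vec_index v)))"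
  proof -
    have "quad_form n (D - C) v = quad_form n D v - quad_form n C v" for v
      using c by (simp add: quad_form_def left_diff_distrib sum_subtractf)
    then show ?thesis by simp
  qed
  also have "\<dots> \<longleftrightarrow> (\<forall>v. Re (quad_form n C v) \<le> Re (quad_form n D v))"
  proof (intro iffI allI ballI)
    fix v :: "nat \<Rightarrow> complex"
    assume H: "\<forall>v\<in>carrier_vec n. Re (quad_form n C (vec_index v)) \<le> Re (quad_form n D (vec_index v))"
    have e: "quad_form n E (vec_index (Matrix.vec n v)) = quad_form n E v" for E
      by (simp add: quad_form_def)
    show "Re (quad_form n C v) \<le> Re (quad_form n D v)"
      using bspec[OF H, of "Matrix.vec n v"] by (simp add: e)
  qed simp
  finally show ?thesis .
qed

text \<open>Splitting off the first block lowers the column number by \<open>p\<close>, which leaves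
  \<open>c mod p\<close> unchanged.\<close>

lemma I_tensor_mat_diag: "p \<ge> 1 \<Longrightarrow> I_tensor R (mat_diag p d) = mat_diag (p * R) (\<lambda>c. d (c mod p))"
proof (induction R)
  case 0
  then show ?case by (auto simp: I_tensor_def mat_diag_def)
next
  case (Suc R)
  have "I_tensor (Suc R) (mat_diag p d) = four_block_mat (mat_diag p d) (0\<^sub>m p (p * R)) (0\<^sub>m (p * R) p)
      (mat_diag (p * R) (\<lambda>c. d (c mod p)))"
    using Suc by (simp add: I_tensor_def Let_def mat_diag_def)
  also have "\<dots> = mat_diag (p * Suc R) (\<lambda>c. d (c mod p))"
    by (rule eq_matI) (auto simp: mat_diag_def le_mod_geq)
  finally show ?case .
qed

lemma foldr_add_mat:
  assumes "\<And>x. x \<in> set xs \<Longrightarrow> F x \<in> carrier_mat n m"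
  shows "foldr (+) (map F xs) (0\<^sub>m n m) \<in> carrier_mat n m"
    and "i < n \<Longrightarrow> j < m \<Longrightarrow> foldr (+) (map F xs) (0\<^sub>m n m) $$ (i, j) = (\<Sum>x\<leftarrow>xs. F x $$ (i, j))"
  using assms by (induction xs) auto

text \<open>The column numbering of \<open>zak_mat_vec\<close> is \<open>c = r * p + k\<close>, with
  \<open>r\<close> the block and \<open>k\<close> the column within it.\<close>

lemma sum_div_mod:
  fixes \<phi> :: "nat \<Rightarrow> nat \<Rightarrow> 'a::comm_monoid_add"
  shows "(\<Sum>c<p * R. \<phi> (c div p) (c mod p)) = (\<Sum>r<R. \<Sum>k<p. \<phi> r k)"
proof (cases "p = 0")
  case False
  have "r * p + k < R * p" if "r < R" "k < p" for r k
  proof -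
    have "r * p + k < Suc r * p" using that by simp
    also have "\<dots> \<le> R * p" using that by (intro mult_right_mono) auto
    finally show ?thesis .
  qed
  then have "(\<Sum>c<R * p. \<phi> (c div p) (c mod p)) = (\<Sum>(r, k)\<in>{..<R} \<times> {..<p}. \<phi> r k)"
    by (intro sum.reindex_bij_witness[of _ "\<lambda>(r, k). r * p + k" "\<lambda>c. (c div p, c mod p)"])
       (use False in \<open>auto simp: less_mult_imp_div_less\<close>)
  then show ?thesis by (simp add: sum.cartesian_product mult.commute)
qed simp

section \<open>The Gram and support matrices as quadratic forms\<close>

context gabor_lattice
begin

lemma zak_gram_carrier: "zak_gram p q L M N R g j \<theta> \<in> carrier_mat (p * R) (p * R)"
  unfolding zak_gram_def
  by (rule foldr_add_mat) (auto simp: zak_mat_vec_def intro!: carrier_matI)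

lemma zak_gram_index:
  assumes "a < p * R" "b < p * R"
  shows "zak_gram p q L M N R g j \<theta> $$ (a, b) = (\<Sum>l<L. \<Sum>s<q.
      cnj (zk (g l (a div p)) (j + int (a mod p) * int M - int s * int N) \<theta>)
      * zk (g l (b div p)) (j + int (b mod p) * int M - int s * int N) \<theta>)"
proof -
  let ?Z = "\<lambda>l. zak_mat_vec p q M N R (g l) j \<theta>"
  have "zak_gram p q L M N R g j \<theta> $$ (a, b) = (\<Sum>l\<leftarrow>[0..<L]. (mat_adjoint (?Z l) * ?Z l) $$ (a, b))"
    unfolding zak_gram_def
    by (rule foldr_add_mat) (use assms in \<open>auto simp: zak_mat_vec_def intro!: carrier_matI\<close>)
  also have "\<dots> = (\<Sum>l<L. (mat_adjoint (?Z l) * ?Z l) $$ (a, b))"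
    by (simp add: interv_sum_list_conv_sum_set_nat lessThan_atLeast0)
  also have "\<dots> = (\<Sum>l<L. \<Sum>s<q. cnj (?Z l $$ (s, a)) * ?Z l $$ (s, b))"
  proof (intro sum.cong refl)
    fix l
    have d: "dim_row (?Z l) = q" "dim_col (?Z l) = p * R"
      by (auto simp: zak_mat_vec_def)
    show "(mat_adjoint (?Z l) * ?Z l) $$ (a, b) = (\<Sum>s<q. cnj (?Z l $$ (s, a)) * ?Z l $$ (s, b))"
      using assms by (simp add: d Matrix.scalar_prod_def lessThan_atLeast0 mat_adjoint_index)
  qed
  finally show ?thesis
    using assms p_pos by (simp add: zak_mat_vec_def zak_mat_def)
qed

lemma hermitian_zak_gram: "hermitian_mat (p * R) (zak_gram p q L M N R g j \<theta>)"
  unfolding hermitian_mat_iff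
  by (simp add: zak_gram_carrier zak_gram_index mult.commute[of "cnj z" for z])

text \<open>For each \<open>l\<close> and each row \<open>s\<close> the double sum over
  \<open>a\<close> and \<open>b\<close> is a sum times its own conjugate, so the form is the sum
  over \<open>l\<close> of the squared norms of the Zak matrices applied to
  \<open>v\<close>.\<close>

lemma quad_form_zak_gram:
  "quad_form (p * R) (zak_gram p q L M N R g j \<theta>) v
    = of_real (gram_form L R g j \<theta> (\<lambda>r k. v (r * p + k)))"
proof -
  let ?z = "\<lambda>l s c. zk (g l (c div p)) (j + int (c mod p) * int M - int s * int N) \<theta>"
  have "quad_form (p * R) (zak_gram p q L M N R g j \<theta>) v
    = (\<Sum>a<p * R. \<Sum>b<p * R. \<Sum>l<L. \<Sum>s<q. (?z l s b * v b) * cnj (?z l s a * v a))"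
    unfolding quad_form_def
    by (intro sum.cong refl) (simp add: zak_gram_index sum_distrib_left sum_distrib_right, simp only: mult_ac)
  also have "\<dots> = (\<Sum>l<L. \<Sum>s<q. \<Sum>a<p * R. \<Sum>b<p * R. (?z l s b * v b) * cnj (?z l s a * v a))"
    by (simp only: sum.swap[of _ "{..<L}"]) (simp only: sum.swap[of _ "{..<q}"])
  also have "\<dots> = (\<Sum>l<L. \<Sum>s<q. of_real ((cmod (\<Sum>c<p * R. ?z l s c * v c))\<^sup>2))"
    unfolding complex_norm_square
    by (intro sum.cong refl, subst sum.swap) (simp only: sum_product cnj_sum)
  also have "\<dots> = of_real (gram_form L R g j \<theta> (\<lambda>r k. v (r * p + k)))"
    by (simp only: gram_form_def of_real_sum div_mult_mod_eq
        sum_div_mod[of "\<lambda>r k. zk (g l r) (j + int k * int M - int s * int N) \<theta> * v (r * p + k)" p R for l s, symmetric])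
  finally show ?thesis .
qed

lemma support_mat_eq:
  "complex_of_real e \<cdot>\<^sub>m I_tensor R (K_mat p M S j)
    = mat_diag (p * R) (\<lambda>c. of_real e * indicator (K_set p M S j) (c mod p))"
  unfolding K_mat_def I_tensor_mat_diag[OF p_pos] by (rule eq_matI) (auto simp: mat_diag_def)

lemma hermitian_support_mat: "hermitian_mat (p * R) (complex_of_real e \<cdot>\<^sub>m I_tensor R (K_mat p M S j))"
  unfolding hermitian_mat_iff support_mat_eq by (auto simp: mat_diag_def indicator_def)

lemma quad_form_support_mat:
  "quad_form (p * R) (complex_of_real e \<cdot>\<^sub>m I_tensor R (K_mat p M S j)) v
    = of_real (e * support_form R S j (\<lambda>r k. v (r * p + k)))"
proof -
  let ?K = "K_set p M S j"
  have "quad_form (p * R) (complex_of_real e \<cdot>\<^sub>m I_tensor R (K_mat p M S j)) v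
    = (\<Sum>a<p * R. \<Sum>b<p * R. if a = b then of_real e * indicator ?K (b mod p) * v b * cnj (v b) else 0)"
    unfolding quad_form_def support_mat_eq by (intro sum.cong refl) (auto simp: mat_diag_def)
  also have "\<dots> = (\<Sum>c<p * R. of_real (e * (indicator ?K (c mod p) * (cmod (v c))\<^sup>2)))"
    unfolding of_real_mult complex_norm_square
    by (intro sum.cong refl) (auto simp: indicator_def)
  also have "\<dots> = of_real (e * (\<Sum>c<p * R. indicator ?K (c mod p) * (cmod (v c))\<^sup>2))"
    by (simp only: of_real_sum sum_distrib_left)
  also have "(\<Sum>c<p * R. indicator ?K (c mod p) * (cmod (v c))\<^sup>2)
    = (\<Sum>r<R. \<Sum>k<p. indicator ?K k * (cmod (v (r * p + k)))\<^sup>2)"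
    by (simp only: sum_div_mod[of "\<lambda>r k. indicator ?K k * (cmod (v (r * p + k)))\<^sup>2" p R, symmetric] div_mult_mod_eq)
  also have "\<dots> = support_form R S j (\<lambda>r k. v (r * p + k))"
    unfolding support_form_def
    by (intro sum.cong refl sum.mono_neutral_cong_right) (auto simp: K_set_def indicator_def)
  finally show ?thesis .
qed

lemma support_form_cong:
  "(\<And>r k. r < R \<Longrightarrow> k < p \<Longrightarrow> v r k = w r k) \<Longrightarrow> support_form R S j v = support_form R S j w"
  by (simp add: support_form_def K_set_def)

lemma gram_form_cong:
  "(\<And>r k. r < R \<Longrightarrow> k < p \<Longrightarrow> v r k = w r k) \<Longrightarrow> gram_form L R g j \<theta> v = gram_form L R g j \<theta> w"
  by (simp add: gram_form_def)

text \<open>All matrices involved are Hermitian, so only quadratic forms are compared; what is left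
  is the passage from flat vectors to double-indexed families.\<close>

theorem loewner_bounds_iff:
  "loewner_le (p * R) (complex_of_real a \<cdot>\<^sub>m I_tensor R (K_mat p M S j)) (zak_gram p q L M N R g j \<theta>) \<and>
   loewner_le (p * R) (zak_gram p q L M N R g j \<theta>) (complex_of_real b \<cdot>\<^sub>m I_tensor R (K_mat p M S j))
   \<longleftrightarrow> (\<forall>v. a * support_form R S j v \<le> gram_form L R g j \<theta> v \<and> gram_form L R g j \<theta> v \<le> b * support_form R S j v)"
    (is "?L \<longleftrightarrow> (\<forall>v. ?P v)")
proof -
  have "?L \<longleftrightarrow> (\<forall>v. ?P (\<lambda>r k. v (r * p + k)))"
    by (simp add: loewner_le_iff hermitian_zak_gram hermitian_support_mat quad_form_zak_gram
        quad_form_support_mat all_conj_distrib del: of_real_mult)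
  also have "\<dots> \<longleftrightarrow> (\<forall>v. ?P v)"
  proof (intro iffI allI)
    fix v :: "nat \<Rightarrow> nat \<Rightarrow> complex"
    assume H: "\<forall>v. ?P (\<lambda>r k. v (r * p + k))"
    \<comment> \<open>The flattened family recovers \<open>v\<close> only at indices
      \<open>k < p\<close>, where \<open>(r * p + k) div p\<close> is \<open>r\<close>; by the
      congruence lemmas the forms see no other entries.\<close>
    let ?w = "\<lambda>r k. (\<lambda>c. v (c div p) (c mod p)) (r * p + k)"
    have "support_form R S j ?w = support_form R S j v"
      by (rule support_form_cong) simp
    moreover have "gram_form L R g j \<theta> ?w = gram_form L R g j \<theta> v"
      by (rule gram_form_cong) simp
    ultimately show "?P v"
      using spec[OF H, of "\<lambda>c. v (c div p) (c mod p)"] by (simp only:)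
  qed simp
  finally show ?thesis .
qed

end

section \<open>Frame bounds and bounds on the quadratic forms\<close>

text \<open>Testing with the set \<open>E\<close> where \<open>G < F\<close> forces the integral of
  \<open>F - G\<close> over \<open>E\<close> to be 0. The subtraction needs a finite integral of
  \<open>G\<close> over \<open>E\<close>; either alternative of \<open>fin\<close> gives it, as
  \<open>G \<le> F\<close> on \<open>E\<close>.\<close>

lemma AE_le_of_set_nn_integral_le:
  fixes F G :: "'a \<Rightarrow> real"
  assumes [measurable]: "F \<in> borel_measurable Q" "G \<in> borel_measurable Q"
    and nn: "\<And>x. F x \<ge> 0" "\<And>x. G x \<ge> 0"
    and fin: "(\<integral>\<^sup>+x. ennreal (F x) \<partial>Q) < \<infinity> \<or> (\<integral>\<^sup>+x. ennreal (G x) \<partial>Q) < \<infinity>"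
    and le: "\<And>E. E \<in> sets Q \<Longrightarrow> (\<integral>\<^sup>+x\<in>E. ennreal (F x) \<partial>Q) \<le> (\<integral>\<^sup>+x\<in>E. ennreal (G x) \<partial>Q)"
  shows "AE x in Q. F x \<le> G x"
proof -
  define E where "E = {x \<in> space Q. G x < F x}"
  have [measurable]: "E \<in> sets Q" unfolding E_def by measurable
  let ?h = "\<lambda>x. ennreal (F x - G x) * indicator E x"
  have "(\<integral>\<^sup>+x\<in>E. ennreal (G x) \<partial>Q) \<le> (\<integral>\<^sup>+x. ennreal (F x) \<partial>Q)"
    using nn by (intro nn_integral_mono) (auto simp: E_def indicator_def intro: ennreal_leI)
  moreover have "(\<integral>\<^sup>+x\<in>E. ennreal (G x) \<partial>Q) \<le> (\<integral>\<^sup>+x. ennreal (G x) \<partial>Q)"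
    by (intro nn_integral_mono) (auto simp: indicator_def)
  ultimately have fE: "(\<integral>\<^sup>+x\<in>E. ennreal (G x) \<partial>Q) < \<infinity>"
    using fin by (auto intro: order.strict_trans1)
  have "(\<integral>\<^sup>+x\<in>E. ennreal (F x) \<partial>Q) = (\<integral>\<^sup>+x. ennreal (G x) * indicator E x + ?h x \<partial>Q)"
    using nn by (intro nn_integral_cong) (auto simp: E_def indicator_def simp flip: ennreal_plus)
  also have "\<dots> = (\<integral>\<^sup>+x\<in>E. ennreal (G x) \<partial>Q) + (\<integral>\<^sup>+x. ?h x \<partial>Q)"
    by (rule nn_integral_add) measurable
  finally have "(\<integral>\<^sup>+x\<in>E. ennreal (G x) \<partial>Q) + (\<integral>\<^sup>+x. ?h x \<partial>Q) \<le> (\<integral>\<^sup>+x\<in>E. ennreal (G x) \<partial>Q) + 0"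
    using le[of E] by simp
  then have "(\<integral>\<^sup>+x. ?h x \<partial>Q) = 0"
    using fE by (subst (asm) ennreal_add_left_cancel_le) auto
  then have "AE x in Q. ?h x = 0"
    by (subst (asm) nn_integral_0_iff_AE) auto
  then show ?thesis
  proof (rule AE_mp, intro AE_I2 impI)
    fix x assume "x \<in> space Q" "?h x = 0"
    then show "F x \<le> G x"
      by (cases "x \<in> E") (auto simp: E_def ennreal_eq_0_iff)
  qed
qed

lemma periodic_set_add: "periodic_set N S \<Longrightarrow> x + c * int N \<in> S \<longleftrightarrow> x \<in> S"
  unfolding periodic_set_def
  by (metis add.assoc add.right_neutral add.right_inverse minus_mult_left)

section \<open>From matrix inequalities to frame inequalities\<close>

context gabor_lattice
begin

text \<open>The quantifier over \<open>v\<close> is inside the property of \<open>\<theta>\<close>: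
  an almost everywhere statement has one null set for all vectors, so \<open>v\<close> may
  afterwards depend on \<open>\<theta>\<close>.\<close>

definition zak_bounds :: "nat \<Rightarrow> nat \<Rightarrow> int set \<Rightarrow> (nat \<Rightarrow> nat \<Rightarrow> int \<Rightarrow> complex) \<Rightarrow> real \<Rightarrow> real \<Rightarrow> int \<Rightarrow> real \<Rightarrow> bool" where
  "zak_bounds L R S g a b j \<theta> \<longleftrightarrow>
     (\<forall>v. a * support_form R S j v \<le> gram_form L R g j \<theta> v \<and> gram_form L R g j \<theta> v \<le> b * support_form R S j v)"

lemma periodic_set_pM:
  assumes "periodic_set N S" shows "x + c * int (p * M) \<in> S \<longleftrightarrow> x \<in> S"
  using periodic_set_add[OF assms, of x "c * int q"]
  by (metis qN_eq_pM mult.assoc of_nat_mult)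

lemma zak_AE_eq_0_outside:
  assumes h: "h \<in> ell2 S" and S: "periodic_set N S" and "i \<notin> S"
  shows "AE \<theta> in \<mu>. zk h i \<theta> = 0"
proof (rule zak_AE_eq_0[OF h pM_pos])
  fix k
  have "i + k * int (p * M) \<notin> S"
    using periodic_set_pM[OF S] \<open>i \<notin> S\<close> by blast
  then show "h (i + k * int (p * M)) = 0"
    using h by (simp add: ell2_def)
qed

text \<open>The columns outside \<open>K_set\<close> carry the Zak transform of \<open>f\<close> at
  points off \<open>S\<close>, where it vanishes; restricting the norm to the support loses
  nothing.\<close>

lemma support_form_zak:
  assumes f: "f \<in> ell2_vec S R" and S: "periodic_set N S"
  shows "AE \<theta> in \<mu>. support_form R S j (\<lambda>r k. cnj (zk (f r) (j + int k * int M) \<theta>))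
    = (\<Sum>r<R. \<Sum>k<p. (cmod (zk (f r) (j + int k * int M) \<theta>))\<^sup>2)"
proof -
  have "AE \<theta> in \<mu>. \<forall>r\<in>{..<R}. \<forall>k\<in>{..<p} - K_set p M S j. zk (f r) (j + int k * int M) \<theta> = 0"
    by (intro AE_finite_allI zak_AE_eq_0_outside[OF ell2_vecD[OF f] S]) (auto simp: K_set_def)
  then show ?thesis
  proof eventually_elim
    case (elim \<theta>)
    show ?case
      unfolding support_form_def
      by (intro sum.cong refl sum.mono_neutral_cong_left) (use elim in \<open>auto simp: K_set_def\<close>)
  qed
qed

lemma gram_form_nonneg: "gram_form L R g j \<theta> v \<ge> 0"
  by (simp add: gram_form_def sum_nonneg)

lemma support_form_nonneg: "support_form R S j v \<ge> 0"
  by (simp add: support_form_def sum_nonneg)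

lemma norm_form_measurable:
  assumes f: "f \<in> ell2_vec S R"
  shows "(\<lambda>\<theta>. \<Sum>r<R. \<Sum>k<p. (cmod (zk (f r) (j + int k * int M) \<theta>))\<^sup>2) \<in> borel_measurable \<mu>"
proof (intro borel_measurable_sum)
  fix r k assume "r \<in> {..<R}"
  then have [measurable]: "zk (f r) (j + int k * int M) \<in> borel_measurable \<mu>"
    by (intro measurable_zak[OF ell2_vecD[OF f] pM_pos]) simp
  show "(\<lambda>\<theta>. (cmod (zk (f r) (j + int k * int M) \<theta>))\<^sup>2) \<in> borel_measurable \<mu>"
    by measurable
qed

lemma gram_form_measurable:
  assumes g: "\<And>l. l < L \<Longrightarrow> g l \<in> ell2_vec S R"
  shows "(\<lambda>\<theta>. gram_form L R g j \<theta> v) \<in> borel_measurable \<mu>"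
  unfolding gram_form_def
proof (intro borel_measurable_sum)
  fix l s assume l: "l \<in> {..<L}"
  have [measurable]: "(\<lambda>\<theta>. \<Sum>r<R. \<Sum>k<p. zk (g l r) (j + int k * int M - int s * int N) \<theta> * v r k) \<in> borel_measurable \<mu>"
  proof (intro borel_measurable_sum borel_measurable_times borel_measurable_const)
    fix r k assume "r \<in> {..<R}"
    then show "zk (g l r) (j + int k * int M - int s * int N) \<in> borel_measurable \<mu>"
      using l by (intro measurable_zak[OF ell2_vecD[OF g] pM_pos]) auto
  qed
  show "(\<lambda>\<theta>. (cmod (\<Sum>r<R. \<Sum>k<p. zk (g l r) (j + int k * int M - int s * int N) \<theta> * v r k))\<^sup>2)
      \<in> borel_measurable \<mu>"
    by measurable
qed

text \<open>At each \<open>\<theta>\<close> the inequalities are applied to the vector of conjugated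
  Zak transforms of \<open>f\<close>, then integrated. The factor \<open>M\<close> of
  \<open>gabor_frame_sum\<close> cancels the denominators in the bounds.\<close>

lemma frame_sum_bounds:
  assumes f: "f \<in> ell2_vec S R" and g: "\<And>l. l < L \<Longrightarrow> g l \<in> ell2_vec S R" and S: "periodic_set N S"
    and AB: "0 \<le> A" "0 \<le> B"
    and bounds: "\<And>j. j \<in> {0..<int M} \<Longrightarrow> AE \<theta> in \<mu>. zak_bounds L R S g (A / real M) (B / real M) j \<theta>"
  defines "T \<equiv> \<integral>\<^sup>+i. ennreal ((cmod (ell2_vec_inner R f (gabor M N g i)))\<^sup>2) \<partial>count_space (gabor_index L M)"
  shows "ennreal A * ennreal (Re (ell2_vec_inner R f f)) \<le> T"
    and "T \<le> ennreal B * ennreal (Re (ell2_vec_inner R f f))"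
proof -
  let ?n = "\<lambda>j \<theta>. \<Sum>r<R. \<Sum>k<p. (cmod (zk (f r) (j + int k * int M) \<theta>))\<^sup>2"
  let ?v = "\<lambda>j \<theta> r k. cnj (zk (f r) (j + int k * int M) \<theta>)"
  have b: "AE \<theta> in \<mu>. A / real M * ?n j \<theta> \<le> gram_form L R g j \<theta> (?v j \<theta>)
      \<and> gram_form L R g j \<theta> (?v j \<theta>) \<le> B / real M * ?n j \<theta>" if "j \<in> {0..<int M}" for j
    using bounds[OF that] support_form_zak[OF f S, of j]
    by eventually_elim (metis zak_bounds_def)
  have T: "T = ennreal (real M) * (\<Sum>j\<in>{0..<int M}. \<integral>\<^sup>+\<theta>. ennreal (gram_form L R g j \<theta> (?v j \<theta>)) \<partial>\<mu>)"
    unfolding T_def by (rule gabor_frame_sum[OF f g])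
  have scale: "ennreal (real M) * (\<Sum>j\<in>{0..<int M}. \<integral>\<^sup>+\<theta>. ennreal (C / real M * ?n j \<theta>) \<partial>\<mu>)
    = ennreal C * ennreal (Re (ell2_vec_inner R f f))" if "C \<ge> 0" for C
  proof -
    have "(\<integral>\<^sup>+\<theta>. ennreal (c * ?n j \<theta>) \<partial>\<mu>) = ennreal c * (\<integral>\<^sup>+\<theta>. ennreal (?n j \<theta>) \<partial>\<mu>)" if "c \<ge> 0" for c j
      using norm_form_measurable[OF f, of j] that
      by (subst nn_integral_cmult[symmetric]) (auto simp: ennreal_mult sum_nonneg simp del: sum_ennreal)
    from this[of "C / real M"] have "ennreal (real M) * (\<Sum>j\<in>{0..<int M}. \<integral>\<^sup>+\<theta>. ennreal (C / real M * ?n j \<theta>) \<partial>\<mu>)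
      = ennreal (real M) * ennreal (C / real M) * ennreal (Re (ell2_vec_inner R f f))"
      unfolding ell2_vec_norm[OF f] using that by (simp only: sum_distrib_left mult.assoc divide_nonneg_nonneg of_nat_0_le_iff simp_thms)
    also have "ennreal (real M) * ennreal (C / real M) = ennreal C"
      using that M_pos by (simp flip: ennreal_mult)
    finally show ?thesis .
  qed
  have "ennreal (real M) * (\<Sum>j\<in>{0..<int M}. \<integral>\<^sup>+\<theta>. ennreal (A / real M * ?n j \<theta>) \<partial>\<mu>) \<le> T"
    unfolding T
    by (intro mult_left_mono sum_mono nn_integral_mono_AE eventually_mono[OF b])
      (auto intro: ennreal_leI)
  then show "ennreal A * ennreal (Re (ell2_vec_inner R f f)) \<le> T"
    by (simp only: scale[OF AB(1)])
  have "T \<le> ennreal (real M) * (\<Sum>j\<in>{0..<int M}. \<integral>\<^sup>+\<theta>. ennreal (B / real M * ?n j \<theta>) \<partial>\<mu>)"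
    unfolding T
    by (intro mult_left_mono sum_mono nn_integral_mono_AE eventually_mono[OF b])
      (auto intro: ennreal_leI)
  then show "T \<le> ennreal B * ennreal (Re (ell2_vec_inner R f f))"
    by (simp only: scale[OF AB(2)])
qed

section \<open>Localisation by sequences with prescribed Zak transform\<close>

lemma summable_on_lattice:
  fixes w :: "int \<Rightarrow> real"
  assumes nn: "\<And>x. w x \<ge> 0"
    and s: "\<And>j k. j \<in> {0..<int M} \<Longrightarrow> k < p \<Longrightarrow> (\<lambda>n. w (j + int k * int M + n * int (p * M))) summable_on UNIV"
  shows "w summable_on UNIV"
proof -
  let ?b = "\<lambda>((j, k), n). j + int k * int M + n * int (p * M)"
  have "(\<integral>\<^sup>+x. ennreal (w x) \<partial>count_space UNIV)
      = (\<integral>\<^sup>+z. ennreal (w (?b z)) \<partial>count_space (({0..<int M} \<times> {..<p}) \<times> UNIV))"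
    by (rule nn_integral_bij_count_space[OF bij_split, symmetric])
  also have "\<dots> = (\<Sum>x\<in>{0..<int M} \<times> {..<p}. \<integral>\<^sup>+n. ennreal (w (?b (x, n))) \<partial>count_space UNIV)"
    by (rule nn_integral_count_space_Times) simp
  also have "\<dots> < \<infinity>"
  proof -
    have "(\<integral>\<^sup>+n. ennreal (w (?b (x, n))) \<partial>count_space UNIV) < \<infinity>" if "x \<in> {0..<int M} \<times> {..<p}" for x
      using s[of "fst x" "snd x"] that nn
      by (subst nonneg_summable_on_iff_nn_integral[symmetric]) (auto simp: case_prod_beta')
    then show ?thesis by (simp add: less_top)
  qed
  finally show ?thesis
    using nn by (simp add: nonneg_summable_on_iff_nn_integral)
qed

text \<open>On the residue class of \<open>j0\<close> the sequence is \<open>cnj (v r k)\<close>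
  times the \<open>n\<close>-th Fourier coefficient of the indicator of \<open>E\<close>. The
  conjugate anticipates the one in the frame sum. Setting \<open>f\<close> to 0 off \<open>S\<close>
  is consistent because \<open>S\<close> contains each progression in \<open>n\<close> entirely or
  misses it.\<close>

lemma zak_test_function:
  assumes S: "periodic_set N S" and E: "E \<in> sets borel" and j0: "j0 \<in> {0..<int M}"
  obtains f where "f \<in> ell2_vec S R"
    "\<And>r j k. r < R \<Longrightarrow> j \<in> {0..<int M} \<Longrightarrow> k < p \<Longrightarrow>
      AE \<theta> in \<mu>. zk (f r) (j + int k * int M) \<theta> =
        (if j = j0 \<and> k \<in> K_set p M S j then cnj (v r k) else 0) * indicator E \<theta>"
proof -
  have mE [measurable]: "(indicator E :: real \<Rightarrow> complex) \<in> borel_measurable \<mu>"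
    by (rule borel_measurable_unit_lebesgue) (use E in measurable)
  have sE: "square_integrable (\<lambda>\<theta>. c * indicator E \<theta>)" for c
    by (rule square_integrable_cmult, rule square_integrable_bounded[of _ 1])
       (rule mE, simp add: indicator_def)
  define a where "a = fcoeff (indicator E)"
  have a: "(\<lambda>n. (cmod (a n))\<^sup>2) summable_on UNIV"
    using square_integrable_fcoeff_has_sum[OF sE[of 1]] by (simp add: a_def has_sum_imp_summable)
  define w where "w j r k = (if j = j0 \<and> k \<in> K_set p M S j then cnj (v r k) else 0)" for j r k
  define f where "f r x = (if r < R \<and> x mod int M = j0 \<and> x \<in> S
      then cnj (v r (nat (x div int M mod int p))) * a (x div int M div int p) else 0)" for r x
  have fx: "f r (j + int k * int M + n * int (p * M)) = w j r k * a n"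
    if "r < R" "j \<in> {0..<int M}" "k < p" for r j k n
  proof -
    have "j + int k * int M + n * int (p * M) \<in> S \<longleftrightarrow> k \<in> K_set p M S j"
      using that periodic_set_pM[OF S, of "j + int k * int M" n] by (simp add: K_set_def)
    then show ?thesis
      unfolding f_def lattice_div_mod[OF that(2,3)] w_def using that by auto
  qed
  have fl: "f r \<in> ell2 S" if r: "r < R" for r
  proof -
    have "(\<lambda>x. (cmod (f r x))\<^sup>2) summable_on UNIV"
    proof (rule summable_on_lattice)
      fix j k assume jk: "j \<in> {0..<int M}" "k < p"
      show "(\<lambda>n. (cmod (f r (j + int k * int M + n * int (p * M))))\<^sup>2) summable_on UNIV"
        unfolding fx[OF r jk] norm_mult power_mult_distrib
        by (intro summable_on_cmult_right a)
    qed simp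
    then show ?thesis by (simp add: ell2_def f_def)
  qed
  show thesis
  proof (rule that)
    show "f \<in> ell2_vec S R"
      using fl by (auto simp: ell2_vec_def f_def)
    fix r j k assume rjk: "r < R" "j \<in> {0..<int M}" "k < p"
    let ?H = "\<lambda>\<theta>. w j r k * indicator E \<theta>"
    have "fcoeff ?H = (\<lambda>n. w j r k * a n)"
      by (simp add: fun_eq_iff fcoeff_cmult a_def)
    then have "is_fourier (fcoeff ?H) (zk (f r) (j + int k * int M))"
      using zak_is_fourier[OF fl[OF rjk(1)] pM_pos, of "j + int k * int M"] by (simp add: fx[OF rjk] del: of_nat_mult)
    then show "AE \<theta> in \<mu>. zk (f r) (j + int k * int M) \<theta> =
        (if j = j0 \<and> k \<in> K_set p M S j then cnj (v r k) else 0) * indicator E \<theta>"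
      unfolding w_def[symmetric]
      by (rule is_fourier_AE_eq[OF square_integrable_imp_integrable[OF sE]])
  qed
qed

text \<open>For a fixed \<open>v\<close> the test functions reduce the frame inequalities to
  integrals over \<open>E\<close> at the single residue \<open>j0\<close>; as \<open>E\<close> is
  arbitrary, the integrands compare almost everywhere. The null set still depends on
  \<open>v\<close>.\<close>

lemma bounds_of_frame_sum:
  assumes g: "\<And>l. l < L \<Longrightarrow> g l \<in> ell2_vec S R" and S: "periodic_set N S"
    and AB: "0 \<le> A" "0 \<le> B" and j0: "j0 \<in> {0..<int M}"
    and frame: "\<And>f. f \<in> ell2_vec S R \<Longrightarrow>
      ennreal A * ennreal (Re (ell2_vec_inner R f f))
        \<le> (\<integral>\<^sup>+i. ennreal ((cmod (ell2_vec_inner R f (gabor M N g i)))\<^sup>2) \<partial>count_space (gabor_index L M)) \<and>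
      (\<integral>\<^sup>+i. ennreal ((cmod (ell2_vec_inner R f (gabor M N g i)))\<^sup>2) \<partial>count_space (gabor_index L M))
        \<le> ennreal B * ennreal (Re (ell2_vec_inner R f f))"
  shows "AE \<theta> in \<mu>. A / real M * support_form R S j0 v \<le> gram_form L R g j0 \<theta> v
    \<and> gram_form L R g j0 \<theta> v \<le> B / real M * support_form R S j0 v"
proof -
  let ?J = "{0..<int M}"
  let ?s = "support_form R S j0 v"
  let ?G = "\<lambda>\<theta>. gram_form L R g j0 \<theta> v"
  have E_bounds: "(\<integral>\<^sup>+\<theta>\<in>E. ennreal (A / real M * ?s) \<partial>\<mu>) \<le> (\<integral>\<^sup>+\<theta>\<in>E. ennreal (?G \<theta>) \<partial>\<mu>)
      \<and> (\<integral>\<^sup>+\<theta>\<in>E. ennreal (?G \<theta>) \<partial>\<mu>) \<le> (\<integral>\<^sup>+\<theta>\<in>E. ennreal (B / real M * ?s) \<partial>\<mu>)"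
    if E\<mu>: "E \<in> sets \<mu>" for E
  proof -
    have E: "E \<in> sets borel" using E\<mu> by (auto simp: sets_restrict_space)
    obtain f where f: "f \<in> ell2_vec S R"
      and zf: "\<And>r j k. r < R \<Longrightarrow> j \<in> {0..<int M} \<Longrightarrow> k < p \<Longrightarrow>
      AE \<theta> in \<mu>. zk (f r) (j + int k * int M) \<theta> =
        (if j = j0 \<and> k \<in> K_set p M S j then cnj (v r k) else 0) * indicator E \<theta>"
      using zak_test_function[OF S E j0, of R v] by blast
    let ?v = "\<lambda>j \<theta> r k. cnj (zk (f r) (j + int k * int M) \<theta>)"
    have ae: "AE \<theta> in \<mu>. \<forall>r\<in>{..<R}. \<forall>k\<in>{..<p}. zk (f r) (j + int k * int M) \<theta> =
        (if j = j0 \<and> k \<in> K_set p M S j then cnj (v r k) else 0) * indicator E \<theta>"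
      if "j \<in> ?J" for j
      by (intro AE_finite_allI zf that) auto
    \<comment> \<open>Outside \<open>K_set\<close> the test function has Zak transform 0 whereas
      \<open>v\<close> is arbitrary. The Zak transforms of \<open>g\<close> vanish there too,
      \<open>S\<close> being \<open>N\<close>-periodic, so these entries of \<open>v\<close> do not
      affect the Gram form.\<close>
    have out: "AE \<theta> in \<mu>. \<forall>l\<in>{..<L}. \<forall>r\<in>{..<R}. \<forall>s\<in>{..<q}. \<forall>k\<in>{..<p} - K_set p M S j0.
        zk (g l r) (j0 + int k * int M - int s * int N) \<theta> = 0"
    proof (intro AE_finite_allI)
      fix l r s k assume a: "l \<in> {..<L}" "r \<in> {..<R}" "k \<in> {..<p} - K_set p M S j0"
      then have "j0 + int k * int M - int s * int N \<notin> S"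
        using periodic_set_add[OF S, of "j0 + int k * int M" "- int s"] by (simp add: K_set_def)
      then show "AE \<theta> in \<mu>. zk (g l r) (j0 + int k * int M - int s * int N) \<theta> = 0"
        using a by (intro zak_AE_eq_0_outside[OF ell2_vecD[OF g] S]) auto
    qed auto
    have gram: "(\<integral>\<^sup>+\<theta>. ennreal (gram_form L R g j \<theta> (?v j \<theta>)) \<partial>\<mu>)
        = (if j = j0 then \<integral>\<^sup>+\<theta>\<in>E. ennreal (?G \<theta>) \<partial>\<mu> else 0)" if j: "j \<in> ?J" for j
    proof -
      have "(\<integral>\<^sup>+\<theta>. ennreal (gram_form L R g j \<theta> (?v j \<theta>)) \<partial>\<mu>)
        = (\<integral>\<^sup>+\<theta>. (if j = j0 then ennreal (?G \<theta>) * indicator E \<theta> else 0) \<partial>\<mu>)"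
      proof (rule nn_integral_cong_AE)
        show "AE \<theta> in \<mu>. ennreal (gram_form L R g j \<theta> (?v j \<theta>))
            = (if j = j0 then ennreal (?G \<theta>) * indicator E \<theta> else 0)"
          using ae[OF j] out
        proof eventually_elim
          case (elim \<theta>)
          have "gram_form L R g j \<theta> (?v j \<theta>) = (if j = j0 \<and> \<theta> \<in> E then ?G \<theta> else 0)"
          proof (cases "j = j0 \<and> \<theta> \<in> E")
            case True
            have "(\<Sum>r<R. \<Sum>k<p. zk (g l r) (j + int k * int M - int s * int N) \<theta> * ?v j \<theta> r k)
              = (\<Sum>r<R. \<Sum>k<p. zk (g l r) (j0 + int k * int M - int s * int N) \<theta> * v r k)"
              if "l < L" "s < q" for l s
              using True elim that by (intro sum.cong refl) auto
            then show ?thesis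
              using True by (simp add: gram_form_def)
          next
            case False
            then have "?v j \<theta> r k = 0" if "r < R" "k < p" for r k
              using elim(1) that by auto
            then show ?thesis
              unfolding if_not_P[OF False] by (simp add: gram_form_def)
          qed
          then show ?case by simp
        qed
      qed
      then show ?thesis by simp
    qed
    have norm: "(\<integral>\<^sup>+\<theta>. ennreal (\<Sum>r<R. \<Sum>k<p. (cmod (zk (f r) (j + int k * int M) \<theta>))\<^sup>2) \<partial>\<mu>)
        = (if j = j0 then \<integral>\<^sup>+\<theta>\<in>E. ennreal ?s \<partial>\<mu> else 0)" if j: "j \<in> ?J" for j
    proof -
      have "(\<integral>\<^sup>+\<theta>. ennreal (\<Sum>r<R. \<Sum>k<p. (cmod (zk (f r) (j + int k * int M) \<theta>))\<^sup>2) \<partial>\<mu>)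
        = (\<integral>\<^sup>+\<theta>. (if j = j0 then ennreal ?s * indicator E \<theta> else 0) \<partial>\<mu>)"
      proof (rule nn_integral_cong_AE)
        show "AE \<theta> in \<mu>. ennreal (\<Sum>r<R. \<Sum>k<p. (cmod (zk (f r) (j + int k * int M) \<theta>))\<^sup>2)
            = (if j = j0 then ennreal ?s * indicator E \<theta> else 0)"
          using ae[OF j]
        proof eventually_elim
          case (elim \<theta>)
          have "(\<Sum>r<R. \<Sum>k<p. (cmod (zk (f r) (j + int k * int M) \<theta>))\<^sup>2) = (if j = j0 \<and> \<theta> \<in> E then ?s else 0)"
          proof (cases "j = j0 \<and> \<theta> \<in> E")
            case True
            have "(\<Sum>k<p. (cmod (zk (f r) (j + int k * int M) \<theta>))\<^sup>2) = (\<Sum>k\<in>K_set p M S j0. (cmod (v r k))\<^sup>2)"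
              if "r < R" for r
              using True elim that
              by (intro sum.mono_neutral_cong_right) (auto simp: K_set_def)
            then show ?thesis
              using True by (simp add: support_form_def)
          next
            case False
            then have "zk (f r) (j + int k * int M) \<theta> = 0" if "r < R" "k < p" for r k
              using elim that by auto
            then show ?thesis
              unfolding if_not_P[OF False] by simp
          qed
          then show ?case by simp
        qed
      qed
      then show ?thesis by simp
    qed
    have T: "(\<integral>\<^sup>+i. ennreal ((cmod (ell2_vec_inner R f (gabor M N g i)))\<^sup>2) \<partial>count_space (gabor_index L M))
      = ennreal (real M) * (\<integral>\<^sup>+\<theta>\<in>E. ennreal (?G \<theta>) \<partial>\<mu>)"
      using j0 by (subst gabor_frame_sum[OF f g]) (simp_all add: gram)
    have I: "ennreal (Re (ell2_vec_inner R f f)) = (\<integral>\<^sup>+\<theta>\<in>E. ennreal ?s \<partial>\<mu>)"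
      using j0 by (subst ell2_vec_norm[OF f]) (simp add: norm del: sum_ennreal)
    have scale: "ennreal C * (\<integral>\<^sup>+\<theta>\<in>E. ennreal ?s \<partial>\<mu>) = ennreal (real M) * (\<integral>\<^sup>+\<theta>\<in>E. ennreal (C / real M * ?s) \<partial>\<mu>)"
      if "C \<ge> 0" for C
    proof -
      have "(\<integral>\<^sup>+\<theta>\<in>E. ennreal c \<partial>\<mu>) = ennreal c * emeasure \<mu> E" for c
        using E\<mu> by (rule nn_integral_cmult_indicator)
      moreover have "ennreal C * ennreal ?s = ennreal (real M) * ennreal (C / real M * ?s)"
        using that M_pos support_form_nonneg[of R S j0 v] by (simp flip: ennreal_mult)
      ultimately show ?thesis
        by (simp only: mult.assoc[symmetric])
    qed
    have M0: "ennreal (real M) \<noteq> 0" "ennreal (real M) \<noteq> \<infinity>"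
      using M_pos by auto
    show ?thesis
      using frame[OF f] M0
      unfolding T I scale[OF AB(1)] scale[OF AB(2)]
      by (simp add: ennreal_mult_le_mult_iff)
  qed
  \<comment> \<open>One of the two integrands compared below is constant, hence of finite integral;
    this supplies the finiteness condition of \<open>AE_le_of_set_nn_integral_le\<close>.\<close>
  have const: "(\<integral>\<^sup>+\<theta>. ennreal c \<partial>\<mu>) < \<infinity>" for c
    by (simp add: space_unit_lebesgue emeasure_restrict_space)
  note mG = gram_form_measurable[OF g, where j = j0 and v = v]
  have "AE \<theta> in \<mu>. A / real M * ?s \<le> ?G \<theta>"
    by (rule AE_le_of_set_nn_integral_le)
       (use E_bounds const mG AB in \<open>auto simp: gram_form_nonneg support_form_nonneg\<close>)
  moreover have "AE \<theta> in \<mu>. ?G \<theta> \<le> B / real M * ?s"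
    by (rule AE_le_of_set_nn_integral_le)
       (use E_bounds const mG AB in \<open>auto simp: gram_form_nonneg support_form_nonneg\<close>)
  ultimately show ?thesis by eventually_elim simp
qed

text \<open>Lists of pairs of rationals form a countable type, so almost everywhere statements for
  all of them share a null set.\<close>

definition rational_vec :: "(rat \<times> rat) list \<Rightarrow> nat \<Rightarrow> nat \<Rightarrow> complex" where
  "rational_vec xs r k = Complex (of_rat (fst (xs ! (r * p + k)))) (of_rat (snd (xs ! (r * p + k))))"

lemma rational_vec_dense:
  assumes "e > 0"
  obtains xs where "\<And>r k. r < R \<Longrightarrow> k < p \<Longrightarrow> cmod (rational_vec xs r k - v r k) < e"
proof -
  have "\<exists>a. cmod (Complex (of_rat (fst a)) (of_rat (snd a)) - z) < e" for z
  proof -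
    obtain a where a: "Re z < of_rat a" "of_rat a < Re z + e / 2"
      using of_rat_dense[of "Re z" "Re z + e / 2"] \<open>e > 0\<close> by auto
    obtain b where b: "Im z < of_rat b" "of_rat b < Im z + e / 2"
      using of_rat_dense[of "Im z" "Im z + e / 2"] \<open>e > 0\<close> by auto
    have "cmod (Complex (of_rat a) (of_rat b) - z) \<le> \<bar>of_rat a - Re z\<bar> + \<bar>of_rat b - Im z\<bar>"
      using cmod_le[of "Complex (of_rat a) (of_rat b) - z"] by simp
    also have "\<dots> < e" using a b by simp
    finally show ?thesis by (intro exI[of _ "(a, b)"]) simp
  qed
  then obtain c where c: "\<And>z. cmod (Complex (of_rat (fst (c z))) (of_rat (snd (c z))) - z) < e"
    by metis
  let ?xs = "map (\<lambda>i. c (v (i div p) (i mod p))) [0..<R * p]"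
  show thesis
  proof (rule that)
    fix r k assume rk: "r < R" "k < p"
    have "r * p + k < Suc r * p" using rk by simp
    also have "\<dots> \<le> R * p" using rk by (intro mult_right_mono) auto
    finally have "?xs ! (r * p + k) = c (v r k)"
      using rk by simp
    then show "cmod (rational_vec ?xs r k - v r k) < e"
      using c by (simp add: rational_vec_def)
  qed
qed

text \<open>Both forms are continuous in the finitely many entries of \<open>v\<close>, and
  non-strict inequalities survive the limit.\<close>

lemma zak_bounds_rational:
  assumes H: "\<And>xs. a * support_form R S j (rational_vec xs) \<le> gram_form L R g j \<theta> (rational_vec xs)
      \<and> gram_form L R g j \<theta> (rational_vec xs) \<le> b * support_form R S j (rational_vec xs)"
  shows "zak_bounds L R S g a b j \<theta>"
  unfolding zak_bounds_def
proof
  fix v :: "nat \<Rightarrow> nat \<Rightarrow> complex"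
  have "\<exists>xs. \<forall>r<R. \<forall>k<p. cmod (rational_vec xs r k - v r k) < inverse (real (Suc n))" for n
    using rational_vec_dense[of "inverse (real (Suc n))" R v] by (metis inverse_positive_iff_positive of_nat_0_less_iff zero_less_Suc)
  then obtain xs where xs: "\<And>n r k. r < R \<Longrightarrow> k < p \<Longrightarrow>
      cmod (rational_vec (xs n) r k - v r k) < inverse (real (Suc n))"
    by metis
  have lim: "(\<lambda>n. rational_vec (xs n) r k) \<longlonglongrightarrow> v r k" if "r < R" "k < p" for r k
  proof -
    have "(\<lambda>n. rational_vec (xs n) r k - v r k) \<longlonglongrightarrow> 0"
      by (rule Lim_null_comparison[OF _ LIMSEQ_inverse_real_of_nat])
         (use xs[OF that] in \<open>auto intro!: always_eventually less_imp_le\<close>)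
    then show ?thesis by (simp add: LIM_zero_iff)
  qed
  have s: "(\<lambda>n. support_form R S j (rational_vec (xs n))) \<longlonglongrightarrow> support_form R S j v"
    unfolding support_form_def
    by (intro tendsto_sum tendsto_power tendsto_norm lim) (auto simp: K_set_def)
  have G: "(\<lambda>n. gram_form L R g j \<theta> (rational_vec (xs n))) \<longlonglongrightarrow> gram_form L R g j \<theta> v"
    unfolding gram_form_def
    by (intro tendsto_sum tendsto_power tendsto_norm tendsto_mult tendsto_const lim) auto
  have "a * support_form R S j v \<le> gram_form L R g j \<theta> v"
    by (rule LIMSEQ_le[OF tendsto_mult[OF tendsto_const s] G]) (use H in auto)
  moreover have "gram_form L R g j \<theta> v \<le> b * support_form R S j v"
    by (rule LIMSEQ_le[OF G tendsto_mult[OF tendsto_const s]]) (use H in auto)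
  ultimately show "a * support_form R S j v \<le> gram_form L R g j \<theta> v
      \<and> gram_form L R g j \<theta> v \<le> b * support_form R S j v" ..
qed

section \<open>Invariance of the bounds under translations of \<open>j\<close>\<close>

lemma support_form_alt:
  "support_form R S j v = (\<Sum>r<R. \<Sum>k<p. if j + int k * int M \<in> S then (cmod (v r k))\<^sup>2 else 0)"
  unfolding support_form_def
  by (intro sum.cong refl sum.mono_neutral_cong_left) (auto simp: K_set_def)

text \<open>One null set serves all \<open>l\<close>, \<open>r\<close>, \<open>x\<close> and
  \<open>c\<close>, as these range over countable sets. Hence the translation lemmas can be proved,
  and iterated, at a fixed \<open>\<theta>\<close>.\<close>

definition quasi_periodic_at :: "nat \<Rightarrow> nat \<Rightarrow> (nat \<Rightarrow> nat \<Rightarrow> int \<Rightarrow> complex) \<Rightarrow> real \<Rightarrow> bool" where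
  "quasi_periodic_at L R g \<theta> \<longleftrightarrow> (\<forall>l<L. \<forall>r<R. \<forall>x c.
     zk (g l r) (x + c * int (p * M)) \<theta> = fexp (- c) \<theta> * zk (g l r) x \<theta>)"

lemma AE_quasi_periodic:
  assumes g: "\<And>l. l < L \<Longrightarrow> g l \<in> ell2_vec S R"
  shows "AE \<theta> in \<mu>. quasi_periodic_at L R g \<theta>"
proof -
  have "AE \<theta> in \<mu>. \<forall>l\<in>{..<L}. \<forall>r\<in>{..<R}. \<forall>x c.
     zk (g l r) (x + c * int (p * M)) \<theta> = fexp (- c) \<theta> * zk (g l r) x \<theta>"
    by (intro AE_finite_allI AE_all_countable[THEN iffD2] allI zak_quasi_periodic[OF ell2_vecD[OF g] pM_pos]) auto
  then show ?thesis
    by eventually_elim (simp add: quasi_periodic_at_def)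
qed

text \<open>Shifting \<open>j\<close> by \<open>M\<close> permutes the columns of each block cyclically, up to a unimodular factor
  in the column that wraps around.\<close>

lemma zak_bounds_add_M:
  assumes S: "periodic_set N S" and qp: "quasi_periodic_at L R g \<theta>"
    and b: "zak_bounds L R S g a b j \<theta>"
  shows "zak_bounds L R S g a b (j + int M) \<theta>"
  unfolding zak_bounds_def
proof
  fix v :: "nat \<Rightarrow> nat \<Rightarrow> complex"
  \<comment> \<open>The column past the last one is column 0 times
    \<open>fexp (- 1) \<theta>\<close>, so the last entry of \<open>v\<close> moves to position 0
    with that factor.\<close>
  define w where "w r k = (case k of 0 \<Rightarrow> fexp (- 1) \<theta> * v r (p - 1) | Suc k \<Rightarrow> v r k)" for r k
  obtain p' where p': "p = Suc p'" using p_pos by (cases p) auto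
  have wrap: "zk (g l r) (x + int p * int M) \<theta> = fexp (- 1) \<theta> * zk (g l r) x \<theta>" if "l < L" "r < R" for l r x
    using qp that unfolding quasi_periodic_at_def by (metis mult_1 of_nat_mult)
  have "(\<Sum>k<p. zk (g l r) (j + int M + int k * int M - int s * int N) \<theta> * v r k)
      = (\<Sum>k<p. zk (g l r) (j + int k * int M - int s * int N) \<theta> * w r k)" if "l < L" "r < R" for l r s
  proof -
    define X where "X k = zk (g l r) (j + int k * int M - int s * int N) \<theta>" for k
    have "j + int p * int M - int s * int N = (j - int s * int N) + int p * int M"
      by simp
    then have "X (Suc p') = fexp (- 1) \<theta> * X 0"
      by (simp only: X_def wrap[OF that] p'[symmetric]) simp
    then have "(\<Sum>k<p. X (Suc k) * v r k) = (\<Sum>k<p. X k * w r k)"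
      unfolding p' sum.lessThan_Suc_shift[of "\<lambda>k. X k * w r k" p']
      by (simp add: w_def p' add.commute)
    moreover have "zk (g l r) (j + int M + int k * int M - int s * int N) \<theta> = X (Suc k)" for k
      unfolding X_def by (simp add: algebra_simps)
    ultimately have "(\<Sum>k<p. zk (g l r) (j + int M + int k * int M - int s * int N) \<theta> * v r k)
        = (\<Sum>k<p. X k * w r k)"
      by (simp only:)
    then show ?thesis by (simp only: X_def)
  qed
  then have "gram_form L R g (j + int M) \<theta> v = gram_form L R g j \<theta> w"
    by (simp add: gram_form_def)
  moreover have "support_form R S (j + int M) v = support_form R S j w"
  proof -
    have "(\<Sum>k<p. if j + int M + int k * int M \<in> S then (cmod (v r k))\<^sup>2 else 0)
      = (\<Sum>k<p. if j + int k * int M \<in> S then (cmod (w r k))\<^sup>2 else 0)" for r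
    proof -
      define Y where "Y k \<longleftrightarrow> j + int k * int M \<in> S" for k
      \<comment> \<open>For the support the wrap-around is exact: \<open>j + p * M\<close> lies in
        \<open>S\<close> if and only if \<open>j\<close> does, and the unimodular factor disappears
        in the modulus.\<close>
      have "Y (Suc p') \<longleftrightarrow> Y 0"
        using periodic_set_pM[OF S, of j 1] by (simp add: Y_def p'[symmetric] del: of_nat_Suc)
      then have "(\<Sum>k<p. if Y (Suc k) then (cmod (v r k))\<^sup>2 else 0) = (\<Sum>k<p. if Y k then (cmod (w r k))\<^sup>2 else 0)"
        unfolding p' sum.lessThan_Suc_shift[of "\<lambda>k. if Y k then (cmod (w r k))\<^sup>2 else 0" p']
        by (simp add: w_def p' add.commute norm_mult cong: if_cong)
      moreover have "j + int M + int k * int M \<in> S \<longleftrightarrow> Y (Suc k)" for k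
        unfolding Y_def by (simp add: algebra_simps)
      ultimately have "(\<Sum>k<p. if j + int M + int k * int M \<in> S then (cmod (v r k))\<^sup>2 else 0)
        = (\<Sum>k<p. if Y k then (cmod (w r k))\<^sup>2 else 0)"
        by (simp only:)
      then show ?thesis by (simp only: Y_def)
    qed
    then show ?thesis by (simp add: support_form_alt)
  qed
  ultimately show "a * support_form R S (j + int M) v \<le> gram_form L R g (j + int M) \<theta> v
      \<and> gram_form L R g (j + int M) \<theta> v \<le> b * support_form R S (j + int M) v"
    using b by (simp add: zak_bounds_def)
qed

text \<open>Shifting \<open>j\<close> by \<open>- N\<close> permutes the rows cyclically, up to a unimodular factor.\<close>

lemma zak_bounds_diff_N:
  assumes S: "periodic_set N S" and qp: "quasi_periodic_at L R g \<theta>"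
    and b: "zak_bounds L R S g a b j \<theta>"
  shows "zak_bounds L R S g a b (j - int N) \<theta>"
  unfolding zak_bounds_def
proof
  fix v :: "nat \<Rightarrow> nat \<Rightarrow> complex"
  obtain q' where q': "q = Suc q'" using q_pos by (cases q) auto
  define F where "F l s = (cmod (\<Sum>r<R. \<Sum>k<p. zk (g l r) (j + int k * int M - int s * int N) \<theta> * v r k))\<^sup>2" for l s
  \<comment> \<open>Row \<open>q\<close> is row 0 times \<open>fexp 1 \<theta>\<close>, because
    \<open>q * N = p * M\<close>; the factor leaves the squared modulus unchanged. Here the vector
    \<open>v\<close> stays the same.\<close>
  have wrap: "F l q = F l 0" if "l < L" for l
  proof -
    have "zk (g l r) (j + int k * int M - int q * int N) \<theta> = fexp 1 \<theta> * zk (g l r) (j + int k * int M) \<theta>"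
      if "r < R" for r k
    proof -
      have "j + int k * int M - int q * int N = (j + int k * int M) + (- 1) * int (p * M)"
        by (simp flip: qN_eq_pM)
      then show ?thesis
        using qp \<open>l < L\<close> that unfolding quasi_periodic_at_def by (metis minus_minus)
    qed
    then have "(\<Sum>r<R. \<Sum>k<p. zk (g l r) (j + int k * int M - int q * int N) \<theta> * v r k)
      = fexp 1 \<theta> * (\<Sum>r<R. \<Sum>k<p. zk (g l r) (j + int k * int M) \<theta> * v r k)"
      by (simp add: sum_distrib_left mult.assoc)
    then show ?thesis by (simp add: F_def norm_mult)
  qed
  have "gram_form L R g (j - int N) \<theta> v = (\<Sum>l<L. \<Sum>s<q. F l (Suc s))"
    unfolding gram_form_def F_def
    by (intro sum.cong refl arg_cong[of _ _ "\<lambda>x. (cmod x)\<^sup>2"] arg_cong2[of _ _ _ _ "(*)"]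
        arg_cong[of _ _ "\<lambda>i. zk _ i \<theta>"]) (simp add: algebra_simps)
  also have "\<dots> = (\<Sum>l<L. \<Sum>s<q. F l s)"
  proof (rule sum.cong[OF refl])
    fix l assume "l \<in> {..<L}"
    then have "F l (Suc q') = F l 0" using wrap[of l] by (simp add: q')
    then show "(\<Sum>s<q. F l (Suc s)) = (\<Sum>s<q. F l s)"
      unfolding q' sum.lessThan_Suc_shift[of "F l" q'] by (simp add: add.commute)
  qed
  also have "\<dots> = gram_form L R g j \<theta> v"
    by (simp add: gram_form_def F_def)
  finally have "gram_form L R g (j - int N) \<theta> v = gram_form L R g j \<theta> v" .
  moreover have "support_form R S (j - int N) v = support_form R S j v"
  proof -
    have "j - int N + int k * int M \<in> S \<longleftrightarrow> j + int k * int M \<in> S" for k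
      using periodic_set_add[OF S, of "j + int k * int M" "- 1"] by (simp add: algebra_simps)
    then show ?thesis by (simp add: support_form_alt)
  qed
  ultimately show "a * support_form R S (j - int N) v \<le> gram_form L R g (j - int N) \<theta> v
      \<and> gram_form L R g (j - int N) \<theta> v \<le> b * support_form R S (j - int N) v"
    using b by (simp add: zak_bounds_def)
qed

text \<open>The two shifts are iterated in the directions \<open>+ M\<close> and \<open>- N\<close>
  only, which is why natural coefficients are sought below.\<close>

lemma zak_bounds_translate:
  assumes S: "periodic_set N S" and qp: "quasi_periodic_at L R g \<theta>"
    and b: "zak_bounds L R S g a b j \<theta>"
  shows "zak_bounds L R S g a b (j + int m * int M - int n * int N) \<theta>"
proof -
  have 1: "zak_bounds L R S g a b (j + int m * int M) \<theta>" for m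
  proof (induction m)
    case (Suc m)
    from zak_bounds_add_M[OF S qp this] show ?case by (simp add: algebra_simps)
  qed (use b in simp)
  show ?thesis
  proof (induction n)
    case (Suc n)
    from zak_bounds_diff_N[OF S qp this] show ?case by (simp add: algebra_simps)
  qed (use 1 in simp)
qed

end

text \<open>Bezout coefficients may be negative. Adding \<open>int p * t\<close> to the coefficient
  of \<open>q\<close> and \<open>int q * t\<close> to that of \<open>p\<close> makes both
  nonnegative and cancels in the difference.\<close>

lemma coprime_nat_combination:
  assumes "coprime p q" "p \<ge> 1" "q \<ge> 1"
  obtains a b :: nat where "int a * int q - int b * int p = u"
proof -
  obtain x y :: int where xy: "x * int q + y * int p = 1"
    using bezout_int[of "int q" "int p"] assms(1) by (auto simp: coprime_iff_gcd_eq_1 gcd.commute)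
  \<comment> \<open>Large enough for both coefficients at once, since \<open>p\<close> and
    \<open>q\<close> are at least 1.\<close>
  define t where "t = \<bar>x * u\<bar> + \<bar>y * u\<bar>"
  have "\<bar>x * u\<bar> \<le> t" "\<bar>y * u\<bar> \<le> t" "t \<ge> 0"
    by (simp_all add: t_def)
  moreover from \<open>t \<ge> 0\<close> have "t \<le> int p * t" "t \<le> int q * t"
    using assms mult_right_mono[of 1 "int p" t] mult_right_mono[of 1 "int q" t] by simp_all
  ultimately have "x * u + int p * t \<ge> 0" "- (y * u) + int q * t \<ge> 0"
    by linarith+
  then have "int (nat (x * u + int p * t)) * int q - int (nat (- (y * u) + int q * t)) * int p
      = (x * int q + y * int p) * u"
    by (simp add: algebra_simps)
  also have "\<dots> = u" by (simp add: xy)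
  finally show thesis by (rule that)
qed

section \<open>The frame condition with values in [0, \<infinity>]\<close>

lemma AE_unit_lebesgue: "(AE \<theta>\<in>{0..<1} in lborel. P \<theta>) \<longleftrightarrow> (AE \<theta> in \<mu>. P \<theta>)"
  by (simp add: AE_restrict_space_iff)

lemma ell2_vec_inner_self_nonneg: "Re (ell2_vec_inner R f f) \<ge> 0"
proof -
  have "Re (ell2_inner h h) \<ge> 0" for h
  proof (cases "(\<lambda>j. (cmod (h j))\<^sup>2) summable_on UNIV")
    case True
    have "ell2_inner h h = of_real (\<Sum>\<^sub>\<infinity>j\<in>UNIV. (cmod (h j))\<^sup>2)"
      unfolding ell2_inner_def complex_norm_square[symmetric]
      by (rule infsumI, rule has_sum_of_real, rule has_sum_infsum, rule True)
    then show ?thesis by (simp add: infsum_nonneg)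
  next
    case False
    then have "\<not> (\<lambda>j. complex_of_real ((cmod (h j))\<^sup>2)) summable_on UNIV"
      using summable_on_Re[of "\<lambda>j. complex_of_real ((cmod (h j))\<^sup>2)" UNIV] by auto
    then have "ell2_inner h h = 0"
      unfolding ell2_inner_def complex_norm_square[symmetric] by (rule infsum_not_exists)
    then show ?thesis by simp
  qed
  then show ?thesis
    by (simp add: ell2_vec_inner_def sum_nonneg)
qed

text \<open>On the right, summability is implied by the finite upper bound, because a nonnegative
  family that is not summable has integral \<infinity>.\<close>

lemma frame_inequality_iff:
  fixes w :: "'a \<Rightarrow> real"
  assumes nn: "\<And>i. w i \<ge> 0" and "0 \<le> A" "0 \<le> B" "0 \<le> n"
  shows "w summable_on I \<and> A * n \<le> infsum w I \<and> infsum w I \<le> B * n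
    \<longleftrightarrow> ennreal A * ennreal n \<le> (\<integral>\<^sup>+i. ennreal (w i) \<partial>count_space I)
      \<and> (\<integral>\<^sup>+i. ennreal (w i) \<partial>count_space I) \<le> ennreal B * ennreal n"
proof (cases "w summable_on I")
  case True
  have "infsum w I \<ge> 0" using nn by (intro infsum_nonneg) auto
  with True assms show ?thesis
    by (simp add: ennreal_infsum[OF nn True, symmetric] ennreal_mult[symmetric])
next
  case False
  then have "(\<integral>\<^sup>+i. ennreal (w i) \<partial>count_space I) = \<infinity>"
    using nonneg_summable_on_iff_nn_integral[of w I] nn by (metis infinity_ennreal_def less_top)
  with False assms show ?thesis
    by (simp add: ennreal_mult[symmetric] top_unique)
qed

text \<open>Modulation multiplies by factors of modulus 1, and \<open>S\<close> is invariant under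
  translation by multiples of \<open>N\<close>.\<close>

lemma gabor_in_ell2_vec:
  assumes g: "\<And>l. l < L \<Longrightarrow> g l \<in> ell2_vec S R" and S: "periodic_set N S"
    and i: "i \<in> gabor_index L M"
  shows "gabor M N g i \<in> ell2_vec S R"
proof -
  obtain m n l where i: "i = (m, n, l)" "l < L"
    using i by (auto simp: gabor_index_def)
  have n: "cmod (exp (2 * of_real pi * \<i> * of_real (real m / real M) * of_int j)) = 1" for j :: int
    by (simp add: norm_exp_eq_Re)
  have "(\<lambda>j. exp (2 * of_real pi * \<i> * of_real (real m / real M) * of_int j) * g l r (j - n * int N)) \<in> ell2 S"
    if "g l r \<in> ell2 S" for r
  proof -
    have "j - n * int N \<in> S \<longleftrightarrow> j \<in> S" for j
      using periodic_set_add[OF S, of j "- n"] by simp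
    moreover have "(\<lambda>j. (cmod (g l r (j - n * int N)))\<^sup>2) summable_on UNIV"
      using that by (subst summable_on_shift) (simp add: ell2_def)
    ultimately show ?thesis
      using that by (simp add: ell2_def norm_mult n)
  qed
  then show ?thesis
    using g[OF i(2)] unfolding ell2_vec_def i gabor_def modulation_def translation_def
    by simp
qed

section \<open>The equivalences in terms of quadratic forms\<close>

context gabor_lattice
begin

theorem is_frame_iff_zak_bounds:
  assumes g: "\<And>l. l < L \<Longrightarrow> g l \<in> ell2_vec S R" and S: "periodic_set N S"
    and AB: "0 < A" "A \<le> B"
  shows "is_frame (ell2_vec S R) (ell2_vec_inner R) (gabor_index L M) (gabor M N g) A B
    \<longleftrightarrow> (\<forall>j\<in>{0..<int M}. AE \<theta> in \<mu>. zak_bounds L R S g (A / real M) (B / real M) j \<theta>)"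
proof -
  let ?T = "\<lambda>f. \<integral>\<^sup>+i. ennreal ((cmod (ell2_vec_inner R f (gabor M N g i)))\<^sup>2) \<partial>count_space (gabor_index L M)"
  let ?n = "\<lambda>f. ennreal (Re (ell2_vec_inner R f f))"
  have AB': "0 \<le> A" "0 \<le> B" using AB by auto
  have "countable (gabor_index L M)"
    by (simp add: gabor_index_def)
  then have "is_frame (ell2_vec S R) (ell2_vec_inner R) (gabor_index L M) (gabor M N g) A B
    \<longleftrightarrow> (\<forall>f\<in>ell2_vec S R. ennreal A * ?n f \<le> ?T f \<and> ?T f \<le> ennreal B * ?n f)"
    unfolding is_frame_def
    using AB gabor_in_ell2_vec[OF g S]
    by (subst frame_inequality_iff) (auto simp: AB' ell2_vec_inner_self_nonneg)
  also have "\<dots> \<longleftrightarrow> (\<forall>j\<in>{0..<int M}. AE \<theta> in \<mu>. zak_bounds L R S g (A / real M) (B / real M) j \<theta>)"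
  proof (intro iffI ballI)
    fix j
    assume frame: "\<forall>f\<in>ell2_vec S R. ennreal A * ?n f \<le> ?T f \<and> ?T f \<le> ennreal B * ?n f"
      and j: "j \<in> {0..<int M}"
    \<comment> \<open>Each list has its own null set; countability of the type of \<open>xs\<close>
      unites them.\<close>
    have "AE \<theta> in \<mu>. \<forall>xs. A / real M * support_form R S j (rational_vec xs) \<le> gram_form L R g j \<theta> (rational_vec xs)
      \<and> gram_form L R g j \<theta> (rational_vec xs) \<le> B / real M * support_form R S j (rational_vec xs)"
      unfolding AE_all_countable
      by (intro allI bounds_of_frame_sum[OF g S AB' j]) (use frame in blast)+
    then show "AE \<theta> in \<mu>. zak_bounds L R S g (A / real M) (B / real M) j \<theta>"
      by eventually_elim (rule zak_bounds_rational, blast)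
  next
    fix f
    assume bounds: "\<forall>j\<in>{0..<int M}. AE \<theta> in \<mu>. zak_bounds L R S g (A / real M) (B / real M) j \<theta>"
      and f: "f \<in> ell2_vec S R"
    have "ennreal A * ?n f \<le> ?T f"
      by (rule frame_sum_bounds(1)[OF f _ S AB']) (use g bounds in blast)+
    moreover have "?T f \<le> ennreal B * ?n f"
      by (rule frame_sum_bounds(2)[OF f _ S AB']) (use g bounds in blast)+
    ultimately show "ennreal A * ?n f \<le> ?T f \<and> ?T f \<le> ennreal B * ?n f" ..
  qed
  finally show ?thesis .
qed

text \<open>Coprimality turns \<open>q dvd p * M\<close> into \<open>q dvd M\<close>, so
  \<open>M = q * d\<close> and \<open>N = p * d\<close> with \<open>d = M div q\<close>. Every
  \<open>j\<close> is then reached from \<open>j mod int d\<close> by adding multiples of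
  \<open>M\<close> and subtracting multiples of \<open>N\<close>.\<close>

theorem zak_bounds_reduced_range:
  assumes g: "\<And>l. l < L \<Longrightarrow> g l \<in> ell2_vec S R" and S: "periodic_set N S" and "coprime p q"
  shows "(\<forall>j\<in>{0..<int (M div q)}. AE \<theta> in \<mu>. zak_bounds L R S g a b j \<theta>)
    \<longleftrightarrow> (\<forall>j\<in>{0..<int M}. AE \<theta> in \<mu>. zak_bounds L R S g a b j \<theta>)"
proof (intro iffI ballI)
  fix j
  assume "\<forall>j\<in>{0..<int M}. AE \<theta> in \<mu>. zak_bounds L R S g a b j \<theta>" and "j \<in> {0..<int (M div q)}"
  moreover have "int (M div q) \<le> int M" by simp
  ultimately show "AE \<theta> in \<mu>. zak_bounds L R S g a b j \<theta>"
    by (metis atLeastLessThan_iff order_less_le_trans)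
next
  fix j
  assume H: "\<forall>j\<in>{0..<int (M div q)}. AE \<theta> in \<mu>. zak_bounds L R S g a b j \<theta>"
  define d where "d = M div q"
  have "q dvd p * M" using qN_eq_pM by (metis dvd_triv_left)
  then have "q dvd M"
    using \<open>coprime p q\<close> by (simp add: coprime_commute coprime_dvd_mult_right_iff)
  then have M: "M = q * d" by (simp add: d_def)
  then have N: "N = p * d" using qN_eq_pM q_pos by simp
  have "d > 0" using M M_pos by (cases d) auto
  obtain m n :: nat where mn: "int m * int q - int n * int p = j div int d"
    using coprime_nat_combination[OF \<open>coprime p q\<close> p_pos q_pos] by blast
  have "j = j mod int d + (int m * int q - int n * int p) * int d"
    unfolding mn by simp
  also have "\<dots> = j mod int d + int m * int M - int n * int N"
    by (simp add: M N algebra_simps)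
  finally have j: "j = j mod int d + int m * int M - int n * int N" .
  have "j mod int d \<in> {0..<int (M div q)}"
    using \<open>d > 0\<close> by (simp add: d_def)
  with H have "AE \<theta> in \<mu>. zak_bounds L R S g a b (j mod int d) \<theta>" by blast
  moreover have "AE \<theta> in \<mu>. quasi_periodic_at L R g \<theta>"
    by (rule AE_quasi_periodic) (rule g)
  ultimately show "AE \<theta> in \<mu>. zak_bounds L R S g a b j \<theta>"
  proof eventually_elim
    case (elim \<theta>)
    show ?case
      by (subst j) (rule zak_bounds_translate[OF S elim(2,1)])
  qed
qed

end

theorem theorem3p9:
  fixes L M N R p q :: nat
    and S :: "int set"
    and g :: "nat \<Rightarrow> nat \<Rightarrow> int \<Rightarrow> complex"
    and A B :: real
  assumes "L \<ge> 1" "M \<ge> 1" "N \<ge> 1" "R \<ge> 1" "p \<ge> 1" "q \<ge> 1"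
    and "coprime p q" "real N / real M = real p / real q"
    and "periodic_set N S"
    and "\<And>l. l < L \<Longrightarrow> g l \<in> ell2_vec S R"
    and "0 < A" "A \<le> B"
  defines "frame \<equiv>
      is_frame (ell2_vec S R) (ell2_vec_inner R) (gabor_index L M) (gabor M N g) A B"
    and "bounds_at \<equiv> \<lambda>(j::int) (\<theta>::real).
      loewner_le (p * R) (complex_of_real (A / real M) \<cdot>\<^sub>m I_tensor R (K_mat p M S j))
        (zak_gram p q L M N R g j \<theta>) \<and>
      loewner_le (p * R) (zak_gram p q L M N R g j \<theta>)
        (complex_of_real (B / real M) \<cdot>\<^sub>m I_tensor R (K_mat p M S j))"
  shows "(frame \<longleftrightarrow> (\<forall>j\<in>{0..<int (M div q)}. AE \<theta>\<in>{0..<1} in lborel. bounds_at j \<theta>)) \<and>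
         (frame \<longleftrightarrow> (\<forall>j\<in>{0..<int M}. AE \<theta>\<in>{0..<1} in lborel. bounds_at j \<theta>))"
proof -
  have "q * N = p * M"
  proof -
    have "real q * real N = real p * real M"
      using assms(2,6,8) by (simp add: field_simps)
    then show ?thesis by (metis of_nat_eq_iff of_nat_mult)
  qed
  then interpret gabor_lattice M N p q
    using assms by unfold_locales
  have b: "bounds_at j \<theta> \<longleftrightarrow> zak_bounds L R S g (A / real M) (B / real M) j \<theta>" for j \<theta>
    unfolding bounds_at_def zak_bounds_def by (rule loewner_bounds_iff)
  have "frame \<longleftrightarrow> (\<forall>j\<in>{0..<int M}. AE \<theta> in \<mu>. zak_bounds L R S g (A / real M) (B / real M) j \<theta>)"
    unfolding frame_def by (rule is_frame_iff_zak_bounds) (use assms in auto)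
  moreover have "(\<forall>j\<in>{0..<int (M div q)}. AE \<theta> in \<mu>. zak_bounds L R S g (A / real M) (B / real M) j \<theta>)
    \<longleftrightarrow> (\<forall>j\<in>{0..<int M}. AE \<theta> in \<mu>. zak_bounds L R S g (A / real M) (B / real M) j \<theta>)"
    by (rule zak_bounds_reduced_range) (use assms in auto)
  ultimately show ?thesis
    unfolding AE_unit_lebesgue b by blast
qed

end
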